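(* Let $0<\theta_0\le\pi$, $R>0$, and $\Omega_R=\{(r\cos\theta,r\sin\theta):0<r<R,\ |\theta|<\theta_0\}$. Let $u_R\in H^1_0(\Omega_R)$ be the unique variational solution of $-\Delta u_R=\mathrm{e}^{-u_R}$ in $\Omega_R$, $u_R=0$ on $\partial\Omega_R$. Then, for every $r\in(0,R)$, the map $\theta\mapsto u_R(r,\theta)$ achieves its maximum at $\theta=0$.
   Context: The variational solution satisfies $\int_{\Omega_R}\nabla u_R\cdot\nabla v=\int_{\Omega_R}\mathrm{e}^{-u_R}v$ for all $v\in H^1_0(\Omega_R)$; it is known to exist, to be unique, positive, and symmetric with respect to $\theta\mapsto-\theta$. *)

theory Defs
  imports "HOL-Analysis.Analysis"
begin

primrec Ck :: "nat \<Rightarrow> ('a::euclidean_space \<Rightarrow> real) \<Rightarrow> bool" where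
  "Ck 0 f \<longleftrightarrow> continuous_on UNIV f"
| "Ck (Suc k) f \<longleftrightarrow>
     (\<forall>x. f differentiable (at x)) \<and> (\<forall>b\<in>Basis. Ck k (\<lambda>x. frechet_derivative f (at x) b))"

definition gradient :: "('a::euclidean_space \<Rightarrow> real) \<Rightarrow> 'a \<Rightarrow> 'a" where
  "gradient f x = (\<Sum>b\<in>Basis. frechet_derivative f (at x) b *\<^sub>R b)"

text \<open>The space of smooth functions with compact support in \<open>\<Omega>\<close>, whose elements are
  represented by their extension by zero to the whole space.\<close>

definition test_functions :: "'a::euclidean_space set \<Rightarrow> ('a \<Rightarrow> real) set" where
  "test_functions \<Omega> =
     {\<phi>. (\<forall>k. Ck k \<phi>) \<and> (\<exists>K. compact K \<and> K \<subseteq> \<Omega> \<and> (\<forall>x. x \<notin> K \<longrightarrow> \<phi> x = 0))}"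

text \<open>Elements of the Lebesgue and Sobolev spaces below are functions rather than classes of
  functions modulo null sets. Membership depends only on the values almost everywhere in \<open>\<Omega>\<close>.\<close>

definition L2 :: "'a::euclidean_space set \<Rightarrow> ('a \<Rightarrow> 'b::euclidean_space) set" where
  "L2 \<Omega> = {f. f \<in> borel_measurable (lebesgue_on \<Omega>) \<and>
              integrable (lebesgue_on \<Omega>) (\<lambda>x. (norm (f x))\<^sup>2)}"

definition is_weak_gradient ::
    "'a::euclidean_space set \<Rightarrow> ('a \<Rightarrow> real) \<Rightarrow> ('a \<Rightarrow> 'a) \<Rightarrow> bool" where
  "is_weak_gradient \<Omega> u g \<longleftrightarrow>
     (\<forall>\<phi>\<in>test_functions \<Omega>.
        (\<integral>x. u x *\<^sub>R gradient \<phi> x \<partial>lebesgue_on \<Omega>) = - (\<integral>x. \<phi> x *\<^sub>R g x \<partial>lebesgue_on \<Omega>))"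

definition H1 :: "'a::euclidean_space set \<Rightarrow> ('a \<Rightarrow> real) set" where
  "H1 \<Omega> = {u \<in> L2 \<Omega>. \<exists>g\<in>L2 \<Omega>. is_weak_gradient \<Omega> u g}"

text \<open>For \<open>u \<in> H1 \<Omega>\<close> the weak gradient is unique up to null sets, so the choice made here does not
  affect any integral in which it occurs.\<close>

definition weak_gradient :: "'a::euclidean_space set \<Rightarrow> ('a \<Rightarrow> real) \<Rightarrow> 'a \<Rightarrow> 'a" where
  "weak_gradient \<Omega> u = (SOME g. g \<in> L2 \<Omega> \<and> is_weak_gradient \<Omega> u g)"

definition H1_norm :: "'a::euclidean_space set \<Rightarrow> ('a \<Rightarrow> real) \<Rightarrow> real" where
  "H1_norm \<Omega> u =
     sqrt ((\<integral>x. (u x)\<^sup>2 \<partial>lebesgue_on \<Omega>) + (\<integral>x. (norm (weak_gradient \<Omega> u x))\<^sup>2 \<partial>lebesgue_on \<Omega>))"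

text \<open>\<open>H\<^sup>1\<^sub>0(\<Omega>)\<close> is the closure of the test functions in \<open>H\<^sup>1(\<Omega>)\<close>. This encodes the homogeneous
  Dirichlet condition on the boundary of \<open>\<Omega>\<close>.\<close>

definition H10 :: "'a::euclidean_space set \<Rightarrow> ('a \<Rightarrow> real) set" where
  "H10 \<Omega> = {u \<in> H1 \<Omega>. \<forall>\<epsilon>>0. \<exists>\<phi>\<in>test_functions \<Omega>. H1_norm \<Omega> (\<lambda>x. u x - \<phi> x) < \<epsilon>}"

text \<open>Variational solutions of \<open>- \<Delta> u = exp (- u)\<close> in \<open>\<Omega>\<close>, \<open>u = 0\<close> on the boundary. The
  integrability condition says that the right-hand side is a convergent integral; the left-hand
  side always is one, the weak gradients being square-integrable.\<close>

definition variational_solution :: "'a::euclidean_space set \<Rightarrow> ('a \<Rightarrow> real) \<Rightarrow> bool" where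
  "variational_solution \<Omega> u \<longleftrightarrow> u \<in> H10 \<Omega> \<and>
     (\<forall>v\<in>H10 \<Omega>. integrable (lebesgue_on \<Omega>) (\<lambda>x. exp (- u x) * v x) \<and>
        (\<integral>x. weak_gradient \<Omega> u x \<bullet> weak_gradient \<Omega> v x \<partial>lebesgue_on \<Omega>) =
        (\<integral>x. exp (- u x) * v x \<partial>lebesgue_on \<Omega>))"

definition polar :: "real \<Rightarrow> real \<Rightarrow> real \<times> real" where
  "polar r \<theta> = (r * cos \<theta>, r * sin \<theta>)"

definition sector :: "real \<Rightarrow> real \<Rightarrow> (real \<times> real) set" where
  "sector \<theta>\<^sub>0 R = {polar r \<theta> | r \<theta>. 0 < r \<and> r < R \<and> \<bar>\<theta>\<bar> < \<theta>\<^sub>0}"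

text \<open>On an open set \<open>\<Omega>\<close>, a continuous representative is unique on \<open>\<Omega>\<close>. Pointwise values of a
  Sobolev function are those of its continuous representative.\<close>

definition continuous_representative ::
    "'a::euclidean_space set \<Rightarrow> ('a \<Rightarrow> real) \<Rightarrow> ('a \<Rightarrow> real) \<Rightarrow> bool" where
  "continuous_representative \<Omega> u w \<longleftrightarrow>
     continuous_on \<Omega> w \<and> (AE x in lebesgue_on \<Omega>. w x = u x)"

end

theory Submission
  imports Defs
begin

text \<open>The map \<open>\<theta> \<mapsto> u(r, \<theta>)\<close> is compared with its reflections. Let \<open>n\<close> be a unit vector with
  nonnegative first component and \<open>\<sigma>\<close> the reflection in the line orthogonal to \<open>n\<close>. Since
  \<open>\<Omega> = {x. |x| < R, |x| cos \<theta>\<^sub>0 < x\<^sub>1}\<close> and \<open>\<sigma>\<close> keeps the norm, a point \<open>x\<close> with \<open>x \<bullet> n \<ge> 0\<close> and \<open>\<sigma> x \<in> \<Omega>\<close>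
  lies in \<open>\<Omega>\<close>. Hence, as \<open>u \<ge> 0\<close>, the function \<open>w = (u - u \<circ> \<sigma>)\<^sup>+\<close>, restricted to the half-plane \<open>x \<bullet> n < 0\<close>, and \<open>w \<circ> \<sigma>\<close> both
  vanish outside \<open>\<Omega>\<close>, and the equation tested with \<open>w - w \<circ> \<sigma>\<close> gives
  \<open>\<integral> |\<nabla>w|\<^sup>2 = \<integral> (exp (- u) - exp (- u \<circ> \<sigma>)) w \<le> 0\<close>. So \<open>u \<le> u \<circ> \<sigma>\<close> where \<open>x \<bullet> n < 0\<close>
  (\<open>reflection_comparison\<close>). For given \<open>r\<close> and \<open>\<theta> \<noteq> 0\<close>, choosing \<open>n\<close> as the direction from \<open>(r, \<theta>)\<close> to
  \<open>(r, 0)\<close> makes \<open>\<sigma>\<close> exchange these two points, which is the claim once \<open>u\<close> is continuous.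

  Truncations of Sobolev functions are avoided altogether. The solution is approximated by
  test functions \<open>\<phi>\<close>, and the positive part is replaced by the smooth function \<open>t exp (- \<epsilon> / t)\<close>
  for \<open>t > 0\<close>, extended by \<open>0\<close>. It is flat at \<open>0\<close>, so a composite that vanishes on a line stays
  smooth when it is cut off at that line (\<open>smooth_cut_halfspace\<close>); its slope lies in \<open>[0, 1]\<close>, so
  composing with it does not increase gradients. Thus \<open>w - w \<circ> \<sigma>\<close>, built from \<open>\<phi>\<close> instead of
  \<open>u\<close>, is itself a test function, and \<open>defect_bound\<close> says that \<open>\<phi>\<close> satisfies the equation up to a
  small error. For its support to lie in \<open>\<Omega>\<close> the function \<open>\<phi>\<close> must be nonnegative. The same device
  shows that \<open>u \<ge> 0\<close> (\<open>AE_nonneg\<close>) and that \<open>\<phi>\<close> may be chosen nonnegative (\<open>approx_nonneg\<close>).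

  Continuity of \<open>u\<close> inside \<open>\<Omega>\<close> uses of the equation only that \<open>\<Delta>u = - exp (- u)\<close> is bounded. Testing with
  translates of \<open>\<eta>(z) ln (|z|\<^sup>2 + \<epsilon>)\<close>, where \<open>\<eta>\<close> is a cutoff function, expresses the convolution of
  \<open>u\<close> with an approximate identity by convolutions that converge uniformly as \<open>\<epsilon> \<rightarrow> 0\<close>; the limit is
  continuous and equals a multiple of \<open>u\<close> almost everywhere (\<open>local_continuity\<close>).\<close>

section \<open>Calculus of the classes \<open>Ck\<close>\<close>

lemma Ck_SucI:
  assumes "\<And>x. (f has_derivative D x) (at x)" and "\<And>b. b \<in> Basis \<Longrightarrow> Ck k (\<lambda>x. D x b)"
  shows "Ck (Suc k) f"
proof -
  have "frechet_derivative f (at x) = D x" for x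
    using assms(1)[of x] by (metis frechet_derivative_at)
  then show ?thesis
    using assms by (auto simp: differentiable_def)
qed

lemma Ck_Suc_has_derivative:
  "Ck (Suc k) f \<Longrightarrow> (f has_derivative frechet_derivative f (at x)) (at x)"
  by (simp add: frechet_derivative_works[symmetric])

lemma Ck_Suc_partial:
  "Ck (Suc k) f \<Longrightarrow> b \<in> Basis \<Longrightarrow> Ck k (\<lambda>x. frechet_derivative f (at x) b)"
  by simp

lemma Ck_Suc_imp_Ck: "Ck (Suc k) f \<Longrightarrow> Ck k f"
proof (induction k arbitrary: f)
  case 0
  then show ?case
    by (auto intro!: differentiable_imp_continuous_on simp: differentiable_on_def
        intro: differentiable_at_withinI)
next
  case (Suc k)
  then show ?case by (metis Ck.simps(2))
qed

lemma Ck_imp_continuous: "Ck k f \<Longrightarrow> continuous_on UNIV f"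
  by (induction k) (auto dest: Ck_Suc_imp_Ck simp del: Ck.simps(2))

lemma Ck_const: "Ck k (\<lambda>x. c)"
proof (induction k arbitrary: c)
  case (Suc k) show ?case
    by (rule Ck_SucI[where D = "\<lambda>_ _. 0"]) (use Suc in auto)
qed auto

lemma Ck_add: "Ck k f \<Longrightarrow> Ck k g \<Longrightarrow> Ck k (\<lambda>x. f x + g x)"
proof (induction k arbitrary: f g)
  case 0 then show ?case by (auto intro: continuous_on_add)
next
  case (Suc k) show ?case
    by (rule Ck_SucI[OF has_derivative_add[OF Ck_Suc_has_derivative[OF Suc.prems(1)]
              Ck_Suc_has_derivative[OF Suc.prems(2)]]])
       (use Suc in auto)
qed

lemma Ck_mult: "Ck k f \<Longrightarrow> Ck k g \<Longrightarrow> Ck k (\<lambda>x. f x * g x)"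
proof (induction k arbitrary: f g)
  case 0 then show ?case by (auto intro: continuous_on_mult)
next
  case (Suc k) show ?case
    by (rule Ck_SucI[OF has_derivative_mult[OF Ck_Suc_has_derivative[OF Suc.prems(1)]
              Ck_Suc_has_derivative[OF Suc.prems(2)]]])
       (use Suc in \<open>auto intro!: Ck_add simp: Ck_Suc_imp_Ck simp del: Ck.simps(2) dest: Ck_Suc_partial\<close>)
qed

lemma Ck_cmult: "Ck k f \<Longrightarrow> Ck k (\<lambda>x. c * f x)"
  by (intro Ck_mult Ck_const)

lemma Ck_minus: "Ck k f \<Longrightarrow> Ck k (\<lambda>x. - f x)"
  using Ck_cmult[of k f "-1"] by simp

lemma Ck_diff: "Ck k f \<Longrightarrow> Ck k g \<Longrightarrow> Ck k (\<lambda>x. f x - g x)"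
  using Ck_add[of k f "\<lambda>x. - g x"] by (simp add: Ck_minus)

lemma Ck_sum: "finite I \<Longrightarrow> (\<And>i. i \<in> I \<Longrightarrow> Ck k (f i)) \<Longrightarrow> Ck k (\<lambda>x. \<Sum>i\<in>I. f i x)"
  by (induction I rule: finite_induct) (auto intro: Ck_add Ck_const)

lemma Ck_prod: "finite I \<Longrightarrow> (\<And>i. i \<in> I \<Longrightarrow> Ck k (f i)) \<Longrightarrow> Ck k (\<lambda>x. \<Prod>i\<in>I. f i x)"
  by (induction I rule: finite_induct) (auto intro: Ck_mult Ck_const)

lemma Ck_bounded_linear: "bounded_linear f \<Longrightarrow> Ck k f"
proof (cases k)
  case 0 then show "bounded_linear f \<Longrightarrow> Ck k f" by (simp add: linear_continuous_on)
next
  case (Suc l)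
  assume f: "bounded_linear f"
  show ?thesis unfolding Suc
    by (rule Ck_SucI[OF bounded_linear_imp_has_derivative[OF f]]) (rule Ck_const)
qed

lemma has_derivative_compose_real:
  fixes f :: "'a::real_normed_vector \<Rightarrow> real" and h :: "real \<Rightarrow> real"
  assumes "(f has_derivative D) (at x)" and "(h has_derivative H) (at (f x))"
  shows "((\<lambda>x. h (f x)) has_derivative (\<lambda>v. H 1 * D v)) (at x)"
proof -
  have "H t = H 1 * t" for t
    using has_derivative_linear[OF assms(2)] linear_scale[of H t 1] by simp
  then have "(\<lambda>v. H (D v)) = (\<lambda>v. H 1 * D v)" by blast
  then show ?thesis
    using has_derivative_compose[OF assms] by simp
qed

lemma Ck_compose_real:
  fixes h :: "real \<Rightarrow> real"
  shows "Ck k h \<Longrightarrow> Ck k f \<Longrightarrow> Ck k (\<lambda>x. h (f x))"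
proof (induction k arbitrary: h f)
  case 0 then show ?case
    by (auto intro: continuous_on_compose2)
next
  case (Suc k) show ?case
  proof (rule Ck_SucI[OF has_derivative_compose_real[OF Ck_Suc_has_derivative[OF Suc.prems(2)]
              Ck_Suc_has_derivative[OF Suc.prems(1)]]], rule Ck_mult)
    have "Ck k (\<lambda>t. frechet_derivative h (at t) 1)"
      using Suc.prems(1) by (auto simp: Basis_real_def)
    from Suc.IH[OF this Ck_Suc_imp_Ck[OF Suc.prems(2)]]
    show "Ck k (\<lambda>x. frechet_derivative h (at (f x)) 1)" .
  qed (use Suc.prems in auto)
qed

lemma Ck_compose_affine:
  fixes f :: "'b::euclidean_space \<Rightarrow> real" and L :: "'a::euclidean_space \<Rightarrow> 'b"
  assumes L: "bounded_linear L"
  shows "Ck k f \<Longrightarrow> Ck k (\<lambda>x. f (L x + c))"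
proof (induction k arbitrary: f)
  case 0 then show ?case
    by (auto intro!: continuous_on_compose2[of UNIV f] continuous_intros linear_continuous_on[OF L])
next
  case (Suc k)
  have D: "((\<lambda>x. f (L x + c)) has_derivative (\<lambda>v. frechet_derivative f (at (L x + c)) (L v))) (at x)" for x
    by (rule has_derivative_compose[OF _ Ck_Suc_has_derivative[OF Suc.prems]])
       (auto intro!: derivative_eq_intros bounded_linear_imp_has_derivative[OF L])
  have e: "frechet_derivative f (at y) (L b) = (\<Sum>e\<in>Basis. (L b \<bullet> e) * frechet_derivative f (at y) e)" for y b
  proof -
    have l: "linear (frechet_derivative f (at y))"
      using has_derivative_linear[OF Ck_Suc_has_derivative[OF Suc.prems]] .
    have "frechet_derivative f (at y) (L b) = frechet_derivative f (at y) (\<Sum>e\<in>Basis. (L b \<bullet> e) *\<^sub>R e)"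
      by (simp add: euclidean_representation)
    then show ?thesis by (simp add: linear_sum[OF l] linear_scale[OF l])
  qed
  show ?case
    by (rule Ck_SucI[OF D]) (use Suc in \<open>auto simp: e intro!: Ck_sum Ck_cmult\<close>)
qed

lemma Ck_inverse:
  fixes f :: "'a::euclidean_space \<Rightarrow> real"
  assumes nz: "\<And>x. f x \<noteq> 0"
  shows "Ck k f \<Longrightarrow> Ck k (\<lambda>x. inverse (f x))"
proof (induction k)
  case 0 then show ?case using nz by (auto intro: continuous_on_inverse)
next
  case (Suc k) show ?case
    by (rule Ck_SucI[OF Deriv.has_derivative_inverse[OF nz Ck_Suc_has_derivative[OF Suc.prems]]])
       (use Suc in \<open>auto intro!: Ck_mult Ck_minus simp: Ck_Suc_imp_Ck simp del: Ck.simps(2) dest: Ck_Suc_partial\<close>)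
qed

lemma Ck_ln:
  fixes f :: "'a::euclidean_space \<Rightarrow> real"
  assumes pos: "\<And>x. f x > 0" and f: "Ck k f"
  shows "Ck k (\<lambda>x. ln (f x))"
proof (cases k)
  case 0 then show ?thesis using f pos by (auto intro!: continuous_on_ln simp: less_imp_neq[THEN not_sym])
next
  case (Suc l)
  have D: "((\<lambda>x. ln (f x)) has_derivative (\<lambda>v. inverse (f x) * frechet_derivative f (at x) v)) (at x)" for x
    using has_derivative_ln[OF pos Ck_Suc_has_derivative[OF f[unfolded Suc]]]
    by (simp add: field_simps)
  show ?thesis unfolding Suc
    by (rule Ck_SucI[OF D])
       (use f pos in \<open>auto simp: Suc less_imp_neq[THEN not_sym] intro!: Ck_mult Ck_inverse
          simp del: Ck.simps(2) dest: Ck_Suc_partial Ck_Suc_imp_Ck\<close>)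
qed

lemma Ck_Suc_real:
  fixes h :: "real \<Rightarrow> real"
  assumes "\<And>t. (h has_real_derivative h' t) (at t)" and "Ck k h'"
  shows "Ck (Suc k) h"
  by (rule Ck_SucI[where D = "\<lambda>t v. h' t * v"])
     (use assms in \<open>auto simp: has_field_derivative_def Basis_real_def\<close>)

text \<open>Functions all of whose iterated partial derivatives exist and are continuous.\<close>

definition smooth :: "('a::euclidean_space \<Rightarrow> real) \<Rightarrow> bool" where
  "smooth f \<longleftrightarrow> (\<forall>k. Ck k f)"

lemma smooth_has_derivative:
  "smooth f \<Longrightarrow> (f has_derivative frechet_derivative f (at x)) (at x)"
  unfolding smooth_def using Ck_Suc_has_derivative by blast

lemma smooth_partial: "smooth f \<Longrightarrow> b \<in> Basis \<Longrightarrow> smooth (\<lambda>x. frechet_derivative f (at x) b)"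
  unfolding smooth_def using Ck_Suc_partial by blast

lemma smooth_continuous: "smooth f \<Longrightarrow> continuous_on S f"
  unfolding smooth_def using Ck_imp_continuous continuous_on_subset subset_UNIV by metis

lemma smooth_intros:
  fixes f g :: "'a::euclidean_space \<Rightarrow> real"
  shows "smooth (\<lambda>x::'a. c)" "smooth f \<Longrightarrow> smooth g \<Longrightarrow> smooth (\<lambda>x. f x + g x)"
    "smooth f \<Longrightarrow> smooth g \<Longrightarrow> smooth (\<lambda>x. f x * g x)"
    "smooth f \<Longrightarrow> smooth (\<lambda>x. - f x)"
    "smooth f \<Longrightarrow> smooth g \<Longrightarrow> smooth (\<lambda>x. f x - g x)"
    "smooth (\<lambda>x. x \<bullet> b)"
  unfolding smooth_def
  by (auto intro: Ck_const Ck_add Ck_mult Ck_minus Ck_diff Ck_bounded_linear[OF bounded_linear_inner_left])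

lemma smooth_compose:
  fixes f :: "'a::euclidean_space \<Rightarrow> real" and h :: "real \<Rightarrow> real"
  shows "smooth h \<Longrightarrow> smooth f \<Longrightarrow> smooth (\<lambda>x. h (f x))"
  unfolding smooth_def using Ck_compose_real by blast

lemma smooth_ident: "smooth (\<lambda>t::real. t)"
  unfolding smooth_def by (auto intro: Ck_bounded_linear bounded_linear_ident)

lemma smooth_norm_sq: "smooth (\<lambda>x::'a::euclidean_space. (norm x)\<^sup>2)"
proof -
  have "(\<lambda>x::'a. (norm x)\<^sup>2) = (\<lambda>x. \<Sum>b\<in>Basis. (x \<bullet> b) * (x \<bullet> b))"
    by (simp add: power2_norm_eq_inner euclidean_inner[symmetric])
  then show ?thesis
    unfolding smooth_def
    by (intro allI, simp only:) (intro Ck_sum finite_Basis Ck_mult Ck_bounded_linear[OF bounded_linear_inner_left])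
qed

text \<open>The family \<open>(1 / t)\<^sup>n exp (- 1 / t)\<close>, extended by \<open>0\<close> to \<open>t \<le> 0\<close>. It is closed under
  differentiation up to linear combinations, which gives smoothness of all its members at once.\<close>

definition flat :: "nat \<Rightarrow> real \<Rightarrow> real" where
  "flat n t = (if t > 0 then (1 / t) ^ n * exp (- (1 / t)) else 0)"

lemma flat_over_ident_tendsto: "((\<lambda>t. flat n t / t) \<longlongrightarrow> 0) (at 0)"
proof -
  have lim: "((\<lambda>y::real. y ^ Suc n / exp y) \<longlongrightarrow> 0) at_top"
    by (rule tendsto_power_div_exp_0)
  have "((\<lambda>t::real. (inverse t) ^ Suc n / exp (inverse t)) \<longlongrightarrow> 0) (at_right 0)"
    using filterlim_compose[OF lim filterlim_inverse_at_top_right] .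
  then have "((\<lambda>t. flat n t / t) \<longlongrightarrow> 0) (at_right 0)"
    by (rule Lim_transform_eventually)
       (auto simp: eventually_at_filter flat_def divide_simps exp_minus)
  moreover have "((\<lambda>t. flat n t / t) \<longlongrightarrow> 0) (at_left 0)"
    by (rule Lim_transform_eventually[of "\<lambda>_. 0"])
       (auto simp: eventually_at_filter flat_def)
  ultimately show ?thesis by (simp add: filterlim_split_at)
qed

lemma flat_has_derivative:
  "(flat n has_real_derivative (flat (n + 2) t - n * flat (n + 1) t)) (at t)"
proof -
  consider "t > 0" | "t < 0" | "t = 0" by linarith
  then show ?thesis
  proof cases
    case 1
    have e: "((\<lambda>t. (1 / t) ^ n * exp (- (1 / t))) has_real_derivative
        (flat (n + 2) t - n * flat (n + 1) t)) (at t)"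
    proof (cases n)
      case 0
      show ?thesis using 1 unfolding 0
        by (auto intro!: derivative_eq_intros simp: flat_def field_simps power2_eq_square)
    next
      case (Suc m)
      show ?thesis using 1 unfolding Suc
        by (auto intro!: derivative_eq_intros simp: flat_def divide_simps)
           (cases m; auto simp: algebra_simps power2_eq_square)
    qed
    show ?thesis
      by (rule has_field_derivative_transform_within_open[OF e open_greaterThan[of 0]])
         (use 1 in \<open>auto simp: flat_def\<close>)
  next
    case 2
    show ?thesis
      by (rule has_field_derivative_transform_within_open[OF _ open_lessThan[of 0], of "\<lambda>_. 0"])
         (use 2 in \<open>auto simp: flat_def\<close>)
  next
    case 3
    show ?thesis unfolding 3
      using flat_over_ident_tendsto[of n] by (simp add: has_field_derivative_iff flat_def)
  qed
qed

lemma smooth_flat: "smooth (flat n)"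
proof -
  have "Ck k (flat n)" for k n
  proof (induction k arbitrary: n)
    case 0 show ?case
      using DERIV_isCont[OF flat_has_derivative]
      by (simp add: continuous_at_imp_continuous_on)
  next
    case (Suc k) show ?case
      by (rule Ck_Suc_real[OF flat_has_derivative]) (intro Ck_diff Ck_cmult Suc)
  qed
  then show ?thesis by (simp add: smooth_def)
qed

lemma flat0_pos: "0 < t \<Longrightarrow> 0 < flat 0 t" and flat0_nonneg: "0 \<le> flat 0 t"
  and flat0_le_1: "flat 0 t \<le> 1" and flat0_nonpos: "t \<le> 0 \<Longrightarrow> flat 0 t = 0"
  by (auto simp: flat_def)

text \<open>A smooth substitute for the positive part: \<open>t exp (- \<epsilon> / t)\<close> for \<open>t > 0\<close> and \<open>0\<close> for
  \<open>t \<le> 0\<close>, where \<open>\<epsilon> > 0\<close>. It differs from the positive part by at most \<open>\<epsilon>\<close>.\<close>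

definition soft_pos :: "real \<Rightarrow> real \<Rightarrow> real" where
  "soft_pos \<epsilon> t = t * flat 0 (t / \<epsilon>)"

text \<open>The derivative of \<open>soft_pos \<epsilon>\<close>. It is at most \<open>1\<close> because \<open>1 + 1 / s \<le> exp (1 / s)\<close>.\<close>

definition soft_pos_deriv :: "real \<Rightarrow> real \<Rightarrow> real" where
  "soft_pos_deriv \<epsilon> t = flat 0 (t / \<epsilon>) + (t / \<epsilon>) * flat 2 (t / \<epsilon>)"

lemma smooth_soft_pos: "smooth (soft_pos \<epsilon>)"
proof -
  have "smooth (\<lambda>t. t * (1 / \<epsilon>))" by (intro smooth_intros(3)[OF smooth_ident smooth_intros(1)])
  then have "smooth (\<lambda>t. flat 0 (t * (1 / \<epsilon>)))" by (intro smooth_compose[OF smooth_flat])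
  then show ?thesis
    using smooth_intros(3)[OF smooth_ident] by (simp add: soft_pos_def[abs_def])
qed

lemma soft_pos_has_derivative:
  assumes "\<epsilon> > 0" shows "(soft_pos \<epsilon> has_real_derivative soft_pos_deriv \<epsilon> t) (at t)"
proof -
  have "((\<lambda>t. flat 0 (t / \<epsilon>)) has_real_derivative flat 2 (t / \<epsilon>) * (1 / \<epsilon>)) (at t)"
    by (rule DERIV_chain2[of "flat 0"])
       (use flat_has_derivative[of 0 "t / \<epsilon>"] assms in \<open>auto intro!: derivative_eq_intros simp: numeral_2_eq_2\<close>)
  then show ?thesis
    unfolding soft_pos_def[abs_def] soft_pos_deriv_def by (auto intro!: derivative_eq_intros)
qed

lemma soft_pos_deriv_bounds:
  assumes "\<epsilon> > 0" shows "0 \<le> soft_pos_deriv \<epsilon> t" "soft_pos_deriv \<epsilon> t \<le> 1"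
proof -
  show "0 \<le> soft_pos_deriv \<epsilon> t" using assms by (auto simp: soft_pos_deriv_def flat_def zero_less_divide_iff)
  show "soft_pos_deriv \<epsilon> t \<le> 1"
  proof (cases "t > 0")
    case True
    define s where "s = t / \<epsilon>"
    have s: "s > 0" using True assms by (simp add: s_def)
    have "1 + 1 / s \<le> exp (1 / s)" by (rule exp_ge_add_one_self)
    then have "(1 + 1 / s) * exp (- (1 / s)) \<le> exp (1 / s) * exp (- (1 / s))"
      by (intro mult_right_mono) auto
    then have "(1 + 1 / s) * exp (- (1 / s)) \<le> 1" by (simp add: exp_minus)
    moreover have "soft_pos_deriv \<epsilon> t = (1 + 1 / s) * exp (- (1 / s))"
      using s by (simp add: soft_pos_deriv_def s_def[symmetric] flat_def power2_eq_square field_simps)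
    ultimately show ?thesis by simp
  qed (use assms in \<open>auto simp: soft_pos_deriv_def flat_def zero_less_divide_iff\<close>)
qed

lemma soft_pos_deriv_frechet: "\<epsilon> > 0 \<Longrightarrow> frechet_derivative (soft_pos \<epsilon>) (at t) 1 = soft_pos_deriv \<epsilon> t"
  using soft_pos_has_derivative[of \<epsilon> t]
  by (metis frechet_derivative_at has_field_derivative_def mult.right_neutral)

lemma soft_pos_nonpos: "\<epsilon> > 0 \<Longrightarrow> t \<le> 0 \<Longrightarrow> soft_pos \<epsilon> t = 0"
  by (auto simp: soft_pos_def flat_def zero_less_divide_iff)

lemma soft_pos_pos: "\<epsilon> > 0 \<Longrightarrow> t > 0 \<Longrightarrow> soft_pos \<epsilon> t > 0"
  by (auto simp: soft_pos_def flat_def)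

lemma soft_pos_nonneg: "\<epsilon> > 0 \<Longrightarrow> soft_pos \<epsilon> t \<ge> 0"
  using soft_pos_nonpos[of \<epsilon> t] soft_pos_pos[of \<epsilon> t] by (cases "t > 0") auto

lemma soft_pos_lipschitz:
  assumes "\<epsilon> > 0" shows "\<bar>soft_pos \<epsilon> s - soft_pos \<epsilon> t\<bar> \<le> \<bar>s - t\<bar>"
proof -
  have "norm (soft_pos \<epsilon> s - soft_pos \<epsilon> t) \<le> 1 * norm (s - t)"
    by (rule field_differentiable_bound[of UNIV "soft_pos \<epsilon>" "soft_pos_deriv \<epsilon>"])
       (use assms soft_pos_has_derivative soft_pos_deriv_bounds in auto)
  then show ?thesis by simp
qed

lemma soft_pos_le: "\<epsilon> > 0 \<Longrightarrow> soft_pos \<epsilon> t \<le> \<bar>t\<bar>"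
  using soft_pos_lipschitz[of \<epsilon> t 0] by (simp add: soft_pos_nonpos)

lemma ident_minus_soft_pos:
  assumes "\<epsilon> > 0" "t \<ge> 0" shows "0 \<le> t - soft_pos \<epsilon> t" "t - soft_pos \<epsilon> t \<le> \<epsilon>"
proof -
  show "0 \<le> t - soft_pos \<epsilon> t" using soft_pos_le[of \<epsilon> t] assms by simp
  show "t - soft_pos \<epsilon> t \<le> \<epsilon>"
  proof (cases "t = 0")
    case False
    then have t: "t > 0" using assms by simp
    have "1 + - (\<epsilon> / t) \<le> exp (- (\<epsilon> / t))" by (rule exp_ge_add_one_self)
    then have "t * (1 + - (\<epsilon> / t)) \<le> t * exp (- (\<epsilon> / t))" using t by (intro mult_left_mono) auto
    moreover have "t * (1 + - (\<epsilon> / t)) = t - \<epsilon>" using t by (simp add: field_simps)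
    ultimately have "t - \<epsilon> \<le> t * exp (- (\<epsilon> / t))" by metis
    then show ?thesis using t assms by (simp add: soft_pos_def flat_def)
  qed (use assms in \<open>auto simp: soft_pos_def\<close>)
qed

section \<open>Smooth functions cut off at a hyperplane\<close>

lemma has_derivative_cut_halfspace:
  fixes p :: "'a::euclidean_space \<Rightarrow> real"
  assumes D: "(p has_derivative D) (at x)"
    and bd: "x \<bullet> n = 0 \<Longrightarrow> p x = 0 \<and> D = (\<lambda>_. 0)"
  shows "((\<lambda>x. if x \<bullet> n < 0 then p x else 0) has_derivative (\<lambda>v. if x \<bullet> n < 0 then D v else 0)) (at x)"
    (is "(?g has_derivative _) _")
proof -
  consider "x \<bullet> n < 0" | "x \<bullet> n > 0" | "x \<bullet> n = 0" by linarith
  then show ?thesis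
  proof cases
    case 1
    have "open {x. x \<bullet> n < 0}" by (intro open_Collect_less continuous_intros)
    then have "(?g has_derivative D) (at x)"
      by (rule has_derivative_transform_within_open[OF D]) (use 1 in auto)
    then show ?thesis using 1 by simp
  next
    case 2
    have o: "open {x. x \<bullet> n > 0}" by (intro open_Collect_less continuous_intros)
    have "(?g has_derivative (\<lambda>_. 0)) (at x)"
      by (rule has_derivative_transform_within_open[OF has_derivative_const[of 0] o]) (use 2 in auto)
    then show ?thesis using 2 by simp
  next
    case 3
    then have p0: "p x = 0" and D0: "(p has_derivative (\<lambda>_. 0)) (at x)" using bd D by auto
    have lim: "((\<lambda>y. norm (p y) / norm (y - x)) \<longlongrightarrow> 0) (at x)"
      using D0 unfolding has_derivative_iff_norm by (simp add: p0)
    have "((\<lambda>y. norm (?g y) / norm (y - x)) \<longlongrightarrow> 0) (at x)"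
      by (rule tendsto_sandwich[OF _ _ tendsto_const lim]) (auto intro!: always_eventually divide_right_mono)
    then have "(?g has_derivative (\<lambda>_. 0)) (at x)"
      unfolding has_derivative_iff_norm using 3 by (simp add: bounded_linear_zero)
    then show ?thesis using 3 by simp
  qed
qed

lemma smooth_vanishing_derivative:
  fixes h :: "real \<Rightarrow> real"
  assumes h: "smooth h" and h0: "\<And>t. t \<le> 0 \<Longrightarrow> h t = 0" and t: "t \<le> 0"
  shows "frechet_derivative h (at t) 1 = 0"
proof -
  have c: "continuous_on (closure {..<0}) (\<lambda>t. frechet_derivative h (at t) 1)"
    using smooth_continuous[OF smooth_partial[OF h, of 1]] by (auto simp: Basis_real_def)
  have z: "frechet_derivative h (at t) 1 = 0" if "t \<in> {..<0}" for t
  proof -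
    have "(h has_derivative (\<lambda>_. 0)) (at t)"
      by (rule has_derivative_transform_within_open[OF has_derivative_const[of 0] open_lessThan[of 0]])
         (use that h0 in auto)
    then show ?thesis by (metis frechet_derivative_at)
  qed
  show ?thesis
    by (rule continuous_constant_on_closure[OF c z]) (use t in auto)
qed

text \<open>Cutting off \<open>h \<circ> d\<close> at the hyperplane \<open>x \<bullet> n = 0\<close> keeps it smooth if \<open>h\<close> vanishes on the nonpositive
  half-line and \<open>d\<close> on the hyperplane: all derivatives of \<open>h\<close> vanish at \<open>0\<close> as well. The induction on
  the order of differentiation needs an additional smooth factor \<open>f\<close>.\<close>

lemma smooth_cut_halfspace:
  fixes d :: "'a::euclidean_space \<Rightarrow> real" and h :: "real \<Rightarrow> real"
  assumes h: "smooth h" "\<And>t. t \<le> 0 \<Longrightarrow> h t = 0"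
    and d: "smooth d" "\<And>x. x \<bullet> n = 0 \<Longrightarrow> d x = 0"
  shows "smooth (\<lambda>x. if x \<bullet> n < 0 then h (d x) else 0)"
    and "frechet_derivative (\<lambda>x. if x \<bullet> n < 0 then h (d x) else 0) (at x) =
      (\<lambda>v. if x \<bullet> n < 0 then frechet_derivative h (at (d x)) 1 * frechet_derivative d (at x) v else 0)"
proof -
  have D: "((\<lambda>x. if x \<bullet> n < 0 then h (d x) * f x else 0) has_derivative
      (\<lambda>v. if x \<bullet> n < 0 then h (d x) * frechet_derivative f (at x) v +
          frechet_derivative h (at (d x)) 1 * frechet_derivative d (at x) v * f x else 0)) (at x)"
    if h: "smooth h" "\<And>t. t \<le> 0 \<Longrightarrow> h t = 0" and f: "smooth f" for h f x
  proof (rule has_derivative_cut_halfspace)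
    show "((\<lambda>x. h (d x) * f x) has_derivative (\<lambda>v. h (d x) * frechet_derivative f (at x) v +
          frechet_derivative h (at (d x)) 1 * frechet_derivative d (at x) v * f x)) (at x)"
      by (intro has_derivative_mult has_derivative_compose_real smooth_has_derivative h f d)
    show "h (d x) * f x = 0 \<and> (\<lambda>v. h (d x) * frechet_derivative f (at x) v +
          frechet_derivative h (at (d x)) 1 * frechet_derivative d (at x) v * f x) = (\<lambda>_. 0)"
      if "x \<bullet> n = 0"
      using that d(2) h(2)[of 0] smooth_vanishing_derivative[OF h, of 0] by simp
  qed
  have "Ck k (\<lambda>x. if x \<bullet> n < 0 then h (d x) * f x else 0)"
    if "smooth h" "\<And>t. t \<le> 0 \<Longrightarrow> h t = 0" and "smooth f" for k h f
    using that
  proof (induction k arbitrary: h f)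
    case 0
    show ?case
      using D[OF 0, THEN has_derivative_continuous]
      by (simp add: continuous_on_eq_continuous_at)
  next
    case (Suc k)
    show ?case
    proof (rule Ck_SucI[OF D[OF Suc.prems]])
      fix b :: 'a assume b: "b \<in> Basis"
      have h': "smooth (\<lambda>t. frechet_derivative h (at t) 1)"
        using smooth_partial[OF Suc.prems(1), of 1] by (simp add: Basis_real_def)
      have 1: "Ck k (\<lambda>x. if x \<bullet> n < 0 then h (d x) * frechet_derivative f (at x) b else 0)"
        by (intro Suc.IH Suc.prems smooth_partial b)
      have 2: "Ck k (\<lambda>x. if x \<bullet> n < 0 then frechet_derivative h (at (d x)) 1 *
            (frechet_derivative d (at x) b * f x) else 0)"
        by (intro Suc.IH[of "\<lambda>t. frechet_derivative h (at t) 1"] h' smooth_vanishing_derivative Suc.prems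
            smooth_intros smooth_partial b d)
      show "Ck k (\<lambda>x. if x \<bullet> n < 0 then h (d x) * frechet_derivative f (at x) b +
          frechet_derivative h (at (d x)) 1 * frechet_derivative d (at x) b * f x else 0)"
        using Ck_add[OF 1 2] by (rule back_subst[where P = "Ck k"]) (auto simp: fun_eq_iff)
    qed
  qed
  from this[OF h smooth_intros(1)[of 1]] show "smooth (\<lambda>x. if x \<bullet> n < 0 then h (d x) else 0)"
    by (simp add: smooth_def cong: if_cong)
  have "((\<lambda>x. if x \<bullet> n < 0 then h (d x) else 0) has_derivative
      (\<lambda>v. if x \<bullet> n < 0 then frechet_derivative h (at (d x)) 1 * frechet_derivative d (at x) v else 0)) (at x)"
    using D[OF h smooth_intros(1)[of 1], of x] by (simp cong: if_cong)
  then show "frechet_derivative (\<lambda>x. if x \<bullet> n < 0 then h (d x) else 0) (at x) =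
      (\<lambda>v. if x \<bullet> n < 0 then frechet_derivative h (at (d x)) 1 * frechet_derivative d (at x) v else 0)"
    by (rule frechet_derivative_at[symmetric])
qed

section \<open>Gradients and test functions\<close>

lemma gradient_eqI:
  assumes "(f has_derivative (\<lambda>v. g \<bullet> v)) (at x)"
  shows "gradient f x = g"
proof -
  have "frechet_derivative f (at x) = (\<lambda>v. g \<bullet> v)"
    using assms by (rule frechet_derivative_at[symmetric])
  then show ?thesis by (simp add: gradient_def euclidean_representation)
qed

lemma smooth_has_gradient:
  assumes "smooth f" shows "(f has_derivative (\<lambda>v. gradient f x \<bullet> v)) (at x)"
proof -
  let ?D = "frechet_derivative f (at x)"
  have D: "(f has_derivative ?D) (at x)" using assms by (rule smooth_has_derivative)
  then have l: "linear ?D" by (rule has_derivative_linear)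
  have "?D v = gradient f x \<bullet> v" for v
  proof -
    have "?D v = ?D (\<Sum>b\<in>Basis. (v \<bullet> b) *\<^sub>R b)" by (simp add: euclidean_representation)
    also have "\<dots> = gradient f x \<bullet> v"
      by (simp add: linear_sum[OF l] linear_scale[OF l] gradient_def inner_sum_left inner_commute[of v] mult.commute)
    finally show ?thesis .
  qed
  then have "?D = (\<lambda>v. gradient f x \<bullet> v)" by blast
  with D show ?thesis by metis
qed

lemma gradient_inner_Basis:
  "b \<in> Basis \<Longrightarrow> gradient f x \<bullet> b = frechet_derivative f (at x) b"
  by (simp add: gradient_def)

lemma continuous_gradient: "smooth f \<Longrightarrow> continuous_on S (gradient f)"
  unfolding gradient_def[abs_def]
  by (intro continuous_intros smooth_continuous[OF smooth_partial])

lemma gradient_compose_real: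
  assumes "smooth f" "(h has_real_derivative h') (at (f x))"
  shows "gradient (\<lambda>x. h (f x)) x = h' *\<^sub>R gradient f x"
  by (rule gradient_eqI)
     (use has_derivative_compose_real[OF smooth_has_gradient[OF assms(1)] assms(2)[unfolded has_field_derivative_def]] in simp)

lemma gradient_add: "smooth f \<Longrightarrow> smooth g \<Longrightarrow> gradient (\<lambda>x. f x + g x) x = gradient f x + gradient g x"
  by (rule gradient_eqI)
     (auto intro!: derivative_eq_intros smooth_has_gradient simp: inner_add_left)

lemma gradient_diff: "smooth f \<Longrightarrow> smooth g \<Longrightarrow> gradient (\<lambda>x. f x - g x) x = gradient f x - gradient g x"
  by (rule gradient_eqI)
     (auto intro!: derivative_eq_intros smooth_has_gradient simp: inner_diff_left)

lemma gradient_mult: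
  "smooth f \<Longrightarrow> smooth g \<Longrightarrow> gradient (\<lambda>x. f x * g x) x = f x *\<^sub>R gradient g x + g x *\<^sub>R gradient f x"
  by (rule gradient_eqI)
     (auto intro!: derivative_eq_intros smooth_has_gradient simp: inner_add_left)

lemma gradient_locally_zero:
  assumes "open S" "x \<in> S" "\<And>y. y \<in> S \<Longrightarrow> f y = 0"
  shows "gradient f x = 0"
  by (rule gradient_eqI, simp)
     (rule has_derivative_transform_within_open[OF has_derivative_const[of 0] assms(1,2)], simp add: assms(3))

lemma gradient_zero: "gradient (\<lambda>_. 0) x = 0"
  by (rule gradient_locally_zero[of UNIV]) auto

lemma integrable_compact_support:
  fixes f :: "'a::euclidean_space \<Rightarrow> 'b::euclidean_space"
  assumes "continuous_on UNIV f" "compact K" "\<And>x. x \<notin> K \<Longrightarrow> f x = 0"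
  shows "integrable lborel f"
proof -
  have "integrable lborel (\<lambda>x. indicator K x *\<^sub>R f x)"
    using assms(1,2) continuous_on_subset by (intro borel_integrable_compact) auto
  moreover have "(\<lambda>x. indicator K x *\<^sub>R f x) = f"
    using assms(3) by (auto simp: indicator_def fun_eq_iff)
  ultimately show ?thesis by simp
qed

lemma bounded_compact_support:
  fixes f :: "'a::euclidean_space \<Rightarrow> 'b::real_normed_vector"
  assumes "continuous_on UNIV f" "compact K" "\<And>x. x \<notin> K \<Longrightarrow> f x = 0"
  obtains B where "B > 0" "\<And>x. norm (f x) \<le> B"
proof -
  have "bounded (f ` K)"
    using assms(1,2) continuous_on_subset compact_continuous_image compact_imp_bounded by blast
  then obtain B where B: "\<And>x. x \<in> K \<Longrightarrow> norm (f x) \<le> B" unfolding bounded_iff by auto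
  show ?thesis
  proof
    show "\<bar>B\<bar> + 1 > 0" by simp
    fix x show "norm (f x) \<le> \<bar>B\<bar> + 1"
      using B[of x] assms(3)[of x] by (cases "x \<in> K") auto
  qed
qed

lemma integral_translate:
  fixes f :: "'a::euclidean_space \<Rightarrow> 'b::euclidean_space"
  assumes [measurable]: "f \<in> borel_measurable borel"
  shows "(LBINT x. f (c + x)) = (LBINT x. f x)"
    and "integrable lborel (\<lambda>x. f (c + x)) \<longleftrightarrow> integrable lborel f"
proof -
  have "(LBINT x. f (c + x)) = (\<integral>x. f x \<partial>distr lborel borel ((+) c))"
    by (subst integral_distr) auto
  then show "(LBINT x. f (c + x)) = (LBINT x. f x)" by (simp only: lborel_distr_plus)
  have "integrable lborel (\<lambda>x. f (c + x)) \<longleftrightarrow> integrable (distr lborel borel ((+) c)) f"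
    by (subst integrable_distr_eq) auto
  then show "integrable lborel (\<lambda>x. f (c + x)) \<longleftrightarrow> integrable lborel f"
    by (simp only: lborel_distr_plus)
qed

lemma test_functionE:
  assumes "\<phi> \<in> test_functions \<Omega>"
  obtains K where "smooth \<phi>" "compact K" "K \<subseteq> \<Omega>" "\<And>x. x \<notin> K \<Longrightarrow> \<phi> x = 0"
  using assms unfolding test_functions_def smooth_def by blast

lemma test_functionI:
  "smooth \<phi> \<Longrightarrow> compact K \<Longrightarrow> K \<subseteq> \<Omega> \<Longrightarrow> (\<And>x. x \<notin> K \<Longrightarrow> \<phi> x = 0) \<Longrightarrow> \<phi> \<in> test_functions \<Omega>"
  unfolding test_functions_def smooth_def by blast

lemma test_smooth: "\<phi> \<in> test_functions \<Omega> \<Longrightarrow> smooth \<phi>"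
  by (erule test_functionE)

lemma gradient_support:
  assumes "compact K" "\<And>x. x \<notin> K \<Longrightarrow> \<phi> x = 0" "x \<notin> K"
  shows "gradient \<phi> x = 0"
  using assms by (intro gradient_locally_zero[of "- K"]) (auto simp: open_Compl compact_imp_closed)

lemma test_partial:
  assumes "\<phi> \<in> test_functions \<Omega>" "b \<in> Basis"
  shows "(\<lambda>x. frechet_derivative \<phi> (at x) b) \<in> test_functions \<Omega>"
proof -
  obtain K where K: "smooth \<phi>" "compact K" "K \<subseteq> \<Omega>" "\<And>x. x \<notin> K \<Longrightarrow> \<phi> x = 0"
    using assms(1) by (rule test_functionE) auto
  show ?thesis
    by (rule test_functionI[OF smooth_partial[OF K(1) assms(2)] K(2,3)])
       (use gradient_support[OF K(2,4)] assms(2) in \<open>auto simp: gradient_inner_Basis[symmetric]\<close>)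
qed

lemma test_compose:
  fixes h :: "real \<Rightarrow> real"
  assumes \<phi>: "\<phi> \<in> test_functions \<Omega>" and h: "smooth h" "h 0 = 0"
  shows "(\<lambda>x. h (\<phi> x)) \<in> test_functions \<Omega>"
proof -
  obtain K where K: "smooth \<phi>" "compact K" "K \<subseteq> \<Omega>" "\<And>x. x \<notin> K \<Longrightarrow> \<phi> x = 0"
    using \<phi> by (rule test_functionE) auto
  show ?thesis
    by (rule test_functionI[OF smooth_compose[OF h(1) K(1)] K(2,3)]) (simp add: K(4) h(2))
qed

lemma test_diff:
  assumes "\<phi> \<in> test_functions \<Omega>" "\<psi> \<in> test_functions \<Omega>"
  shows "(\<lambda>x. \<phi> x - \<psi> x) \<in> test_functions \<Omega>"
proof -
  obtain K where K: "smooth \<phi>" "compact K" "K \<subseteq> \<Omega>" "\<And>x. x \<notin> K \<Longrightarrow> \<phi> x = 0"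
    using assms(1) by (rule test_functionE) auto
  obtain L where L: "smooth \<psi>" "compact L" "L \<subseteq> \<Omega>" "\<And>x. x \<notin> L \<Longrightarrow> \<psi> x = 0"
    using assms(2) by (rule test_functionE) auto
  show ?thesis
    by (rule test_functionI[where K = "K \<union> L"]) (use K L in \<open>auto intro: smooth_intros\<close>)
qed

lemma test_mult:
  assumes "\<phi> \<in> test_functions \<Omega>" "smooth \<psi>"
  shows "(\<lambda>x. \<phi> x * \<psi> x) \<in> test_functions \<Omega>"
proof -
  obtain K where K: "smooth \<phi>" "compact K" "K \<subseteq> \<Omega>" "\<And>x. x \<notin> K \<Longrightarrow> \<phi> x = 0"
    using assms(1) by (rule test_functionE) auto
  show ?thesis
    by (rule test_functionI[OF _ K(2,3)]) (use K assms in \<open>auto intro: smooth_intros\<close>)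
qed

lemma test_continuous: "\<phi> \<in> test_functions \<Omega> \<Longrightarrow> continuous_on S \<phi>"
  using smooth_continuous test_smooth by blast

lemma test_measurable:
  assumes "\<phi> \<in> test_functions \<Omega>"
  shows "\<phi> \<in> borel_measurable borel" "gradient \<phi> \<in> borel_measurable borel"
  using continuous_gradient test_smooth assms test_continuous by (auto intro!: borel_measurable_continuous_onI)

lemma test_outside: "\<phi> \<in> test_functions \<Omega> \<Longrightarrow> x \<notin> \<Omega> \<Longrightarrow> \<phi> x = 0"
  by (erule test_functionE) auto

lemma test_gradient_outside: "\<phi> \<in> test_functions \<Omega> \<Longrightarrow> x \<notin> \<Omega> \<Longrightarrow> gradient \<phi> x = 0"
  by (erule test_functionE) (use gradient_support in blast)

lemma test_bounded:
  assumes "\<phi> \<in> test_functions \<Omega>"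
  obtains B where "B > 0" "\<And>x. \<bar>\<phi> x\<bar> \<le> B" "\<And>x. norm (gradient \<phi> x) \<le> B"
proof -
  obtain K where K: "smooth \<phi>" "compact K" "K \<subseteq> \<Omega>" "\<And>x. x \<notin> K \<Longrightarrow> \<phi> x = 0"
    using assms(1) by (rule test_functionE) auto
  obtain A where A: "A > 0" "\<And>x. norm (\<phi> x) \<le> A"
    using bounded_compact_support[OF smooth_continuous[OF K(1)] K(2,4)] by auto
  obtain B where B: "B > 0" "\<And>x. norm (gradient \<phi> x) \<le> B"
    using bounded_compact_support[OF continuous_gradient[OF K(1)] K(2) gradient_support[OF K(2,4)]] by auto
  show ?thesis
    by (rule that[of "max A B"]) (use A B in \<open>auto intro: le_max_iff_disj[THEN iffD2]\<close>)
qed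

lemma test_integrable:
  assumes "\<phi> \<in> test_functions \<Omega>"
  shows "integrable lborel \<phi>" "integrable lborel (gradient \<phi>)"
    "integrable lborel (\<lambda>x. (\<phi> x)\<^sup>2)" "integrable lborel (\<lambda>x. (norm (gradient \<phi> x))\<^sup>2)"
proof -
  obtain K where K: "smooth \<phi>" "compact K" "K \<subseteq> \<Omega>" "\<And>x. x \<notin> K \<Longrightarrow> \<phi> x = 0"
    using assms(1) by (rule test_functionE) auto
  note c = smooth_continuous[OF K(1), of UNIV] continuous_gradient[OF K(1), of UNIV]
  show "integrable lborel \<phi>" "integrable lborel (gradient \<phi>)"
    "integrable lborel (\<lambda>x. (\<phi> x)\<^sup>2)" "integrable lborel (\<lambda>x. (norm (gradient \<phi> x))\<^sup>2)"
    using K(4) gradient_support[OF K(2,4)] by (auto intro!: integrable_compact_support[OF _ K(2)] c continuous_intros)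
qed

text \<open>The difference quotients of \<open>f\<close> have integral zero by translation invariance and converge
  dominatedly to the directional derivative.\<close>

lemma integral_partial_zero:
  fixes f :: "'a::euclidean_space \<Rightarrow> real"
  assumes f: "f \<in> test_functions UNIV"
  shows "(LBINT x. gradient f x \<bullet> v) = 0"
proof -
  obtain K where K: "smooth f" "compact K" "\<And>x. x \<notin> K \<Longrightarrow> f x = 0"
    using f by (rule test_functionE) auto
  obtain B where B: "B > 0" "\<And>x. norm (gradient f x) \<le> B" using test_bounded[OF f] by metis
  obtain r where r: "K \<subseteq> cball 0 r"
    using compact_imp_bounded[OF K(2)] by (metis bounded_iff mem_cball_0 subsetI)
  note [measurable] = test_measurable[OF f]
  define s where "s n x = real (Suc n) * (f ((1 / real (Suc n)) *\<^sub>R v + x) - f x)" for n x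
  have lim: "(\<lambda>n. s n x) \<longlonglongrightarrow> gradient f x \<bullet> v" for x
  proof -
    have line: "((\<lambda>t. f (t *\<^sub>R v + x)) has_derivative (\<lambda>t. gradient f (0 *\<^sub>R v + x) \<bullet> (t *\<^sub>R v))) (at 0)"
      by (rule has_derivative_compose[where g = f and f = "\<lambda>t. t *\<^sub>R v + x"])
         (auto intro!: derivative_eq_intros smooth_has_gradient[OF K(1)])
    have "((\<lambda>t. f (t *\<^sub>R v + x)) has_real_derivative gradient f x \<bullet> v) (at 0)"
      unfolding has_field_derivative_def by (rule has_derivative_eq_rhs[OF line]) auto
    then have "((\<lambda>t. (f (t *\<^sub>R v + x) - f x) / t) \<longlongrightarrow> gradient f x \<bullet> v) (at 0)"
      by (simp add: has_field_derivative_iff)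
    moreover have "filterlim (\<lambda>n. 1 / real (Suc n)) (at 0) sequentially"
      unfolding filterlim_at using LIMSEQ_inverse_real_of_nat
      by (auto simp: inverse_eq_divide)
    ultimately have "(\<lambda>n. (f ((1 / real (Suc n)) *\<^sub>R v + x) - f x) / (1 / real (Suc n))) \<longlonglongrightarrow> gradient f x \<bullet> v"
      by (rule filterlim_compose)
    then show ?thesis by (simp add: s_def mult.commute)
  qed
  have lip: "\<bar>f y - f x\<bar> \<le> B * norm (y - x)" for x y
  proof -
    have "onorm (\<lambda>v. gradient f z \<bullet> v) \<le> B" for z
    proof (rule onorm_bound)
      fix v show "norm (gradient f z \<bullet> v) \<le> B * norm v"
        using Cauchy_Schwarz_ineq2[of "gradient f z" v] mult_right_mono[OF B(2)[of z] norm_ge_zero[of v]]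
        by simp
    qed (use B in simp)
    then show ?thesis
      using differentiable_bound[of UNIV f "\<lambda>x v. gradient f x \<bullet> v" B y x]
        smooth_has_gradient[OF K(1)] by simp
  qed
  have bd: "norm (s n x) \<le> indicator (cball 0 (r + norm v)) x *\<^sub>R (B * norm v)" for n x
  proof (cases "norm x \<le> r + norm v")
    case True
    have "\<bar>f ((1 / real (Suc n)) *\<^sub>R v + x) - f x\<bar> \<le> B * norm v / real (Suc n)"
      using lip[of "(1 / real (Suc n)) *\<^sub>R v + x" x] by simp
    then have "norm (s n x) \<le> B * norm v"
      unfolding s_def by (simp add: abs_mult pos_le_divide_eq mult.commute)
    then show ?thesis using True by (simp add: indicator_def)
  next
    case False
    have "norm ((1 / real (Suc n)) *\<^sub>R v) \<le> norm v"
      by (simp add: divide_simps mult_le_cancel_left1)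
    moreover have "norm x \<le> norm ((1 / real (Suc n)) *\<^sub>R v + x) + norm ((1 / real (Suc n)) *\<^sub>R v)"
      by (metis add.commute add_diff_cancel_left' norm_triangle_sub norm_minus_commute add_diff_cancel)
    ultimately have "norm ((1 / real (Suc n)) *\<^sub>R v + x) > r" using False by linarith
    moreover have "norm x > r" using False norm_ge_zero[of v] by linarith
    ultimately have "(1 / real (Suc n)) *\<^sub>R v + x \<notin> K" "x \<notin> K" using r by auto
    then show ?thesis using False B by (simp add: s_def K(3) indicator_def)
  qed
  have "(\<lambda>n. LBINT x. s n x) \<longlonglongrightarrow> (LBINT x. gradient f x \<bullet> v)"
  proof (rule integral_dominated_convergence[where w = "\<lambda>x. indicator (cball 0 (r + norm v)) x *\<^sub>R (B * norm v)"])
    show "integrable lborel (\<lambda>x::'a. indicator (cball 0 (r + norm v)) x *\<^sub>R (B * norm v))"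
      by (rule borel_integrable_compact) auto
    show "(\<lambda>x. s n x) \<in> borel_measurable lborel" for n unfolding s_def by measurable
  qed (use lim bd in \<open>auto simp del: real_scaleR_def\<close>)
  moreover have "(LBINT x. s n x) = 0" for n
    unfolding s_def using test_integrable[OF f] integral_translate[of f "(1 / real (Suc n)) *\<^sub>R v"]
    by simp
  ultimately show ?thesis by (simp add: LIMSEQ_const_iff)
qed

lemma integral_by_parts_test:
  fixes \<phi> \<psi> :: "'a::euclidean_space \<Rightarrow> real"
  assumes \<phi>: "\<phi> \<in> test_functions \<Omega>" and \<psi>: "\<psi> \<in> test_functions \<Omega>"
  shows "(LBINT x. \<phi> x *\<^sub>R gradient \<psi> x) = - (LBINT x. \<psi> x *\<^sub>R gradient \<phi> x)"
proof (rule euclidean_eqI)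
  fix b :: 'a assume "b \<in> Basis"
  have u: "\<phi> \<in> test_functions UNIV" "\<psi> \<in> test_functions UNIV"
    using \<phi> \<psi> by (auto simp: test_functions_def)
  have 0: "(\<lambda>x. \<phi> x * \<psi> x) \<in> test_functions UNIV" by (intro test_mult u test_smooth[OF u(2)])
  have int: "integrable lborel (\<lambda>x. \<phi> x *\<^sub>R gradient \<psi> x)"
    if t: "\<phi> \<in> test_functions UNIV" "\<psi> \<in> test_functions UNIV" for \<phi> \<psi> :: "'a \<Rightarrow> real"
  proof -
    obtain K where K: "smooth \<phi>" "compact K" "\<And>x. x \<notin> K \<Longrightarrow> \<phi> x = 0"
      using t(1) by (rule test_functionE) auto
    show ?thesis
      by (rule integrable_compact_support[OF _ K(2)])
         (use K(3) t in \<open>auto intro!: continuous_intros test_continuous continuous_gradient test_smooth\<close>)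
  qed
  have g: "gradient (\<lambda>x. \<phi> x * \<psi> x) x = \<phi> x *\<^sub>R gradient \<psi> x + \<psi> x *\<^sub>R gradient \<phi> x" for x
    using gradient_mult test_smooth u by blast
  have "0 = (LBINT x. gradient (\<lambda>x. \<phi> x * \<psi> x) x \<bullet> b)"
    using integral_partial_zero[OF 0] by simp
  also have "\<dots> = (LBINT x. gradient (\<lambda>x. \<phi> x * \<psi> x) x) \<bullet> b"
    using test_integrable(2)[OF 0] by simp
  also have "(LBINT x. gradient (\<lambda>x. \<phi> x * \<psi> x) x) =
      (LBINT x. \<phi> x *\<^sub>R gradient \<psi> x) + (LBINT x. \<psi> x *\<^sub>R gradient \<phi> x)"
    using int[OF u] int[OF u(2,1)] by (simp add: g)
  finally show "(LBINT x. \<phi> x *\<^sub>R gradient \<psi> x) \<bullet> b = - (LBINT x. \<psi> x *\<^sub>R gradient \<phi> x) \<bullet> b"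
    by (simp add: inner_add_left)
qed

section \<open>The fundamental lemma of the calculus of variations\<close>

text \<open>A smooth function that is positive on the open box and zero elsewhere.\<close>

definition box_bump :: "'a::euclidean_space \<Rightarrow> 'a \<Rightarrow> 'a \<Rightarrow> real" where
  "box_bump a b x = (\<Prod>i\<in>Basis. flat 0 (x \<bullet> i - a \<bullet> i) * flat 0 (b \<bullet> i - x \<bullet> i))"

lemma smooth_box_bump: "smooth (box_bump a b)"
proof -
  have "smooth (\<lambda>x. flat 0 (x \<bullet> i - a \<bullet> i) * flat 0 (b \<bullet> i - x \<bullet> i))" for i
    by (intro smooth_intros(3) smooth_compose[OF smooth_flat] smooth_intros(1,5,6))
  then show ?thesis unfolding smooth_def box_bump_def[abs_def] by (auto intro!: Ck_prod)
qed

lemma box_bump_pos: "x \<in> box a b \<Longrightarrow> box_bump a b x > 0"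
  unfolding box_bump_def by (rule prod_pos) (auto simp: flat0_pos mem_box)

lemma box_bump_zero:
  assumes "x \<notin> box a b" shows "box_bump a b x = 0"
proof -
  obtain i where "i \<in> Basis" "x \<bullet> i \<le> a \<bullet> i \<or> b \<bullet> i \<le> x \<bullet> i"
    using assms by (auto simp: mem_box not_less)
  then show ?thesis
    unfolding box_bump_def by (intro prod_zero bexI[of _ i]) (auto simp: flat0_nonpos)
qed

text \<open>Boxes form an intersection-stable generator of the Borel sets, so a signed density whose integral
  over every box vanishes is zero.\<close>

lemma signed_density_zero:
  fixes h :: "'a::euclidean_space \<Rightarrow> real"
  assumes int: "integrable lborel h" and tot: "(LBINT x. h x) = 0"
    and box: "\<And>c d. (LBINT x. indicator (box c d) x *\<^sub>R h x) = 0"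
  shows "AE x in lborel. h x = 0"
proof (rule density_unique_real[OF int integrable_zero])
  fix A :: "'a set" assume "A \<in> sets lborel"
  then have A: "A \<in> sigma_sets UNIV (range (\<lambda>(a::'a, b). box a b))"
    by (simp add: borel_eq_box)
  have bor: "S \<in> sigma_sets UNIV (range (\<lambda>(a::'a, b). box a b)) \<Longrightarrow> S \<in> sets borel" for S
    by (simp add: borel_eq_box)
  have "Int_stable (range (\<lambda>(a::'a, b). box a b))"
    by (auto simp: Int_stable_def box_Int_box)
  moreover have "range (\<lambda>(a::'a, b). box a b) \<subseteq> Pow UNIV" by simp
  ultimately have "(LINT x:A|lborel. h x) = 0" using A
  proof (induction rule: sigma_sets_induct_disjoint)
    case (basic A) then show ?case using box by (auto simp: set_lebesgue_integral_def)
  next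
    case empty then show ?case by (simp add: set_lebesgue_integral_def)
  next
    case (compl A)
    have [measurable]: "A \<in> sets borel" using bor compl(1) .
    have i: "integrable lborel (\<lambda>x. indicator A x *\<^sub>R h x)"
      using int by (intro integrable_mult_indicator) auto
    have "(LINT x:(UNIV - A)|lborel. h x) = (LBINT x. h x - indicator A x *\<^sub>R h x)"
      unfolding set_lebesgue_integral_def by (intro Bochner_Integration.integral_cong) (auto simp: indicator_def)
    also have "\<dots> = 0"
      using int i tot compl(2) by (simp add: set_lebesgue_integral_def)
    finally show ?case .
  next
    case (union A)
    have [measurable]: "A i \<in> sets borel" for i using bor union(2) by auto
    have "integrable lborel (\<lambda>x. indicator (\<Union>i. A i) x *\<^sub>R h x)"
      by (intro integrable_mult_indicator int) measurable
    then have "(LINT x:(\<Union>i. A i)|lborel. h x) = (\<Sum>i. (LINT x:(A i)|lborel. h x))"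
      using union(1)
      by (intro lebesgue_integral_countable_add) (auto simp: disjoint_family_on_def set_integrable_def)
    then show ?case using union(3) by simp
  qed
  then show "(LINT x:A|lborel. h x) = (LINT x:A|lborel. 0)" by (simp add: set_lebesgue_integral_def)
qed

lemma fundamental_lemma_real:
  fixes g :: "'a::euclidean_space \<Rightarrow> real"
  assumes \<Omega>: "open \<Omega>" and meas[measurable]: "g \<in> borel_measurable borel"
    and loc: "\<And>a b. cbox a b \<subseteq> \<Omega> \<Longrightarrow> integrable lborel (\<lambda>x. indicator (cbox a b) x *\<^sub>R g x)"
    and orth: "\<And>\<phi>. \<phi> \<in> test_functions \<Omega> \<Longrightarrow> (LBINT x. \<phi> x * g x) = 0"
  shows "AE x in lborel. x \<in> \<Omega> \<longrightarrow> g x = 0"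
proof -
  have box0: "(LBINT x. indicator (box a b) x *\<^sub>R g x) = 0" if sub: "cbox a b \<subseteq> \<Omega>" for a b
  proof -
    \<comment> \<open>These test functions increase to the indicator function of the open box.\<close>
    define p where "p n x = flat 0 (real (Suc n) * box_bump a b x)" for n x
    have p: "p n \<in> test_functions \<Omega>" for n
    proof (rule test_functionI)
      show "smooth (p n)" unfolding p_def[abs_def]
        by (intro smooth_compose[OF smooth_flat] smooth_intros(1,3) smooth_box_bump)
      show "compact (cbox a b)" "cbox a b \<subseteq> \<Omega>" using sub by auto
      show "p n x = 0" if "x \<notin> cbox a b" for x
      proof -
        have "x \<notin> box a b" using that box_subset_cbox by blast
        then show ?thesis by (simp add: p_def flat_def box_bump_zero)
      qed
    qed
    have [measurable]: "p n \<in> borel_measurable borel" for n using test_measurable[OF p] by blast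
    have "(\<lambda>n. LBINT x. p n x * g x) \<longlonglongrightarrow> (LBINT x. indicator (box a b) x *\<^sub>R g x)"
    proof (rule integral_dominated_convergence[where w = "\<lambda>x. norm (indicator (cbox a b) x *\<^sub>R g x)"])
      show "integrable lborel (\<lambda>x. norm (indicator (cbox a b) x *\<^sub>R g x))"
        using loc[OF sub] by (rule integrable_norm)
      show "AE x in lborel. norm (p n x * g x) \<le> norm (indicator (cbox a b) x *\<^sub>R g x)" for n
      proof (rule AE_I2)
        fix x
        show "norm (p n x * g x) \<le> norm (indicator (cbox a b) x *\<^sub>R g x)"
        proof (cases "x \<in> cbox a b")
          case False
          then have "x \<notin> box a b" using box_subset_cbox by blast
          then show ?thesis by (simp add: p_def flat_def box_bump_zero)
        qed (auto simp: p_def abs_mult flat0_le_1 flat0_nonneg intro!: mult_left_le_one_le)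
      qed
      have "(\<lambda>n. p n x) \<longlonglongrightarrow> indicator (box a b) x" for x
      proof (cases "x \<in> box a b")
        case True
        define c where "c = box_bump a b x"
        have c: "c > 0" using box_bump_pos[OF True] by (simp add: c_def)
        have "(\<lambda>n. exp (- (1 / c * (1 / real (Suc n))))) \<longlonglongrightarrow> exp (- (1 / c * 0))"
          using LIMSEQ_inverse_real_of_nat
          by (intro tendsto_intros) (simp add: inverse_eq_divide)
        moreover have "p n x = exp (- (1 / c * (1 / real (Suc n))))" for n
          using c by (simp add: p_def c_def[symmetric] flat_def)
        ultimately show ?thesis using True by simp
      qed (simp add: p_def box_bump_zero flat_def)
      then show "AE x in lborel. (\<lambda>n. p n x * g x) \<longlonglongrightarrow> indicator (box a b) x *\<^sub>R g x"
        by (auto intro!: tendsto_intros)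
    qed auto
    moreover have "(LBINT x. p n x * g x) = 0" for n using orth[OF p] .
    ultimately show ?thesis by (simp add: LIMSEQ_const_iff)
  qed
  have cb: "AE x in lborel. x \<in> cbox a b \<longrightarrow> g x = 0" if sub: "cbox a b \<subseteq> \<Omega>" for a b
  proof -
    have bsub: "x \<in> cbox a b" if "x \<in> box a b" for x using that box_subset_cbox by blast
    have nul: "AE x in lborel. x \<notin> cbox a b - box a b"
    proof (rule AE_not_in)
      have "cbox a b - box a b \<in> null_sets lebesgue"
        using negligible_frontier_interval negligible_iff_null_sets by blast
      then show "cbox a b - box a b \<in> null_sets lborel"
        by (simp add: null_sets_completion_iff)
    qed
    have "AE x in lborel. indicator (cbox a b) x *\<^sub>R g x = 0"
    proof (rule signed_density_zero[OF loc[OF sub]])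
      have "(LBINT x. indicator (cbox a b) x *\<^sub>R g x) = (LBINT x. indicator (box a b) x *\<^sub>R g x)"
        by (rule integral_cong_AE[OF _ _ AE_mp[OF nul AE_I2]]) (auto simp: indicator_def bsub)
      then show "(LBINT x. indicator (cbox a b) x *\<^sub>R g x) = 0"
        unfolding box0[OF sub] .
      fix c d :: 'a
      obtain e f where ef: "box a b \<inter> box c d = box e f" using box_Int_box[of a b c d] by blast
      have "box e f \<subseteq> box a b" using ef by auto
      show "(LBINT x. indicator (box c d) x *\<^sub>R indicator (cbox a b) x *\<^sub>R g x) = 0"
      proof (cases "box e f = {}")
        case True
        have "(LBINT x. indicator (box c d) x *\<^sub>R indicator (cbox a b) x *\<^sub>R g x) = (\<integral>x. 0 \<partial>(lborel :: 'a measure))"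
          by (rule integral_cong_AE[OF _ _ AE_mp[OF nul AE_I2]]) (use True ef in \<open>auto simp: indicator_def\<close>)
        then show ?thesis by simp
      next
        case False
        have "cbox e f = closure (box e f)" using False by (simp add: closure_box)
        also have "\<dots> \<subseteq> cbox a b"
          using ef box_subset_cbox[of a b] by (intro closure_minimal) auto
        finally have "cbox e f \<subseteq> \<Omega>" using sub by simp
        have "(LBINT x. indicator (box c d) x *\<^sub>R indicator (cbox a b) x *\<^sub>R g x) =
            (LBINT x. indicator (box e f) x *\<^sub>R g x)"
          unfolding ef[symmetric]
          by (rule integral_cong_AE[OF _ _ AE_mp[OF nul AE_I2]]) (auto simp: indicator_def bsub)
        also have "\<dots> = 0" using box0 \<open>cbox e f \<subseteq> \<Omega>\<close> .
        finally show ?thesis .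
      qed
    qed
    then show ?thesis by (rule AE_mp) (auto simp: indicator_def)
  qed
  obtain D where D: "countable D" "D \<subseteq> Pow \<Omega>" "\<And>X. X \<in> D \<Longrightarrow> \<exists>a b. X = cbox a b" "\<Union>D = \<Omega>"
    using open_countable_Union_open_cbox[OF \<Omega>] by metis
  have "AE x in lborel. \<forall>X\<in>D. x \<in> X \<longrightarrow> g x = 0"
  proof (subst AE_ball_countable[OF D(1)], rule ballI)
    fix X assume X: "X \<in> D"
    then obtain a b where "X = cbox a b" using D(3) by blast
    then show "AE x in lborel. x \<in> X \<longrightarrow> g x = 0" using cb[of a b] X D(2) by auto
  qed
  then show ?thesis by (rule AE_mp) (use D(4) in auto)
qed

lemma fundamental_lemma:
  fixes g :: "'a::euclidean_space \<Rightarrow> 'b::euclidean_space"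
  assumes \<Omega>: "open \<Omega>" and meas[measurable]: "g \<in> borel_measurable borel"
    and loc: "\<And>a b. cbox a b \<subseteq> \<Omega> \<Longrightarrow> integrable lborel (\<lambda>x. indicator (cbox a b) x *\<^sub>R g x)"
    and orth: "\<And>\<phi>. \<phi> \<in> test_functions \<Omega> \<Longrightarrow> (LBINT x. \<phi> x *\<^sub>R g x) = 0"
  shows "AE x in lborel. x \<in> \<Omega> \<longrightarrow> g x = 0"
proof -
  have "AE x in lborel. x \<in> \<Omega> \<longrightarrow> g x \<bullet> e = 0" if "e \<in> Basis" for e
  proof (rule fundamental_lemma_real[OF \<Omega>])
    fix a b :: 'a assume ab: "cbox a b \<subseteq> \<Omega>"
    have "integrable lborel (\<lambda>x. (indicator (cbox a b) x *\<^sub>R g x) \<bullet> e)"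
      by (intro integrable_inner_left loc ab)
    then show "integrable lborel (\<lambda>x. indicator (cbox a b) x *\<^sub>R (g x \<bullet> e))"
      by (simp only: inner_scaleR_left real_scaleR_def)
  next
    fix \<phi> assume \<phi>: "\<phi> \<in> test_functions \<Omega>"
    obtain K where K: "smooth \<phi>" "compact K" "K \<subseteq> \<Omega>" "\<And>x. x \<notin> K \<Longrightarrow> \<phi> x = 0"
      using \<phi> by (rule test_functionE) auto
    obtain B where B: "B > 0" "\<And>x. \<bar>\<phi> x\<bar> \<le> B" using test_bounded[OF \<phi>] by metis
    have [measurable]: "\<phi> \<in> borel_measurable borel" using test_measurable[OF \<phi>] by simp
    obtain D where D: "D \<subseteq> {S. \<exists>a b. S = cbox a b \<and> S \<subseteq> \<Omega>}" "finite D" "K \<subseteq> \<Union>D"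
    proof -
      have ex: "\<exists>a b. x \<in> box a b \<and> cbox a b \<subseteq> \<Omega>" if "x \<in> K" for x
        using open_contains_cbox[OF \<Omega>] K(3) that by (metis subsetD)
      then obtain a b where ab: "\<And>x. x \<in> K \<Longrightarrow> x \<in> box (a x) (b x) \<and> cbox (a x) (b x) \<subseteq> \<Omega>" by metis
      obtain T where T: "T \<subseteq> K" "finite T" "K \<subseteq> (\<Union>x\<in>T. box (a x) (b x))"
        by (rule compactE_image[OF K(2), of K "\<lambda>x. box (a x) (b x)"]) (use ab in auto)
      show ?thesis
      proof (rule that)
        show "(\<lambda>x. cbox (a x) (b x)) ` T \<subseteq> {S. \<exists>a b. S = cbox a b \<and> S \<subseteq> \<Omega>}"
          using T(1) ab by blast
        show "K \<subseteq> \<Union> ((\<lambda>x. cbox (a x) (b x)) ` T)"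
          using T(3) box_subset_cbox by blast
      qed (use T(2) in simp)
    qed
    have i1: "integrable lborel (\<lambda>x. \<Sum>S\<in>D. B * norm (indicator S x *\<^sub>R g x))"
      using D loc by (intro Bochner_Integration.integrable_sum integrable_mult_right integrable_norm) auto
    have "integrable lborel (\<lambda>x. \<phi> x *\<^sub>R g x)"
    proof (rule Bochner_Integration.integrable_bound[OF i1])
      show "AE x in lborel. norm (\<phi> x *\<^sub>R g x) \<le> norm (\<Sum>S\<in>D. B * norm (indicator S x *\<^sub>R g x))"
      proof (rule AE_I2)
        fix x
        show "norm (\<phi> x *\<^sub>R g x) \<le> norm (\<Sum>S\<in>D. B * norm (indicator S x *\<^sub>R g x))"
        proof (cases "x \<in> K")
          case True
          then obtain S where S: "S \<in> D" "x \<in> S" using D by auto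
          have "norm (\<phi> x *\<^sub>R g x) \<le> B * norm (indicator S x *\<^sub>R g x)"
            using S B by (auto intro!: mult_right_mono)
          also have "\<dots> \<le> (\<Sum>S\<in>D. B * norm (indicator S x *\<^sub>R g x))"
            using S D B by (intro member_le_sum) auto
          finally show ?thesis by simp
        qed (simp add: K(4))
      qed
    qed auto
    then have "(LBINT x. \<phi> x *\<^sub>R g x) \<bullet> e = (LBINT x. (\<phi> x *\<^sub>R g x) \<bullet> e)"
      by (intro integral_inner_left[symmetric])
    then show "(LBINT x. \<phi> x * (g x \<bullet> e)) = 0" using orth[OF \<phi>] by simp
  qed auto
  then have "AE x in lborel. \<forall>e\<in>Basis. x \<in> \<Omega> \<longrightarrow> g x \<bullet> e = 0"
    by (subst AE_finite_all) auto
  then show ?thesis by (rule AE_mp) (auto simp: euclidean_all_zero_iff)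
qed

section \<open>Weak gradients and Borel representatives\<close>

lemma borel_measurable_lebesgue_on:
  "f \<in> borel_measurable borel \<Longrightarrow> f \<in> borel_measurable (lebesgue_on \<Omega>)"
  by (intro measurable_restrict_space1 measurable_completion) simp

text \<open>The integrals of the definitions are over \<open>lebesgue_on \<Omega>\<close>. Substitution and product measure are
  simpler to use for \<open>lborel\<close>, so functions on \<open>\<Omega>\<close> are replaced by Borel functions on the whole space
  that vanish outside \<open>\<Omega>\<close>.\<close>

lemma borel_modification_real:
  fixes f :: "'a::euclidean_space \<Rightarrow> real"
  assumes \<Omega>: "open \<Omega>" and f: "f \<in> borel_measurable (lebesgue_on \<Omega>)"
  obtains g where "g \<in> borel_measurable borel" "\<And>x. x \<notin> \<Omega> \<Longrightarrow> g x = 0"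
    "AE x in lborel. x \<in> \<Omega> \<longrightarrow> f x = g x"
proof -
  have [measurable]: "\<Omega> \<in> sets borel" using \<Omega> by simp
  have "(\<lambda>x. indicator \<Omega> x *\<^sub>R f x) \<in> borel_measurable lebesgue"
    using f by (subst (asm) borel_measurable_restrict_space_iff) auto
  then obtain g where g: "g \<in> borel_measurable lborel" "AE x in lborel. indicator \<Omega> x *\<^sub>R f x = g x"
    using completion_ex_borel_measurable_real by blast
  show ?thesis
  proof (rule that[of "\<lambda>x. indicator \<Omega> x * g x"])
    show "(\<lambda>x. indicator \<Omega> x * g x) \<in> borel_measurable borel" using g(1) by simp
    show "AE x in lborel. x \<in> \<Omega> \<longrightarrow> f x = indicator \<Omega> x * g x"
      using g(2) by (rule AE_mp) (auto simp: indicator_def)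
  qed simp
qed

lemma borel_modification:
  fixes f :: "'a::euclidean_space \<Rightarrow> 'b::euclidean_space"
  assumes \<Omega>: "open \<Omega>" and f: "f \<in> borel_measurable (lebesgue_on \<Omega>)"
  obtains g where "g \<in> borel_measurable borel" "\<And>x. x \<notin> \<Omega> \<Longrightarrow> g x = 0"
    "AE x in lborel. x \<in> \<Omega> \<longrightarrow> f x = g x"
proof -
  have "\<exists>g. g \<in> borel_measurable borel \<and> (\<forall>x. x \<notin> \<Omega> \<longrightarrow> g x = 0) \<and>
    (AE x in lborel. x \<in> \<Omega> \<longrightarrow> f x \<bullet> e = g x)" for e
    by (rule borel_modification_real[OF \<Omega>, of "\<lambda>x. f x \<bullet> e"]) (use f in auto)
  then obtain g where g: "\<And>e. g e \<in> borel_measurable borel" "\<And>e x. x \<notin> \<Omega> \<Longrightarrow> g e x = 0"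
    "\<And>e. AE x in lborel. x \<in> \<Omega> \<longrightarrow> f x \<bullet> e = g e x" by metis
  note [measurable] = g(1)
  show ?thesis
  proof (rule that[of "\<lambda>x. \<Sum>e\<in>Basis. g e x *\<^sub>R e"])
    have "AE x in lborel. \<forall>e\<in>Basis. x \<in> \<Omega> \<longrightarrow> f x \<bullet> e = g e x"
      by (subst AE_finite_all) (use g(3) in auto)
    then show "AE x in lborel. x \<in> \<Omega> \<longrightarrow> f x = (\<Sum>e\<in>Basis. g e x *\<^sub>R e)"
    proof (rule AE_mp, intro AE_I2 impI)
      fix x assume *: "\<forall>e\<in>Basis. x \<in> \<Omega> \<longrightarrow> f x \<bullet> e = g e x" "x \<in> \<Omega>"
      have "f x = (\<Sum>e\<in>Basis. (f x \<bullet> e) *\<^sub>R e)" by (simp add: euclidean_representation)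
      also have "\<dots> = (\<Sum>e\<in>Basis. g e x *\<^sub>R e)" using * by (intro sum.cong) auto
      finally show "f x = (\<Sum>e\<in>Basis. g e x *\<^sub>R e)" .
    qed
  qed (use g(2) in auto)
qed

lemma lebesgue_on_eq_lborel:
  fixes F F' :: "'a::euclidean_space \<Rightarrow> 'b::euclidean_space"
  assumes \<Omega>: "open \<Omega>" and F: "F \<in> borel_measurable (lebesgue_on \<Omega>)"
    and F': "F' \<in> borel_measurable borel" "\<And>x. x \<notin> \<Omega> \<Longrightarrow> F' x = 0"
    and ae: "AE x in lborel. x \<in> \<Omega> \<longrightarrow> F x = F' x"
  shows "(\<integral>x. F x \<partial>lebesgue_on \<Omega>) = (LBINT x. F' x)"
    and "integrable (lebesgue_on \<Omega>) F \<longleftrightarrow> integrable lborel F'"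
proof -
  have O: "\<Omega> \<inter> space lebesgue \<in> sets lebesgue" using \<Omega> by simp
  have m: "(\<lambda>x. indicator \<Omega> x *\<^sub>R F x) \<in> borel_measurable lebesgue"
    using F by (subst (asm) borel_measurable_restrict_space_iff[OF O]) (simp add: mult.commute)
  have m': "F' \<in> borel_measurable lebesgue" using F'(1) by (simp add: measurable_completion)
  have ae': "AE x in lebesgue. indicator \<Omega> x *\<^sub>R F x = F' x"
    by (rule AE_completion, rule AE_mp[OF ae AE_I2]) (use F'(2) in \<open>auto simp: indicator_def\<close>)
  have L: "F' \<in> borel_measurable lborel" using F'(1) by simp
  show "(\<integral>x. F x \<partial>lebesgue_on \<Omega>) = (LBINT x. F' x)"
    unfolding integral_restrict_space[OF O] integral_completion[OF L, symmetric]
    by (rule integral_cong_AE[OF m m' ae'])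
  show "integrable (lebesgue_on \<Omega>) F \<longleftrightarrow> integrable lborel F'"
    unfolding integrable_restrict_space[OF O] integrable_completion[OF L, symmetric]
    by (rule integrable_cong_AE[OF m m' ae'])
qed

lemma L2_borel:
  assumes \<Omega>: "open \<Omega>" and f: "f \<in> L2 \<Omega>"
  obtains g where "g \<in> borel_measurable borel" "\<And>x. x \<notin> \<Omega> \<Longrightarrow> g x = 0"
    "AE x in lborel. x \<in> \<Omega> \<longrightarrow> f x = g x" "integrable lborel (\<lambda>x. (norm (g x))\<^sup>2)"
proof -
  have m: "f \<in> borel_measurable (lebesgue_on \<Omega>)" and i: "integrable (lebesgue_on \<Omega>) (\<lambda>x. (norm (f x))\<^sup>2)"
    using f by (auto simp: L2_def)
  obtain g where g: "g \<in> borel_measurable borel" "\<And>x. x \<notin> \<Omega> \<Longrightarrow> g x = 0"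
    "AE x in lborel. x \<in> \<Omega> \<longrightarrow> f x = g x" using borel_modification[OF \<Omega> m] by blast
  have "integrable lborel (\<lambda>x. (norm (g x))\<^sup>2)"
    by (subst lebesgue_on_eq_lborel(2)[OF \<Omega>, of "\<lambda>x. (norm (f x))\<^sup>2", symmetric])
       (use m g i in \<open>auto elim: AE_mp\<close>)
  with g show ?thesis by (rule that)
qed

lemma L2_of_borel:
  assumes \<Omega>: "open \<Omega>" and g: "g \<in> borel_measurable borel" "\<And>x. x \<notin> \<Omega> \<Longrightarrow> g x = 0"
    and i: "integrable lborel (\<lambda>x. (norm (g x))\<^sup>2)"
  shows "g \<in> L2 \<Omega>"
proof -
  have "integrable (lebesgue_on \<Omega>) (\<lambda>x. (norm (g x))\<^sup>2)"
    by (subst lebesgue_on_eq_lborel(2)[OF \<Omega>, of _ "\<lambda>x. (norm (g x))\<^sup>2"])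
       (use g i in \<open>auto intro: borel_measurable_lebesgue_on\<close>)
  then show ?thesis using g by (auto simp: L2_def intro: borel_measurable_lebesgue_on)
qed

lemma is_weak_gradient_borel:
  fixes u :: "'a::euclidean_space \<Rightarrow> real"
  assumes \<Omega>: "open \<Omega>"
    and u: "u \<in> borel_measurable (lebesgue_on \<Omega>)" and U[measurable]: "U \<in> borel_measurable borel"
    and uU: "AE x in lborel. x \<in> \<Omega> \<longrightarrow> u x = U x"
    and g: "g \<in> borel_measurable (lebesgue_on \<Omega>)" and G[measurable]: "G \<in> borel_measurable borel"
    and gG: "AE x in lborel. x \<in> \<Omega> \<longrightarrow> g x = G x"
  shows "is_weak_gradient \<Omega> u g \<longleftrightarrow> (\<forall>\<phi>\<in>test_functions \<Omega>.
      (LBINT x. U x *\<^sub>R gradient \<phi> x) = - (LBINT x. \<phi> x *\<^sub>R G x))"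
proof -
  have "(\<integral>x. u x *\<^sub>R gradient \<phi> x \<partial>lebesgue_on \<Omega>) = (LBINT x. U x *\<^sub>R gradient \<phi> x)"
    "(\<integral>x. \<phi> x *\<^sub>R g x \<partial>lebesgue_on \<Omega>) = (LBINT x. \<phi> x *\<^sub>R G x)"
    if \<phi>: "\<phi> \<in> test_functions \<Omega>" for \<phi>
  proof -
    note [measurable] = test_measurable[OF \<phi>]
    note [measurable] = borel_measurable_lebesgue_on[OF test_measurable(1)[OF \<phi>], of \<Omega>]
      borel_measurable_lebesgue_on[OF test_measurable(2)[OF \<phi>], of \<Omega>]
    show "(\<integral>x. u x *\<^sub>R gradient \<phi> x \<partial>lebesgue_on \<Omega>) = (LBINT x. U x *\<^sub>R gradient \<phi> x)"
      by (rule lebesgue_on_eq_lborel[OF \<Omega>])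
         (use u uU in \<open>auto simp: test_gradient_outside[OF \<phi>] elim: AE_mp\<close>)
    show "(\<integral>x. \<phi> x *\<^sub>R g x \<partial>lebesgue_on \<Omega>) = (LBINT x. \<phi> x *\<^sub>R G x)"
      by (rule lebesgue_on_eq_lborel[OF \<Omega>])
         (use g gG in \<open>auto simp: test_outside[OF \<phi>] elim: AE_mp\<close>)
  qed
  then show ?thesis unfolding is_weak_gradient_def by simp
qed

lemma two_mult_le_sum_squares: "2 * (a * b) \<le> a\<^sup>2 + b\<^sup>2" for a b :: real
  using sum_squares_bound[of a b] by simp

lemma square_integrable_scaleR:
  fixes f :: "'a \<Rightarrow> real" and g :: "'a \<Rightarrow> 'b::euclidean_space"
  assumes [measurable]: "f \<in> borel_measurable M" "g \<in> borel_measurable M"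
    and "integrable M (\<lambda>x. (f x)\<^sup>2)" "integrable M (\<lambda>x. (norm (g x))\<^sup>2)"
  shows "integrable M (\<lambda>x. f x *\<^sub>R g x)"
proof (rule Bochner_Integration.integrable_bound)
  show "integrable M (\<lambda>x. (f x)\<^sup>2 + (norm (g x))\<^sup>2)" using assms by auto
  show "AE x in M. norm (f x *\<^sub>R g x) \<le> norm ((f x)\<^sup>2 + (norm (g x))\<^sup>2)"
  proof (rule AE_I2)
    fix x
    have "2 * (\<bar>f x\<bar> * norm (g x)) \<le> \<bar>f x\<bar>\<^sup>2 + (norm (g x))\<^sup>2" by (rule two_mult_le_sum_squares)
    moreover have "0 \<le> \<bar>f x\<bar> * norm (g x)" by simp
    ultimately have "\<bar>f x\<bar> * norm (g x) \<le> (f x)\<^sup>2 + (norm (g x))\<^sup>2" unfolding power2_abs by linarith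
    then show "norm (f x *\<^sub>R g x) \<le> norm ((f x)\<^sup>2 + (norm (g x))\<^sup>2)" by simp
  qed
qed auto

lemma square_integrable_inner:
  fixes f g :: "'a \<Rightarrow> 'b::euclidean_space"
  assumes [measurable]: "f \<in> borel_measurable M" "g \<in> borel_measurable M"
    and "integrable M (\<lambda>x. (norm (f x))\<^sup>2)" "integrable M (\<lambda>x. (norm (g x))\<^sup>2)"
  shows "integrable M (\<lambda>x. f x \<bullet> g x)"
proof (rule Bochner_Integration.integrable_bound)
  show "integrable M (\<lambda>x. (norm (f x))\<^sup>2 + (norm (g x))\<^sup>2)" using assms by auto
  show "AE x in M. norm (f x \<bullet> g x) \<le> norm ((norm (f x))\<^sup>2 + (norm (g x))\<^sup>2)"
  proof (rule AE_I2)
    fix x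
    have "2 * (norm (f x) * norm (g x)) \<le> (norm (f x))\<^sup>2 + (norm (g x))\<^sup>2" by (rule two_mult_le_sum_squares)
    moreover have "\<bar>f x \<bullet> g x\<bar> \<le> norm (f x) * norm (g x)" by (rule Cauchy_Schwarz_ineq2)
    moreover have "0 \<le> norm (f x) * norm (g x)" by simp
    ultimately have "\<bar>f x \<bullet> g x\<bar> \<le> (norm (f x))\<^sup>2 + (norm (g x))\<^sup>2" by linarith
    then show "norm (f x \<bullet> g x) \<le> norm ((norm (f x))\<^sup>2 + (norm (g x))\<^sup>2)" by simp
  qed
qed auto

lemma square_integrable_diff:
  fixes f g :: "'a \<Rightarrow> 'b::euclidean_space"
  assumes [measurable]: "f \<in> borel_measurable M" "g \<in> borel_measurable M"
    and i: "integrable M (\<lambda>x. (norm (f x))\<^sup>2)" "integrable M (\<lambda>x. (norm (g x))\<^sup>2)"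
  shows "integrable M (\<lambda>x. (norm (f x - g x))\<^sup>2)"
proof -
  have "(norm (f x - g x))\<^sup>2 = (norm (f x))\<^sup>2 + (norm (g x))\<^sup>2 - 2 * (f x \<bullet> g x)" for x
    by (simp add: power2_norm_eq_inner inner_diff inner_commute)
  then show ?thesis
    using i square_integrable_inner[OF assms] by simp
qed

lemma weak_gradient_unique:
  fixes u :: "'a::euclidean_space \<Rightarrow> real"
  assumes \<Omega>: "open \<Omega>" and u: "u \<in> L2 \<Omega>"
    and g: "g \<in> L2 \<Omega>" "is_weak_gradient \<Omega> u g"
    and h: "h \<in> L2 \<Omega>" "is_weak_gradient \<Omega> u h"
  shows "AE x in lborel. x \<in> \<Omega> \<longrightarrow> g x = h x"
proof -
  obtain U where U: "U \<in> borel_measurable borel" "\<And>x. x \<notin> \<Omega> \<Longrightarrow> U x = 0"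
    "AE x in lborel. x \<in> \<Omega> \<longrightarrow> u x = U x" "integrable lborel (\<lambda>x. (norm (U x))\<^sup>2)" by (rule L2_borel[OF \<Omega> u]) blast
  obtain G where G: "G \<in> borel_measurable borel" "\<And>x. x \<notin> \<Omega> \<Longrightarrow> G x = 0"
    "AE x in lborel. x \<in> \<Omega> \<longrightarrow> g x = G x" "integrable lborel (\<lambda>x. (norm (G x))\<^sup>2)"
    by (rule L2_borel[OF \<Omega> g(1)]) blast
  obtain H where H: "H \<in> borel_measurable borel" "\<And>x. x \<notin> \<Omega> \<Longrightarrow> H x = 0"
    "AE x in lborel. x \<in> \<Omega> \<longrightarrow> h x = H x" "integrable lborel (\<lambda>x. (norm (H x))\<^sup>2)"
    by (rule L2_borel[OF \<Omega> h(1)]) blast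
  note [measurable] = G(1) H(1)
  have L2m: "f \<in> L2 \<Omega> \<Longrightarrow> f \<in> borel_measurable (lebesgue_on \<Omega>)" for f :: "'a \<Rightarrow> 'c::euclidean_space"
    by (simp add: L2_def)
  note wg = is_weak_gradient_borel[OF \<Omega> L2m[OF u] U(1,3) L2m[OF g(1)] G(1,3)]
  note wh = is_weak_gradient_borel[OF \<Omega> L2m[OF u] U(1,3) L2m[OF h(1)] H(1,3)]
  have "AE x in lborel. x \<in> \<Omega> \<longrightarrow> G x - H x = 0"
  proof (rule fundamental_lemma[OF \<Omega>])
    fix a b :: 'a
    show "integrable lborel (\<lambda>x. indicator (cbox a b) x *\<^sub>R (G x - H x))"
    proof (rule square_integrable_scaleR)
      have "(\<lambda>x. (indicator (cbox a b) x :: real)\<^sup>2) = indicator (cbox a b)" by (auto simp: indicator_def)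
      then show "integrable lborel (\<lambda>x. (indicator (cbox a b) x :: real)\<^sup>2)"
        using borel_integrable_compact[of "cbox a b" "\<lambda>_. 1::real"] by simp
    qed (use G(4) H(4) in \<open>auto intro!: square_integrable_diff\<close>)
  next
    fix \<phi> assume \<phi>: "\<phi> \<in> test_functions \<Omega>"
    note [measurable] = test_measurable[OF \<phi>]
    have "integrable lborel (\<lambda>x. \<phi> x *\<^sub>R G x)" "integrable lborel (\<lambda>x. \<phi> x *\<^sub>R H x)"
      using G(4) H(4) test_integrable[OF \<phi>] by (auto intro!: square_integrable_scaleR)
    moreover have "(LBINT x. \<phi> x *\<^sub>R G x) = (LBINT x. \<phi> x *\<^sub>R H x)"
      using wg g(2) wh h(2) \<phi> by (metis add.inverse_inverse)
    ultimately show "(LBINT x. \<phi> x *\<^sub>R (G x - H x)) = 0"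
      by (simp add: scaleR_diff_right)
  qed auto
  with G(3) H(3) show ?thesis by eventually_elim auto
qed

lemma weak_gradient_eq:
  fixes u :: "'a::euclidean_space \<Rightarrow> real"
  assumes \<Omega>: "open \<Omega>" and u: "u \<in> L2 \<Omega>" and g: "g \<in> L2 \<Omega>" "is_weak_gradient \<Omega> u g"
  shows "AE x in lborel. x \<in> \<Omega> \<longrightarrow> weak_gradient \<Omega> u x = g x" and "weak_gradient \<Omega> u \<in> L2 \<Omega>"
    and "is_weak_gradient \<Omega> u (weak_gradient \<Omega> u)"
proof -
  have *: "weak_gradient \<Omega> u \<in> L2 \<Omega> \<and> is_weak_gradient \<Omega> u (weak_gradient \<Omega> u)"
    unfolding weak_gradient_def by (rule someI[of _ g]) (use g in auto)
  then show "weak_gradient \<Omega> u \<in> L2 \<Omega>" "is_weak_gradient \<Omega> u (weak_gradient \<Omega> u)" by auto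
  show "AE x in lborel. x \<in> \<Omega> \<longrightarrow> weak_gradient \<Omega> u x = g x"
    by (rule weak_gradient_unique[OF \<Omega> u _ _ g]) (use * in auto)
qed

lemma test_weak_gradient:
  assumes \<Omega>: "open \<Omega>" and \<phi>: "\<phi> \<in> test_functions \<Omega>"
  shows "\<phi> \<in> L2 \<Omega>" "gradient \<phi> \<in> L2 \<Omega>" "is_weak_gradient \<Omega> \<phi> (gradient \<phi>)"
proof -
  note m = test_measurable[OF \<phi>]
  show "\<phi> \<in> L2 \<Omega>" "gradient \<phi> \<in> L2 \<Omega>"
    using test_integrable[OF \<phi>]
    by (auto intro!: L2_of_borel[OF \<Omega>] m simp: test_outside[OF \<phi>] test_gradient_outside[OF \<phi>])
  show "is_weak_gradient \<Omega> \<phi> (gradient \<phi>)"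
    by (subst is_weak_gradient_borel[OF \<Omega> borel_measurable_lebesgue_on[OF m(1)] m(1) _
          borel_measurable_lebesgue_on[OF m(2)] m(2)])
       (auto intro: integral_by_parts_test[OF \<phi>])
qed

lemma H1_norm_borel:
  fixes v :: "'a::euclidean_space \<Rightarrow> real"
  assumes \<Omega>: "open \<Omega>" and v: "v \<in> L2 \<Omega>" and g: "g \<in> L2 \<Omega>" "is_weak_gradient \<Omega> v g"
    and V: "V \<in> borel_measurable borel" "\<And>x. x \<notin> \<Omega> \<Longrightarrow> V x = 0" "AE x in lborel. x \<in> \<Omega> \<longrightarrow> v x = V x"
    and G: "G \<in> borel_measurable borel" "\<And>x. x \<notin> \<Omega> \<Longrightarrow> G x = 0" "AE x in lborel. x \<in> \<Omega> \<longrightarrow> g x = G x"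
  shows "H1_norm \<Omega> v = sqrt ((LBINT x. (V x)\<^sup>2) + (LBINT x. (norm (G x))\<^sup>2))"
proof -
  note w = weak_gradient_eq[OF \<Omega> v g]
  have m: "v \<in> borel_measurable (lebesgue_on \<Omega>)" "weak_gradient \<Omega> v \<in> borel_measurable (lebesgue_on \<Omega>)"
    using v w(2) by (auto simp: L2_def)
  have wG: "AE x in lborel. x \<in> \<Omega> \<longrightarrow> weak_gradient \<Omega> v x = G x"
    using w(1) G(3) by eventually_elim auto
  have "(\<integral>x. (v x)\<^sup>2 \<partial>lebesgue_on \<Omega>) = (LBINT x. (V x)\<^sup>2)"
    by (rule lebesgue_on_eq_lborel[OF \<Omega>]) (use V m in \<open>auto elim: AE_mp\<close>)
  moreover have "(\<integral>x. (norm (weak_gradient \<Omega> v x))\<^sup>2 \<partial>lebesgue_on \<Omega>) = (LBINT x. (norm (G x))\<^sup>2)"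
    by (rule lebesgue_on_eq_lborel[OF \<Omega>]) (use G wG m in \<open>auto elim: AE_mp\<close>)
  ultimately show ?thesis by (simp add: H1_norm_def)
qed

lemma test_in_H10:
  fixes \<phi> :: "'a::euclidean_space \<Rightarrow> real"
  assumes \<Omega>: "open \<Omega>" and \<phi>: "\<phi> \<in> test_functions \<Omega>"
  shows "\<phi> \<in> H10 \<Omega>"
proof -
  have 0: "(\<lambda>_. 0) \<in> test_functions \<Omega>"
    by (rule test_functionI[of _ "{}"]) (auto intro: smooth_intros)
  have g0: "gradient (\<lambda>_::'a. 0) = (\<lambda>_. 0)" using gradient_zero by blast
  have "H1_norm \<Omega> (\<lambda>x. 0) = sqrt ((\<integral>x. (0::real)\<^sup>2 \<partial>(lborel :: 'a measure)) + (\<integral>x. (norm (0::'a))\<^sup>2 \<partial>(lborel :: 'a measure)))"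
    by (rule H1_norm_borel[OF \<Omega> test_weak_gradient[OF \<Omega> 0]]) (auto simp: g0)
  then have "H1_norm \<Omega> (\<lambda>x. \<phi> x - \<phi> x) = 0" by simp
  then show ?thesis
    using test_weak_gradient[OF \<Omega> \<phi>] \<phi> unfolding H10_def H1_def
    by (auto intro!: bexI[of _ \<phi>] bexI[of _ "gradient \<phi>"])
qed

section \<open>Weak solutions in terms of Borel functions\<close>

text \<open>The properties of a variational solution that the argument uses, for a Borel version \<open>U\<close> of the
  solution and \<open>G\<close> of its weak gradient, both extended by zero. Only test functions occur in the
  equation, and membership in \<open>H\<^sup>1\<^sub>0\<close> enters through the approximation by test functions.\<close>

locale weak_solution =
  fixes \<Omega> :: "'a::euclidean_space set" and U :: "'a \<Rightarrow> real" and G :: "'a \<Rightarrow> 'a"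
  assumes open_domain: "open \<Omega>" and finite_domain: "emeasure lborel \<Omega> < \<infinity>"
    and U_borel [measurable]: "U \<in> borel_measurable borel" and G_borel [measurable]: "G \<in> borel_measurable borel"
    and U_outside: "x \<notin> \<Omega> \<Longrightarrow> U x = 0" and G_outside: "x \<notin> \<Omega> \<Longrightarrow> G x = 0"
    and U_sq: "integrable lborel (\<lambda>x. (U x)\<^sup>2)" and G_sq: "integrable lborel (\<lambda>x. (norm (G x))\<^sup>2)"
    and weak: "\<phi> \<in> test_functions \<Omega> \<Longrightarrow>
        (LBINT x. U x *\<^sub>R gradient \<phi> x) = - (LBINT x. \<phi> x *\<^sub>R G x)"
    and approx: "\<delta> > 0 \<Longrightarrow> \<exists>\<phi>\<in>test_functions \<Omega>.
        (LBINT x. (U x - \<phi> x)\<^sup>2) < \<delta> \<and> (LBINT x. (norm (G x - gradient \<phi> x))\<^sup>2) < \<delta>"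
    and source_integrable: "\<phi> \<in> test_functions \<Omega> \<Longrightarrow> integrable lborel (\<lambda>x. exp (- U x) * \<phi> x)"
    and equation: "\<phi> \<in> test_functions \<Omega> \<Longrightarrow>
        (LBINT x. G x \<bullet> gradient \<phi> x) = (LBINT x. exp (- U x) * \<phi> x)"

lemma variational_solution_weak_solution:
  fixes u :: "'a::euclidean_space \<Rightarrow> real"
  assumes \<Omega>: "open \<Omega>" "emeasure lborel \<Omega> < \<infinity>" and sol: "variational_solution \<Omega> u"
  obtains U G where "weak_solution \<Omega> U G" "AE x in lborel. x \<in> \<Omega> \<longrightarrow> u x = U x"
proof -
  have u10: "u \<in> H10 \<Omega>" using sol by (simp add: variational_solution_def)
  then have "u \<in> H1 \<Omega>" by (simp add: H10_def)
  then obtain g where u: "u \<in> L2 \<Omega>" and g: "g \<in> L2 \<Omega>" "is_weak_gradient \<Omega> u g"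
    by (auto simp: H1_def)
  obtain U where U: "U \<in> borel_measurable borel" "\<And>x. x \<notin> \<Omega> \<Longrightarrow> U x = 0"
    "AE x in lborel. x \<in> \<Omega> \<longrightarrow> u x = U x" "integrable lborel (\<lambda>x. (norm (U x))\<^sup>2)"
    by (rule L2_borel[OF \<Omega>(1) u]) blast
  obtain G where G: "G \<in> borel_measurable borel" "\<And>x. x \<notin> \<Omega> \<Longrightarrow> G x = 0"
    "AE x in lborel. x \<in> \<Omega> \<longrightarrow> g x = G x" "integrable lborel (\<lambda>x. (norm (G x))\<^sup>2)"
    by (rule L2_borel[OF \<Omega>(1) g(1)]) blast
  note [measurable] = U(1) G(1)
  have mu[measurable]: "u \<in> borel_measurable (lebesgue_on \<Omega>)" and mg: "g \<in> borel_measurable (lebesgue_on \<Omega>)"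
    using u g by (auto simp: L2_def)
  have wk: "(LBINT x. U x *\<^sub>R gradient \<phi> x) = - (LBINT x. \<phi> x *\<^sub>R G x)"
    if "\<phi> \<in> test_functions \<Omega>" for \<phi>
    using is_weak_gradient_borel[OF \<Omega>(1) mu U(1,3) mg G(1,3)] g(2) that by blast
  have wG: "AE x in lborel. x \<in> \<Omega> \<longrightarrow> weak_gradient \<Omega> u x = G x"
    using weak_gradient_eq(1)[OF \<Omega>(1) u g] G(3) by eventually_elim auto
  have mw[measurable]: "weak_gradient \<Omega> u \<in> borel_measurable (lebesgue_on \<Omega>)"
    using weak_gradient_eq(2)[OF \<Omega>(1) u g] by (simp add: L2_def)
  have "weak_solution \<Omega> U G"
  proof
    fix \<delta> :: real assume "\<delta> > 0"
    then have "sqrt \<delta> > 0" by simp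
    then obtain \<phi> where \<phi>: "\<phi> \<in> test_functions \<Omega>" and lt: "H1_norm \<Omega> (\<lambda>x. u x - \<phi> x) < sqrt \<delta>"
      using u10 unfolding H10_def by blast
    note [measurable] = test_measurable[OF \<phi>]
    note t = test_integrable[OF \<phi>]
    have dU: "integrable lborel (\<lambda>x. (norm (U x - \<phi> x))\<^sup>2)"
      using U(4) t(3) by (intro square_integrable_diff) auto
    have dG: "integrable lborel (\<lambda>x. (norm (G x - gradient \<phi> x))\<^sup>2)"
      using G(4) t(4) by (intro square_integrable_diff) auto
    have L: "(\<lambda>x. U x - \<phi> x) \<in> L2 \<Omega>" "(\<lambda>x. G x - gradient \<phi> x) \<in> L2 \<Omega>"
      using dU dG U(2) G(2) test_outside[OF \<phi>] test_gradient_outside[OF \<phi>]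
      by (auto intro!: L2_of_borel[OF \<Omega>(1)])
    have mub: "(\<lambda>x. u x - \<phi> x) \<in> borel_measurable (lebesgue_on \<Omega>)"
      using borel_measurable_lebesgue_on[OF test_measurable(1)[OF \<phi>]] mu by measurable
    have ae: "AE x in lborel. x \<in> \<Omega> \<longrightarrow> u x - \<phi> x = U x - \<phi> x"
      using U(3) by eventually_elim auto
    have Lu: "(\<lambda>x. u x - \<phi> x) \<in> L2 \<Omega>"
    proof -
      have "integrable (lebesgue_on \<Omega>) (\<lambda>x. (norm (u x - \<phi> x))\<^sup>2)"
        by (subst lebesgue_on_eq_lborel(2)[OF \<Omega>(1), of _ "\<lambda>x. (norm (U x - \<phi> x))\<^sup>2"])
           (use dU ae mub U(2) test_outside[OF \<phi>] in \<open>auto elim: AE_mp\<close>)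
      then show ?thesis using mub by (simp add: L2_def)
    qed
    have wd: "is_weak_gradient \<Omega> (\<lambda>x. u x - \<phi> x) (\<lambda>x. G x - gradient \<phi> x)"
    proof (subst is_weak_gradient_borel[OF \<Omega>(1) mub _ ae])
      show "\<forall>\<psi>\<in>test_functions \<Omega>. (LBINT x. (U x - \<phi> x) *\<^sub>R gradient \<psi> x) =
          - (LBINT x. \<psi> x *\<^sub>R (G x - gradient \<phi> x))"
      proof
        fix \<psi> assume \<psi>: "\<psi> \<in> test_functions \<Omega>"
        note [measurable] = test_measurable[OF \<psi>]
        have "integrable lborel (\<lambda>x. U x *\<^sub>R gradient \<psi> x)" "integrable lborel (\<lambda>x. \<phi> x *\<^sub>R gradient \<psi> x)"
          "integrable lborel (\<lambda>x. \<psi> x *\<^sub>R G x)" "integrable lborel (\<lambda>x. \<psi> x *\<^sub>R gradient \<phi> x)"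
          using U(4) G(4) t test_integrable[OF \<psi>] by (auto intro!: square_integrable_scaleR)
        then show "(LBINT x. (U x - \<phi> x) *\<^sub>R gradient \<psi> x) =
          - (LBINT x. \<psi> x *\<^sub>R (G x - gradient \<phi> x))"
          using wk[OF \<psi>] integral_by_parts_test[OF \<phi> \<psi>]
          by (simp add: scaleR_diff_left scaleR_diff_right)
      qed
    qed (auto intro!: borel_measurable_lebesgue_on)
    have "H1_norm \<Omega> (\<lambda>x. u x - \<phi> x) =
        sqrt ((LBINT x. (U x - \<phi> x)\<^sup>2) + (LBINT x. (norm (G x - gradient \<phi> x))\<^sup>2))"
      by (rule H1_norm_borel[OF \<Omega>(1) Lu L(2) wd])
         (use ae U(2) G(2) test_outside[OF \<phi>] test_gradient_outside[OF \<phi>] in auto)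
    with lt have "(LBINT x. (U x - \<phi> x)\<^sup>2) + (LBINT x. (norm (G x - gradient \<phi> x))\<^sup>2) < \<delta>"
      by simp
    moreover have nn: "0 \<le> (LBINT x. (U x - \<phi> x)\<^sup>2)" "0 \<le> (LBINT x. (norm (G x - gradient \<phi> x))\<^sup>2)"
      by auto
    ultimately have "(LBINT x. (U x - \<phi> x)\<^sup>2) < \<delta>"
      "(LBINT x. (norm (G x - gradient \<phi> x))\<^sup>2) < \<delta>"
      using nn by linarith+
    then show "\<exists>\<phi>\<in>test_functions \<Omega>.
        (LBINT x. (U x - \<phi> x)\<^sup>2) < \<delta> \<and> (LBINT x. (norm (G x - gradient \<phi> x))\<^sup>2) < \<delta>"
      using \<phi> by (intro bexI[of _ \<phi>]) auto
  next
    fix \<phi> assume \<phi>: "\<phi> \<in> test_functions \<Omega>"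
    note [measurable] = test_measurable[OF \<phi>]
    have v: "integrable (lebesgue_on \<Omega>) (\<lambda>x. exp (- u x) * \<phi> x)"
      "(\<integral>x. weak_gradient \<Omega> u x \<bullet> weak_gradient \<Omega> \<phi> x \<partial>lebesgue_on \<Omega>) = (\<integral>x. exp (- u x) * \<phi> x \<partial>lebesgue_on \<Omega>)"
      using sol test_in_H10[OF \<Omega>(1) \<phi>] by (auto simp: variational_solution_def)
    note wt = weak_gradient_eq[OF \<Omega>(1) test_weak_gradient[OF \<Omega>(1) \<phi>]]
    have mt: "weak_gradient \<Omega> \<phi> \<in> borel_measurable (lebesgue_on \<Omega>)" using wt(2) by (simp add: L2_def)
    have me: "(\<lambda>x. exp (- u x) * \<phi> x) \<in> borel_measurable (lebesgue_on \<Omega>)"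
      using borel_measurable_lebesgue_on[OF test_measurable(1)[OF \<phi>]] mu by measurable
    have ae: "AE x in lborel. x \<in> \<Omega> \<longrightarrow> exp (- u x) * \<phi> x = exp (- U x) * \<phi> x"
      using U(3) by eventually_elim auto
    have mU: "(\<lambda>x. exp (- U x) * \<phi> x) \<in> borel_measurable borel" by measurable
    have "exp (- U x) * \<phi> x = 0" if "x \<notin> \<Omega>" for x using test_outside[OF \<phi> that] by simp
    note e = lebesgue_on_eq_lborel[OF \<Omega>(1) me mU this ae]
    show "integrable lborel (\<lambda>x. exp (- U x) * \<phi> x)" using e(2) v(1) by blast
    have "(\<integral>x. weak_gradient \<Omega> u x \<bullet> weak_gradient \<Omega> \<phi> x \<partial>lebesgue_on \<Omega>) = (LBINT x. G x \<bullet> gradient \<phi> x)"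
    proof (rule lebesgue_on_eq_lborel[OF \<Omega>(1)])
      show "(\<lambda>x. weak_gradient \<Omega> u x \<bullet> weak_gradient \<Omega> \<phi> x) \<in> borel_measurable (lebesgue_on \<Omega>)"
        using mw mt by measurable
      show "AE x in lborel. x \<in> \<Omega> \<longrightarrow> weak_gradient \<Omega> u x \<bullet> weak_gradient \<Omega> \<phi> x = G x \<bullet> gradient \<phi> x"
        using wG wt(1) by eventually_elim auto
    qed (use G(2) in auto)
    then show "(LBINT x. G x \<bullet> gradient \<phi> x) = (LBINT x. exp (- U x) * \<phi> x)"
      using v(2) e(1) by simp
  qed (use \<Omega> U G wk in auto)
  then show ?thesis using U(3) by (rule that)
qed

section \<open>Testing the equation\<close>

lemma integral_inner_bound:
  fixes f g :: "'a \<Rightarrow> 'b::euclidean_space"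
  assumes [measurable]: "f \<in> borel_measurable M" "g \<in> borel_measurable M"
    and i: "integrable M (\<lambda>x. (norm (f x))\<^sup>2)" "integrable M (\<lambda>x. (norm (g x))\<^sup>2)" and t: "t > 0"
  shows "\<bar>\<integral>x. f x \<bullet> g x \<partial>M\<bar> \<le> ((\<integral>x. (norm (f x))\<^sup>2 \<partial>M) / t + t * (\<integral>x. (norm (g x))\<^sup>2 \<partial>M)) / 2"
proof -
  have pt: "\<bar>f x \<bullet> g x\<bar> \<le> ((norm (f x))\<^sup>2 / t + t * (norm (g x))\<^sup>2) / 2" for x
  proof -
    have "2 * ((norm (f x) / sqrt t) * (sqrt t * norm (g x))) \<le> (norm (f x) / sqrt t)\<^sup>2 + (sqrt t * norm (g x))\<^sup>2"
      by (rule two_mult_le_sum_squares)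
    then have "2 * (norm (f x) * norm (g x)) \<le> (norm (f x))\<^sup>2 / t + t * (norm (g x))\<^sup>2"
      using t by (simp add: power_divide power_mult_distrib)
    moreover have "\<bar>f x \<bullet> g x\<bar> \<le> norm (f x) * norm (g x)" by (rule Cauchy_Schwarz_ineq2)
    ultimately have "2 * \<bar>f x \<bullet> g x\<bar> \<le> (norm (f x))\<^sup>2 / t + t * (norm (g x))\<^sup>2" by linarith
    then show ?thesis by simp
  qed
  note fg = square_integrable_inner[OF assms(1,2) i]
  have "\<bar>\<integral>x. f x \<bullet> g x \<partial>M\<bar> \<le> (\<integral>x. \<bar>f x \<bullet> g x\<bar> \<partial>M)" by (rule integral_abs_bound)
  also have "\<dots> \<le> (\<integral>x. ((norm (f x))\<^sup>2 / t + t * (norm (g x))\<^sup>2) / 2 \<partial>M)"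
    using fg i pt by (intro integral_mono) auto
  also have "\<dots> = ((\<integral>x. (norm (f x))\<^sup>2 \<partial>M) / t + t * (\<integral>x. (norm (g x))\<^sup>2 \<partial>M)) / 2"
    using i by simp
  finally show ?thesis .
qed

lemma norm_diff_sq_le: "(norm (a - c))\<^sup>2 \<le> 2 * (norm (a - b))\<^sup>2 + 2 * (norm (b - c))\<^sup>2"
  for a b c :: "'a::real_inner"
proof -
  have "norm (a - c) \<le> norm (a - b) + norm (b - c)" using norm_triangle_ineq[of "a - b" "b - c"] by simp
  then have "(norm (a - c))\<^sup>2 \<le> (norm (a - b) + norm (b - c))\<^sup>2" by (intro power_mono) auto
  also have "\<dots> \<le> 2 * (norm (a - b))\<^sup>2 + 2 * (norm (b - c))\<^sup>2"
    using two_mult_le_sum_squares[of "norm (a - b)" "norm (b - c)"] by (simp add: power2_sum)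
  finally show ?thesis .
qed

lemma nonneg_AE_zero:
  fixes f :: "'a \<Rightarrow> real"
  assumes f: "integrable M f" "\<And>x. f x \<ge> 0" and small: "\<And>\<delta>. 0 < \<delta> \<Longrightarrow> \<delta> \<le> 1 \<Longrightarrow> (\<integral>x. f x \<partial>M) \<le> C * \<delta>"
  shows "AE x in M. f x = 0"
proof -
  have "(\<integral>x. f x \<partial>M) \<le> 0"
  proof (rule ccontr)
    assume "\<not> ?thesis"
    then have I: "(\<integral>x. f x \<partial>M) > 0" by simp
    define \<delta> where "\<delta> = min 1 ((\<integral>x. f x \<partial>M) / (2 * (\<bar>C\<bar> + 1)))"
    have d: "0 < \<delta>" "\<delta> \<le> 1" "\<delta> \<le> (\<integral>x. f x \<partial>M) / (2 * (\<bar>C\<bar> + 1))"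
      using I by (auto simp: \<delta>_def)
    have "(\<integral>x. f x \<partial>M) \<le> C * \<delta>" using small d by blast
    also have "\<dots> \<le> (\<bar>C\<bar> + 1) * \<delta>" using d by (intro mult_right_mono) auto
    also have "\<dots> \<le> (\<integral>x. f x \<partial>M) / 2" using d(3) by (simp add: field_simps)
    finally show False using I by simp
  qed
  moreover have "(\<integral>x. f x \<partial>M) \<ge> 0" using f(2) by simp
  ultimately have "(\<integral>x. f x \<partial>M) = 0" by simp
  then show ?thesis using integral_nonneg_eq_0_iff_AE[OF f(1)] f(2) by simp
qed

context weak_solution
begin

text \<open>The measure of the domain and the Dirichlet energy of the solution (without the factor one half).\<close>

definition area :: real where "area = measure lborel \<Omega>"
definition energy :: real where "energy = (LBINT x. (norm (G x))\<^sup>2)"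

lemma area_nonneg: "area \<ge> 0" and energy_nonneg: "energy \<ge> 0"
  by (auto simp: area_def energy_def)

lemma domain_borel [measurable]: "\<Omega> \<in> sets borel"
  using open_domain by simp

lemma indicator_domain: "integrable lborel (\<lambda>x. c * indicator \<Omega> x :: real)"
    "(LBINT x. c * indicator \<Omega> x) = c * area"
  using finite_domain by (auto simp: area_def)

lemma L1_bound:
  fixes V :: "'a \<Rightarrow> real"
  assumes [measurable]: "V \<in> borel_measurable borel" and 0: "\<And>x. x \<notin> \<Omega> \<Longrightarrow> V x = 0"
    and i: "integrable lborel (\<lambda>x. (V x)\<^sup>2)" and t: "t > 0"
  shows "integrable lborel V" "(LBINT x. \<bar>V x\<bar>) \<le> (t * area + (LBINT x. (V x)\<^sup>2) / t) / 2"
proof -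
  have pt: "\<bar>V x\<bar> \<le> (t * indicator \<Omega> x + (V x)\<^sup>2 / t) / 2" if t: "t > 0" for x t
  proof (cases "x \<in> \<Omega>")
    case True
    have "2 * (sqrt t * (\<bar>V x\<bar> / sqrt t)) \<le> (sqrt t)\<^sup>2 + (\<bar>V x\<bar> / sqrt t)\<^sup>2" by (rule two_mult_le_sum_squares)
    then show ?thesis using True t by (simp add: power_divide)
  qed (simp add: 0)
  have w: "integrable lborel (\<lambda>x. (t * indicator \<Omega> x + (V x)\<^sup>2 / t) / 2)" for t
    using indicator_domain i by auto
  show V: "integrable lborel V"
    by (rule Bochner_Integration.integrable_bound[OF w[of 1]]) (use pt[of 1] in \<open>auto intro!: AE_I2 order_trans[OF _ abs_ge_self]\<close>)
  have "(LBINT x. \<bar>V x\<bar>) \<le> (LBINT x. (t * indicator \<Omega> x + (V x)\<^sup>2 / t) / 2)"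
    using V w pt[OF t] by (intro integral_mono) auto
  also have "\<dots> = (t * area + (LBINT x. (V x)\<^sup>2) / t) / 2"
    using indicator_domain[of t] i by simp
  finally show "(LBINT x. \<bar>V x\<bar>) \<le> (t * area + (LBINT x. (V x)\<^sup>2) / t) / 2" .
qed

lemma U_integrable: "integrable lborel U"
  by (rule L1_bound(1)[OF U_borel U_outside U_sq zero_less_one])

lemma U_minus_test_integrable:
  assumes "\<phi> \<in> test_functions \<Omega>" shows "integrable lborel (\<lambda>x. U x - \<phi> x)"
  using U_integrable test_integrable(1)[OF assms] by simp

text \<open>On a domain of finite measure, approximation in the square mean implies approximation in the mean.
  The bound on the gradients is quadratic in \<open>\<delta>\<close> so that \<open>defect_bound\<close> is linear in \<open>\<delta>\<close>.\<close>

lemma approx_L1: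
  assumes \<delta>: "\<delta> > 0"
  obtains \<phi> where "\<phi> \<in> test_functions \<Omega>" "(LBINT x. \<bar>U x - \<phi> x\<bar>) < \<delta>"
    "(LBINT x. (norm (G x - gradient \<phi> x))\<^sup>2) < \<delta>\<^sup>2"
proof -
  define t where "t = \<delta> / (area + 1)"
  have t: "t > 0" "t * area < \<delta>"
    using \<delta> area_nonneg by (auto simp: t_def field_simps intro!: add_nonneg_pos)
  have "min (\<delta>\<^sup>2) (\<delta> * t) > 0" using \<delta> t by simp
  from approx[OF this] obtain \<phi> where \<phi>: "\<phi> \<in> test_functions \<Omega>"
    and a: "(LBINT x. (U x - \<phi> x)\<^sup>2) < \<delta> * t" "(LBINT x. (norm (G x - gradient \<phi> x))\<^sup>2) < \<delta>\<^sup>2"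
    by auto
  note [measurable] = test_measurable[OF \<phi>]
  have sq: "integrable lborel (\<lambda>x. (U x - \<phi> x)\<^sup>2)"
    using square_integrable_diff[of U lborel \<phi>] U_sq test_integrable(3)[OF \<phi>] by simp
  have "(LBINT x. \<bar>U x - \<phi> x\<bar>) \<le> (t * area + (LBINT x. (U x - \<phi> x)\<^sup>2) / t) / 2"
    by (rule L1_bound(2)[OF _ _ sq t(1)]) (auto simp: U_outside test_outside[OF \<phi>])
  also have "\<dots> < \<delta>"
  proof -
    have "(LBINT x. (U x - \<phi> x)\<^sup>2) / t < \<delta>" using a(1) t(1) by (simp add: pos_divide_less_eq)
    then have "t * area + (LBINT x. (U x - \<phi> x)\<^sup>2) / t < 2 * \<delta>" using t(2) by linarith
    then show ?thesis by simp
  qed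
  finally show ?thesis using \<phi> a(2) by (intro that) auto
qed

lemma gradient_diff_integrable:
  assumes \<phi>: "\<phi> \<in> test_functions \<Omega>"
  shows "integrable lborel (\<lambda>x. (norm (G x - gradient \<phi> x))\<^sup>2)"
  using G_sq test_integrable(4)[OF \<phi>] test_measurable[OF \<phi>] by (intro square_integrable_diff) auto

text \<open>An approximation \<open>\<phi>\<close> of the solution satisfies the weak equation up to an error of order \<open>\<delta>\<close>, provided
  that the energy of the function \<open>\<psi>\<close> used for testing is controlled by the energy of \<open>\<phi>\<close>.\<close>

lemma defect_bound:
  assumes \<phi>: "\<phi> \<in> test_functions \<Omega>" and \<psi>: "\<psi> \<in> test_functions \<Omega>" and \<delta>: "0 < \<delta>" "\<delta> \<le> 1"
    and near: "(LBINT x. (norm (G x - gradient \<phi> x))\<^sup>2) < \<delta>\<^sup>2"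
    and C: "C \<ge> 0" "(LBINT x. (norm (gradient \<psi> x))\<^sup>2) \<le> C * (LBINT x. (norm (gradient \<phi> x))\<^sup>2)"
  shows "\<bar>(LBINT x. exp (- U x) * \<psi> x) - (LBINT x. gradient \<phi> x \<bullet> gradient \<psi> x)\<bar>
    \<le> (1 + C * (energy + 1)) * \<delta>"
proof -
  note m[measurable] = test_measurable[OF \<phi>] test_measurable[OF \<psi>]
  note d = gradient_diff_integrable[OF \<phi>]
  note t = test_integrable(4)[OF \<phi>] test_integrable(4)[OF \<psi>]
  let ?A = "\<integral>x. (norm (G x - gradient \<phi> x))\<^sup>2 \<partial>lborel"
  let ?B = "\<integral>x. (norm (gradient \<psi> x))\<^sup>2 \<partial>lborel"
  have i1: "integrable lborel (\<lambda>x. (G x - gradient \<phi> x) \<bullet> gradient \<psi> x)"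
    "integrable lborel (\<lambda>x. gradient \<phi> x \<bullet> gradient \<psi> x)"
    using d t by (auto intro!: square_integrable_inner)
  have "(LBINT x. exp (- U x) * \<psi> x) = (LBINT x. (G x - gradient \<phi> x) \<bullet> gradient \<psi> x + gradient \<phi> x \<bullet> gradient \<psi> x)"
    unfolding equation[OF \<psi>, symmetric] by (intro Bochner_Integration.integral_cong) (auto simp: inner_diff_left)
  also have "\<dots> = (LBINT x. (G x - gradient \<phi> x) \<bullet> gradient \<psi> x) + (LBINT x. gradient \<phi> x \<bullet> gradient \<psi> x)"
    using i1 by simp
  finally have "\<bar>(LBINT x. exp (- U x) * \<psi> x) - (LBINT x. gradient \<phi> x \<bullet> gradient \<psi> x)\<bar> =
      \<bar>LBINT x. (G x - gradient \<phi> x) \<bullet> gradient \<psi> x\<bar>" by simp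
  also have "\<dots> \<le> (?A / \<delta> + \<delta> * ?B) / 2"
    using d t \<delta> by (intro integral_inner_bound) auto
  also have "\<dots> \<le> (1 + C * (energy + 1)) * \<delta>"
  proof -
    have "(LBINT x. (norm (gradient \<phi> x))\<^sup>2) \<le>
        (LBINT x. 2 * (norm (G x - gradient \<phi> x))\<^sup>2 + 2 * (norm (G x))\<^sup>2)"
      using d t G_sq norm_diff_sq_le[of "gradient \<phi> _" 0 "G _"]
      by (intro integral_mono) (auto simp: norm_minus_commute)
    also have "\<dots> = 2 * ?A + 2 * energy" using d G_sq by (simp add: energy_def)
    also have "\<dots> \<le> 2 * (energy + 1)"
      using near \<delta> power_le_one[of \<delta> 2] by simp
    finally have g: "(LBINT x. (norm (gradient \<phi> x))\<^sup>2) \<le> 2 * (energy + 1)" .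
    have "?B \<le> C * (2 * (energy + 1))" using C mult_left_mono[OF g C(1)] by linarith
    then have "\<delta> * ?B \<le> \<delta> * (C * (2 * (energy + 1)))" using \<delta> by (intro mult_left_mono) auto
    moreover have "?A / \<delta> \<le> \<delta>" using near \<delta> by (simp add: pos_divide_le_eq power2_eq_square)
    moreover have "(1 + C * (energy + 1)) * \<delta> = \<delta> + \<delta> * (C * (2 * (energy + 1))) / 2"
      by (simp add: algebra_simps)
    ultimately have "?A / \<delta> + \<delta> * ?B \<le> 2 * ((1 + C * (energy + 1)) * \<delta>)" using \<delta> by linarith
    then show ?thesis by simp
  qed
  finally show ?thesis .
qed

section \<open>Nonnegativity\<close>

text \<open>Formally, testing with the negative part \<open>u\<^sup>-\<close> gives \<open>\<integral> exp (- u) u\<^sup>- = - \<integral> |\<nabla>u\<^sup>-|\<^sup>2 \<le> 0\<close>. Since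
  \<open>exp (- u)\<close> need not be bounded before the sign of \<open>u\<close> is known, the limit is taken with the smaller
  bounded weight \<open>min 1 (exp (- u))\<close>.\<close>

lemma AE_nonneg: "AE x in lborel. U x \<ge> 0"
proof -
  define f where "f x = min 1 (exp (- U x)) * soft_pos 1 (- U x)" for x
  have cs: "continuous_on UNIV (soft_pos 1)" using smooth_continuous smooth_soft_pos by blast
  have [measurable]: "soft_pos 1 \<in> borel_measurable borel" by (rule borel_measurable_continuous_onI[OF cs])
  have "AE x in lborel. f x = 0"
  proof (rule nonneg_AE_zero)
    show int: "integrable lborel f"
    proof (rule Bochner_Integration.integrable_bound[OF U_integrable])
      show "AE x in lborel. norm (f x) \<le> norm (U x)"
      proof (rule AE_I2)
        fix x
        have "f x \<le> 1 * soft_pos 1 (- U x)" unfolding f_def by (intro mult_right_mono) (auto simp: soft_pos_nonneg)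
        then have "f x \<le> \<bar>U x\<bar>" using soft_pos_le[of 1 "- U x"] by simp
        moreover have "f x \<ge> 0" by (auto simp: f_def soft_pos_nonneg)
        ultimately show "norm (f x) \<le> norm (U x)" by simp
      qed
    qed (auto simp: f_def[abs_def])
    show "f x \<ge> 0" for x by (auto simp: f_def soft_pos_nonneg)
    fix \<delta> :: real assume \<delta>: "0 < \<delta>" "\<delta> \<le> 1"
    obtain \<phi> where \<phi>: "\<phi> \<in> test_functions \<Omega>" and a: "(LBINT x. \<bar>U x - \<phi> x\<bar>) < \<delta>"
      "(LBINT x. (norm (G x - gradient \<phi> x))\<^sup>2) < \<delta>\<^sup>2" using approx_L1[OF \<delta>(1)] by blast
    define \<psi> where "\<psi> x = soft_pos 1 (- \<phi> x)" for x
    have sm: "smooth (\<lambda>t. soft_pos 1 (- t))"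
      by (rule smooth_compose[OF smooth_soft_pos smooth_intros(4)[OF smooth_ident]])
    have \<psi>: "\<psi> \<in> test_functions \<Omega>"
      unfolding \<psi>_def[abs_def] by (rule test_compose[OF \<phi> sm]) (simp add: soft_pos_nonpos)
    have g: "gradient \<psi> x = (- soft_pos_deriv 1 (- \<phi> x)) *\<^sub>R gradient \<phi> x" for x
      unfolding \<psi>_def[abs_def]
      by (rule gradient_compose_real[OF test_smooth[OF \<phi>], of "\<lambda>t. soft_pos 1 (- t)"])
         (use DERIV_chain2[OF soft_pos_has_derivative[of 1 "- \<phi> x"] DERIV_minus[OF DERIV_ident]] in simp)
    have gs: "(norm (gradient \<psi> x))\<^sup>2 \<le> (norm (gradient \<phi> x))\<^sup>2" for x
      using soft_pos_deriv_bounds[of 1 "- \<phi> x"] by (intro power_mono) (auto simp: g intro!: mult_left_le_one_le)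
    have "\<bar>(LBINT x. exp (- U x) * \<psi> x) - (LBINT x. gradient \<phi> x \<bullet> gradient \<psi> x)\<bar>
        \<le> (1 + 1 * (energy + 1)) * \<delta>"
      using gs test_integrable[OF \<phi>] test_integrable[OF \<psi>]
      by (intro defect_bound[OF \<phi> \<psi> \<delta> a(2)]) (auto intro!: integral_mono)
    moreover have "(LBINT x. gradient \<phi> x \<bullet> gradient \<psi> x) \<le> 0"
    proof -
      have "0 \<le> (LBINT x. - (gradient \<phi> x \<bullet> gradient \<psi> x))"
        using soft_pos_deriv_bounds(1)[of 1] by (intro integral_nonneg_AE AE_I2) (auto simp: g)
      then show ?thesis by simp
    qed
    ultimately have le: "(LBINT x. exp (- U x) * \<psi> x) \<le> (energy + 2) * \<delta>"
      by (simp add: abs_le_iff algebra_simps)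
    have "(LBINT x. f x) \<le> (LBINT x. exp (- U x) * \<psi> x + \<bar>U x - \<phi> x\<bar>)"
    proof (rule integral_mono[OF int])
      show "integrable lborel (\<lambda>x. exp (- U x) * \<psi> x + \<bar>U x - \<phi> x\<bar>)"
        using source_integrable[OF \<psi>] U_minus_test_integrable[OF \<phi>] by auto
      fix x
      have "soft_pos 1 (- U x) \<le> \<psi> x + \<bar>U x - \<phi> x\<bar>"
        using soft_pos_lipschitz[of 1 "- U x" "- \<phi> x"] by (simp add: \<psi>_def)
      then have "f x \<le> min 1 (exp (- U x)) * (\<psi> x + \<bar>U x - \<phi> x\<bar>)"
        unfolding f_def by (intro mult_left_mono) auto
      also have "\<dots> = min 1 (exp (- U x)) * \<psi> x + min 1 (exp (- U x)) * \<bar>U x - \<phi> x\<bar>"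
        by (simp add: distrib_left)
      also have "\<dots> \<le> exp (- U x) * \<psi> x + 1 * \<bar>U x - \<phi> x\<bar>"
        by (intro add_mono mult_right_mono) (auto simp: \<psi>_def soft_pos_nonneg)
      finally show "f x \<le> exp (- U x) * \<psi> x + \<bar>U x - \<phi> x\<bar>" by simp
    qed
    also have "\<dots> \<le> (energy + 2) * \<delta> + \<delta>"
      using le a(1) source_integrable[OF \<psi>] U_minus_test_integrable[OF \<phi>] by simp
    finally show "(LBINT x. f x) \<le> (energy + 3) * \<delta>" by (simp add: algebra_simps)
  qed
  then show ?thesis
  proof (rule AE_mp, intro AE_I2 impI)
    fix x assume "f x = 0"
    then have "soft_pos 1 (- U x) = 0" by (auto simp: f_def min_def split: if_splits)
    then show "U x \<ge> 0" using soft_pos_pos[of 1 "- U x"] by force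
  qed
qed

text \<open>The solution is the limit of nonnegative test functions. For an approximation \<open>\<phi>\<close>, the difference
  between \<open>\<phi>\<close> and its smoothed positive part is at most \<open>\<epsilon>\<close> where \<open>\<phi> > 0\<close> and nonpositive elsewhere.
  Testing the equation with this difference shows that its energy is small.\<close>

lemma approx_nonneg:
  assumes \<delta>: "\<delta> > 0"
  obtains \<Phi> where "\<Phi> \<in> test_functions \<Omega>" "\<And>x. \<Phi> x \<ge> 0" "(LBINT x. \<bar>U x - \<Phi> x\<bar>) < \<delta>"
    "(LBINT x. (norm (G x - gradient \<Phi> x))\<^sup>2) < \<delta>"
proof -
  define \<epsilon> where "\<epsilon> = \<delta> / (8 * (area + 1))"
  define \<eta> where "\<eta> = min 1 (\<delta> / (8 * (energy + 3)))"
  have \<epsilon>: "\<epsilon> > 0" "\<epsilon> * area \<le> \<delta> / 8"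
    using \<delta> area_nonneg by (auto simp: \<epsilon>_def field_simps intro!: add_nonneg_pos)
  have \<eta>: "\<eta> > 0" "\<eta> \<le> 1" "\<eta> * (energy + 3) \<le> \<delta> / 8"
  proof -
    show "\<eta> > 0" "\<eta> \<le> 1" using \<delta> energy_nonneg by (auto simp: \<eta>_def intro!: divide_pos_pos)
    have "\<eta> * (energy + 3) \<le> \<delta> / (8 * (energy + 3)) * (energy + 3)"
      using energy_nonneg by (intro mult_right_mono) (auto simp: \<eta>_def)
    also have "\<dots> = \<delta> / 8" using energy_nonneg by (simp add: field_simps)
    finally show "\<eta> * (energy + 3) \<le> \<delta> / 8" .
  qed
  have "\<eta> * 3 \<le> \<eta> * (energy + 3)" using \<eta>(1) energy_nonneg by (intro mult_left_mono) auto
  with \<eta>(3) have \<eta>8: "3 * \<eta> \<le> \<delta> / 8" by simp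
  obtain \<phi> where \<phi>: "\<phi> \<in> test_functions \<Omega>" and a: "(LBINT x. \<bar>U x - \<phi> x\<bar>) < \<eta>"
    "(LBINT x. (norm (G x - gradient \<phi> x))\<^sup>2) < \<eta>\<^sup>2" using approx_L1[OF \<eta>(1)] by blast
  define \<Phi> where "\<Phi> x = soft_pos \<epsilon> (\<phi> x)" for x
  define \<psi> where "\<psi> x = \<phi> x - \<Phi> x" for x
  have \<Phi>: "\<Phi> \<in> test_functions \<Omega>"
    unfolding \<Phi>_def[abs_def] using \<epsilon> by (intro test_compose[OF \<phi> smooth_soft_pos]) (simp add: soft_pos_nonpos)
  have \<psi>: "\<psi> \<in> test_functions \<Omega>" unfolding \<psi>_def[abs_def] by (rule test_diff[OF \<phi> \<Phi>])
  have g\<Phi>: "gradient \<Phi> x = soft_pos_deriv \<epsilon> (\<phi> x) *\<^sub>R gradient \<phi> x" for x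
    unfolding \<Phi>_def[abs_def] using \<epsilon> by (intro gradient_compose_real test_smooth[OF \<phi>] soft_pos_has_derivative)
  have g\<psi>: "gradient \<psi> x = (1 - soft_pos_deriv \<epsilon> (\<phi> x)) *\<^sub>R gradient \<phi> x" for x
    unfolding \<psi>_def[abs_def] by (subst gradient_diff[OF test_smooth[OF \<phi>] test_smooth[OF \<Phi>]]) (simp add: g\<Phi> scaleR_diff_left)
  note b = soft_pos_deriv_bounds[OF \<epsilon>(1)]
  note int = test_integrable[OF \<phi>] test_integrable[OF \<psi>] test_integrable[OF \<Phi>]
  note [measurable] = test_measurable[OF \<phi>] test_measurable[OF \<psi>] test_measurable[OF \<Phi>]
  have gs: "(norm (gradient \<psi> x))\<^sup>2 \<le> (norm (gradient \<phi> x))\<^sup>2" for x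
    using b[of "\<phi> x"] by (intro power_mono) (auto simp: g\<psi> intro!: mult_left_le_one_le)
  have gi: "(norm (gradient \<psi> x))\<^sup>2 \<le> gradient \<phi> x \<bullet> gradient \<psi> x" for x
  proof -
    let ?c = "1 - soft_pos_deriv \<epsilon> (\<phi> x)"
    have "?c * ?c \<le> 1 * ?c" using b[of "\<phi> x"] by (intro mult_right_mono) auto
    then have "?c * ?c * (gradient \<phi> x \<bullet> gradient \<phi> x) \<le> ?c * (gradient \<phi> x \<bullet> gradient \<phi> x)"
      by (intro mult_right_mono) auto
    then show ?thesis by (simp add: g\<psi> power_mult_distrib power2_norm_eq_inner power2_eq_square[of ?c])
  qed
  have "\<bar>(LBINT x. exp (- U x) * \<psi> x) - (LBINT x. gradient \<phi> x \<bullet> gradient \<psi> x)\<bar>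
      \<le> (1 + 1 * (energy + 1)) * \<eta>"
    using gs int by (intro defect_bound[OF \<phi> \<psi> \<eta>(1,2) a(2)]) (auto intro!: integral_mono)
  moreover have "(LBINT x. exp (- U x) * \<psi> x) \<le> (LBINT x. \<epsilon> * indicator \<Omega> x)"
  proof (rule integral_mono_AE[OF source_integrable[OF \<psi>] indicator_domain(1)])
    show "AE x in lborel. exp (- U x) * \<psi> x \<le> \<epsilon> * indicator \<Omega> x"
    proof (rule AE_mp[OF AE_nonneg], intro AE_I2 impI)
      fix x assume U: "U x \<ge> 0"
      show "exp (- U x) * \<psi> x \<le> \<epsilon> * indicator \<Omega> x"
      proof (cases "\<phi> x > 0")
        case True
        then have "x \<in> \<Omega>" using test_outside[OF \<phi>, of x] by force
        have "exp (- U x) * \<psi> x \<le> 1 * \<psi> x"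
          using U ident_minus_soft_pos(1)[of \<epsilon> "\<phi> x"] True \<epsilon> by (intro mult_right_mono) (auto simp: \<psi>_def \<Phi>_def)
        also have "\<dots> \<le> \<epsilon>" using ident_minus_soft_pos(2)[of \<epsilon> "\<phi> x"] True \<epsilon> by (simp add: \<psi>_def \<Phi>_def)
        finally show ?thesis using \<open>x \<in> \<Omega>\<close> by simp
      next
        case False
        then have "exp (- U x) * \<psi> x \<le> 0" using \<epsilon> by (simp add: \<psi>_def \<Phi>_def soft_pos_nonpos mult_le_0_iff)
        also have "0 \<le> \<epsilon> * indicator \<Omega> x" using \<epsilon> by simp
        finally show ?thesis .
      qed
    qed
  qed
  moreover have "(LBINT x. (norm (gradient \<psi> x))\<^sup>2) \<le> (LBINT x. gradient \<phi> x \<bullet> gradient \<psi> x)"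
    using int gi by (intro integral_mono square_integrable_inner) auto
  ultimately have e\<psi>: "(LBINT x. (norm (gradient \<psi> x))\<^sup>2) \<le> \<epsilon> * area + (energy + 2) * \<eta>"
    unfolding indicator_domain(2) by (simp add: abs_le_iff algebra_simps)
  have "(LBINT x. (norm (G x - gradient \<Phi> x))\<^sup>2) \<le>
      (LBINT x. 2 * (norm (G x - gradient \<phi> x))\<^sup>2 + 2 * (norm (gradient \<psi> x))\<^sup>2)"
  proof (rule integral_mono[OF gradient_diff_integrable[OF \<Phi>]])
    show "integrable lborel (\<lambda>x. 2 * (norm (G x - gradient \<phi> x))\<^sup>2 + 2 * (norm (gradient \<psi> x))\<^sup>2)"
      using gradient_diff_integrable[OF \<phi>] int by auto
    show "(norm (G x - gradient \<Phi> x))\<^sup>2 \<le> 2 * (norm (G x - gradient \<phi> x))\<^sup>2 + 2 * (norm (gradient \<psi> x))\<^sup>2" for x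
      using norm_diff_sq_le[of "G x" "gradient \<Phi> x" "gradient \<phi> x"]
      by (simp add: g\<psi> g\<Phi> scaleR_diff_left)
  qed
  also have "\<dots> \<le> 2 * \<eta>\<^sup>2 + 2 * (\<epsilon> * area + (energy + 2) * \<eta>)"
    using a(2) e\<psi> gradient_diff_integrable[OF \<phi>] int by simp
  also have "\<dots> \<le> 2 * (\<epsilon> * area) + 2 * (\<eta> * (energy + 3))"
    using \<eta> by (simp add: power2_eq_square algebra_simps)
  also have "\<dots> < \<delta>" using \<epsilon> \<eta> \<delta> by linarith
  finally have G\<Phi>: "(LBINT x. (norm (G x - gradient \<Phi> x))\<^sup>2) < \<delta>" .
  have "(LBINT x. \<bar>U x - \<Phi> x\<bar>) \<le> (LBINT x. 2 * \<bar>U x - \<phi> x\<bar> + \<epsilon> * indicator \<Omega> x)"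
  proof (rule integral_mono_AE)
    show "AE x in lborel. \<bar>U x - \<Phi> x\<bar> \<le> 2 * \<bar>U x - \<phi> x\<bar> + \<epsilon> * indicator \<Omega> x"
    proof (rule AE_mp[OF AE_nonneg], intro AE_I2 impI)
      fix x assume U: "U x \<ge> 0"
      show "\<bar>U x - \<Phi> x\<bar> \<le> 2 * \<bar>U x - \<phi> x\<bar> + \<epsilon> * indicator \<Omega> x"
      proof (cases "\<phi> x > 0")
        case True
        then have "x \<in> \<Omega>" using test_outside[OF \<phi>, of x] by force
        moreover have "\<bar>U x - \<Phi> x\<bar> \<le> 2 * \<bar>U x - \<phi> x\<bar> + \<epsilon>"
          using ident_minus_soft_pos[OF \<epsilon>(1) less_imp_le[OF True]] abs_ge_zero[of "U x - \<phi> x"]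
          unfolding \<Phi>_def by (auto simp: abs_if)
        ultimately show ?thesis by simp
      next
        case False
        then have "\<bar>U x - \<Phi> x\<bar> \<le> 2 * \<bar>U x - \<phi> x\<bar>"
          using U \<epsilon> by (simp add: \<Phi>_def soft_pos_nonpos)
        moreover have "0 \<le> \<epsilon> * indicator \<Omega> x" using \<epsilon> by simp
        ultimately show ?thesis by linarith
      qed
    qed
  qed (use U_minus_test_integrable[OF \<phi>] U_minus_test_integrable[OF \<Phi>] indicator_domain(1) in auto)
  also have "\<dots> = 2 * (LBINT x. \<bar>U x - \<phi> x\<bar>) + \<epsilon> * area"
    using U_minus_test_integrable[OF \<phi>] indicator_domain[of \<epsilon>] by (subst Bochner_Integration.integral_add) auto
  also have "\<dots> < \<delta>" using a(1) \<epsilon> \<eta>8 \<eta> \<delta> by linarith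
  finally show ?thesis
    using \<Phi> G\<Phi> \<epsilon> by (intro that) (auto simp: \<Phi>_def soft_pos_nonneg)
qed

lemma weak_solution_cong_AE:
  assumes [measurable]: "V \<in> borel_measurable borel" and V: "\<And>x. x \<notin> \<Omega> \<Longrightarrow> V x = 0"
    and ae: "AE x in lborel. U x = V x"
  shows "weak_solution \<Omega> V G"
proof
  show "integrable lborel (\<lambda>x. (V x)\<^sup>2)"
    using U_sq by (rule integrable_cong_AE_imp) (use ae in \<open>auto elim: AE_mp\<close>)
next
  fix \<phi> assume \<phi>: "\<phi> \<in> test_functions \<Omega>"
  note [measurable] = test_measurable[OF \<phi>]
  have "(LBINT x. V x *\<^sub>R gradient \<phi> x) = (LBINT x. U x *\<^sub>R gradient \<phi> x)"
    using ae by (intro integral_cong_AE) (auto elim: AE_mp)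
  then show "(LBINT x. V x *\<^sub>R gradient \<phi> x) = - (LBINT x. \<phi> x *\<^sub>R G x)"
    using weak[OF \<phi>] by simp
  show "integrable lborel (\<lambda>x. exp (- V x) * \<phi> x)"
    using source_integrable[OF \<phi>] by (rule integrable_cong_AE_imp) (use ae in \<open>auto elim: AE_mp\<close>)
  have "(LBINT x. exp (- V x) * \<phi> x) = (LBINT x. exp (- U x) * \<phi> x)"
    using ae by (intro integral_cong_AE) (auto elim: AE_mp)
  then show "(LBINT x. G x \<bullet> gradient \<phi> x) = (LBINT x. exp (- V x) * \<phi> x)"
    using equation[OF \<phi>] by simp
next
  fix \<delta> :: real assume "\<delta> > 0"
  from approx[OF this] obtain \<phi> where \<phi>: "\<phi> \<in> test_functions \<Omega>"
    "(LBINT x. (U x - \<phi> x)\<^sup>2) < \<delta>" "(LBINT x. (norm (G x - gradient \<phi> x))\<^sup>2) < \<delta>" by blast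
  note [measurable] = test_measurable[OF \<phi>(1)]
  have "(LBINT x. (V x - \<phi> x)\<^sup>2) = (LBINT x. (U x - \<phi> x)\<^sup>2)"
    using ae by (intro integral_cong_AE) (auto elim: AE_mp)
  with \<phi> show "\<exists>\<phi>\<in>test_functions \<Omega>.
        (LBINT x. (V x - \<phi> x)\<^sup>2) < \<delta> \<and> (LBINT x. (norm (G x - gradient \<phi> x))\<^sup>2) < \<delta>"
    by (intro bexI[of _ \<phi>]) auto
qed (use open_domain finite_domain V G_outside G_sq in auto)

end

locale nonneg_weak_solution = weak_solution +
  assumes U_nonneg: "U x \<ge> 0"

lemma (in weak_solution) nonneg_version:
  obtains V where "nonneg_weak_solution \<Omega> V G" "AE x in lborel. U x = V x"
proof
  have ae: "AE x in lborel. U x = max 0 (U x)"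
    using AE_nonneg by eventually_elim auto
  then interpret V: weak_solution \<Omega> "\<lambda>x. max 0 (U x)" G
    by (rule weak_solution_cong_AE[rotated 2]) (auto simp: U_outside)
  show "nonneg_weak_solution \<Omega> (\<lambda>x. max 0 (U x)) G"
    by unfold_locales auto
  show "AE x in lborel. U x = max 0 (U x)" by (rule ae)
qed

section \<open>Comparison under reflection\<close>

text \<open>For a unit vector \<open>n\<close>, the reflection in the hyperplane through the origin orthogonal to \<open>n\<close>.\<close>

definition reflect :: "'a::euclidean_space \<Rightarrow> 'a \<Rightarrow> 'a" where
  "reflect n x = x - (2 * (x \<bullet> n)) *\<^sub>R n"

lemma bounded_linear_reflect: "bounded_linear (reflect n)"
  unfolding reflect_def[abs_def]
  by (intro bounded_linear_sub bounded_linear_ident bounded_linear_compose[OF bounded_linear_scaleR_left]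
      bounded_linear_const_mult bounded_linear_inner_left)

lemma continuous_reflect: "continuous_on S (reflect n)"
  by (rule linear_continuous_on[OF bounded_linear_reflect])

lemma reflect_borel [measurable]: "reflect n \<in> borel_measurable borel"
  by (rule borel_measurable_continuous_onI[OF continuous_reflect])

lemma reflect_inner: "reflect n x \<bullet> y = x \<bullet> reflect n y"
  by (simp add: reflect_def inner_diff_left inner_diff_right inner_commute)

lemma reflect_on_line: "x \<bullet> n = 0 \<Longrightarrow> reflect n x = x"
  by (simp add: reflect_def)

lemma reflect_inner_normal: "norm n = 1 \<Longrightarrow> reflect n x \<bullet> n = - (x \<bullet> n)"
  by (simp add: reflect_def inner_diff_left power2_norm_eq_inner[symmetric])

lemma reflect_reflect: "norm n = 1 \<Longrightarrow> reflect n (reflect n x) = x"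
  using reflect_inner_normal[of n x] by (simp add: reflect_def[of n "reflect n x"]) (simp add: reflect_def)

lemma norm_reflect: "norm n = 1 \<Longrightarrow> norm (reflect n x) = norm x"
  by (simp add: norm_eq_sqrt_inner reflect_inner reflect_reflect)

lemma smooth_reflect: "smooth f \<Longrightarrow> smooth (\<lambda>x. f (reflect n x))"
  using Ck_compose_affine[OF bounded_linear_reflect, of _ f n 0] by (simp add: smooth_def)

lemma gradient_reflect:
  assumes "smooth f" shows "gradient (\<lambda>x. f (reflect n x)) x = reflect n (gradient f (reflect n x))"
proof (rule gradient_eqI)
  have "((\<lambda>x. f (reflect n x)) has_derivative (\<lambda>v. gradient f (reflect n x) \<bullet> reflect n v)) (at x)"
    by (rule has_derivative_compose[OF bounded_linear_imp_has_derivative[OF bounded_linear_reflect]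
          smooth_has_gradient[OF assms]])
  then show "((\<lambda>x. f (reflect n x)) has_derivative (\<lambda>v. reflect n (gradient f (reflect n x)) \<bullet> v)) (at x)"
    by (simp add: reflect_inner)
qed

lemma integral_reflect:
  fixes f :: "'a::euclidean_space \<Rightarrow> 'b::euclidean_space"
  assumes inv: "distr lborel borel (reflect n) = lborel" and [measurable]: "f \<in> borel_measurable borel"
  shows "(LBINT x. f (reflect n x)) = (LBINT x. f x)"
    and "integrable lborel (\<lambda>x. f (reflect n x)) \<longleftrightarrow> integrable lborel f"
proof -
  have "(LBINT x. f (reflect n x)) = (\<integral>x. f x \<partial>distr lborel borel (reflect n))"
    by (subst integral_distr) auto
  then show "(LBINT x. f (reflect n x)) = (LBINT x. f x)" by (simp only: inv)
  have "integrable lborel (\<lambda>x. f (reflect n x)) \<longleftrightarrow> integrable (distr lborel borel (reflect n)) f"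
    by (subst integrable_distr_eq) auto
  then show "integrable lborel (\<lambda>x. f (reflect n x)) \<longleftrightarrow> integrable lborel f" by (simp only: inv)
qed

text \<open>The assumption \<open>dom\<close> says that the part of the domain in the half-space \<open>x \<bullet> n \<le> 0\<close> is
  mapped into the domain by the reflection. On \<open>x \<bullet> n < 0\<close>, the functions \<open>- F\<close> and \<open>wU\<close> of the proof are
  both positive exactly where \<open>U > U \<circ> reflect n\<close>, so it suffices that the integral of their product
  is not positive.\<close>

lemma (in nonneg_weak_solution) reflection_comparison:
  assumes n: "norm n = 1" and inv: "distr lborel borel (reflect n) = lborel"
    and dom: "\<And>x. x \<bullet> n \<ge> 0 \<Longrightarrow> reflect n x \<in> \<Omega> \<Longrightarrow> x \<in> \<Omega>"
  shows "AE x in lborel. x \<bullet> n < 0 \<longrightarrow> U x \<le> U (reflect n x)"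
proof -
  let ?s = "reflect n"
  note intr = integral_reflect[OF inv]
  define F where "F x = exp (- U x) - exp (- U (?s x))" for x
  define wU where "wU x = (if x \<bullet> n < 0 then soft_pos 1 (U x - U (?s x)) else 0)" for x
  have cs: "continuous_on UNIV (soft_pos 1)" using smooth_continuous smooth_soft_pos by blast
  have [measurable]: "soft_pos 1 \<in> borel_measurable borel" by (rule borel_measurable_continuous_onI[OF cs])
  have [measurable]: "F \<in> borel_measurable borel" unfolding F_def[abs_def] by measurable
  have [measurable]: "wU \<in> borel_measurable borel" unfolding wU_def[abs_def] by measurable
  have F1: "\<bar>F x\<bar> \<le> 1" for x
  proof -
    have "0 < exp (- U x)" "exp (- U x) \<le> 1" "0 < exp (- U (?s x))" "exp (- U (?s x)) \<le> 1"
      using U_nonneg by auto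
    then show ?thesis unfolding F_def by linarith
  qed
  have Us: "integrable lborel (\<lambda>x. U (?s x))" using U_integrable intr(2)[of U] by simp
  have wU_le: "0 \<le> wU x" "wU x \<le> U x + U (?s x)" for x
    using soft_pos_nonneg[of 1] soft_pos_le[of 1 "U x - U (?s x)"] U_nonneg[of x] U_nonneg[of "?s x"]
    by (auto simp: wU_def abs_if split: if_splits)
  have "AE x in lborel. - F x * wU x = 0"
  proof (rule nonneg_AE_zero)
    show int: "integrable lborel (\<lambda>x. - F x * wU x)"
    proof (rule Bochner_Integration.integrable_bound)
      show "integrable lborel (\<lambda>x. U x + U (?s x))" using U_integrable Us by simp
      show "AE x in lborel. norm (- F x * wU x) \<le> norm (U x + U (?s x))"
      proof (rule AE_I2)
        fix x
        have "\<bar>F x\<bar> * wU x \<le> 1 * wU x" using F1[of x] wU_le(1)[of x] by (intro mult_right_mono)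
        then show "norm (- F x * wU x) \<le> norm (U x + U (?s x))"
          using wU_le[of x] by (simp add: abs_mult)
      qed
    qed auto
    show "- F x * wU x \<ge> 0" for x
    proof (cases "x \<bullet> n < 0 \<and> U x > U (?s x)")
      case True
      then have "F x \<le> 0" by (simp add: F_def)
      then show ?thesis using wU_le(1)[of x] by (simp add: mult_nonpos_nonneg)
    qed (auto simp: wU_def soft_pos_nonpos)
    fix \<delta> :: real assume \<delta>: "0 < \<delta>" "\<delta> \<le> 1"
    have \<delta>2: "0 < \<delta>\<^sup>2" "\<delta>\<^sup>2 \<le> \<delta>" using \<delta> by (auto simp: power2_eq_square mult_left_le_one_le)
    obtain \<Phi> where \<Phi>: "\<Phi> \<in> test_functions \<Omega>" and \<Phi>0: "\<And>x. \<Phi> x \<ge> 0"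
      and near: "(LBINT x. \<bar>U x - \<Phi> x\<bar>) < \<delta>\<^sup>2" "(LBINT x. (norm (G x - gradient \<Phi> x))\<^sup>2) < \<delta>\<^sup>2"
      using approx_nonneg[OF \<delta>2(1)] by blast
    obtain K where K: "smooth \<Phi>" "compact K" "K \<subseteq> \<Omega>" "\<And>x. x \<notin> K \<Longrightarrow> \<Phi> x = 0"
      using \<Phi> by (rule test_functionE) auto
    \<comment> \<open>Because \<open>\<Phi> \<ge> 0\<close>, the function \<open>w\<close> vanishes where \<open>\<Phi>\<close> does.\<close>
    define d where "d x = \<Phi> x - \<Phi> (?s x)" for x
    define w where "w x = (if x \<bullet> n < 0 then soft_pos 1 (d x) else 0)" for x
    define W where "W x = w x - w (?s x)" for x
    have d: "smooth d" unfolding d_def[abs_def] by (intro smooth_intros(5) K(1) smooth_reflect)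
    have gd: "gradient d x = gradient \<Phi> x - ?s (gradient \<Phi> (?s x))" for x
      unfolding d_def[abs_def]
      by (subst gradient_diff[OF K(1) smooth_reflect[OF K(1)]]) (simp add: gradient_reflect[OF K(1)])
    have cut: "smooth w"
      "frechet_derivative w (at x) = (\<lambda>v. if x \<bullet> n < 0 then
          frechet_derivative (soft_pos 1) (at (d x)) 1 * frechet_derivative d (at x) v else 0)" for x
      unfolding w_def[abs_def]
      by (rule smooth_cut_halfspace[OF smooth_soft_pos _ d], simp add: soft_pos_nonpos, simp add: d_def reflect_on_line)+
    have gw: "gradient w x = (if x \<bullet> n < 0 then soft_pos_deriv 1 (d x) *\<^sub>R gradient d x else 0)" for x
      by (simp add: gradient_def cut(2) soft_pos_deriv_frechet scaleR_sum_right)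
    have wK: "x \<in> K" if "w x \<noteq> 0" for x
    proof -
      have "d x > 0" using that soft_pos_nonpos[of 1 "d x"] by (auto simp: w_def split: if_splits intro: ccontr)
      then have "\<Phi> x > 0" using \<Phi>0[of "?s x"] by (simp add: d_def)
      then show ?thesis using K(4)[of x] by force
    qed
    have w: "w \<in> test_functions \<Omega>"
      by (rule test_functionI[OF cut(1) K(2,3)]) (use wK in blast)
    have ws: "(\<lambda>x. w (?s x)) \<in> test_functions \<Omega>"
    proof (rule test_functionI[OF smooth_reflect[OF cut(1)]])
      show "compact (?s ` K \<inter> {x. x \<bullet> n \<ge> 0})"
        by (intro compact_Int_closed compact_continuous_image continuous_reflect K closed_Collect_le continuous_intros)
      show "?s ` K \<inter> {x. x \<bullet> n \<ge> 0} \<subseteq> \<Omega>"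
        using K(3) dom by (auto simp: reflect_reflect[OF n])
      fix x assume x: "x \<notin> ?s ` K \<inter> {x. x \<bullet> n \<ge> 0}"
      show "w (?s x) = 0"
      proof (rule ccontr)
        assume "w (?s x) \<noteq> 0"
        then have "?s x \<in> K" "?s x \<bullet> n < 0" using wK by (auto simp: w_def split: if_splits)
        then show False
          using x by (auto simp: reflect_inner_normal[OF n] image_iff) (metis reflect_reflect[OF n])
      qed
    qed
    have W: "W \<in> test_functions \<Omega>" unfolding W_def[abs_def] by (rule test_diff[OF w ws])
    have gW: "gradient W x = gradient w x - ?s (gradient w (?s x))" for x
      unfolding W_def[abs_def]
      by (subst gradient_diff[OF cut(1) smooth_reflect[OF cut(1)]]) (simp add: gradient_reflect[OF cut(1)])
    note [measurable] = test_measurable[OF \<Phi>] test_measurable[OF w] test_measurable[OF W]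
    note int\<Phi> = test_integrable[OF \<Phi>] note intw = test_integrable[OF w] note intW = test_integrable[OF W]
    have sq: "integrable lborel (\<lambda>x. (norm (f (?s x)))\<^sup>2)" "(LBINT x. (norm (f (?s x)))\<^sup>2) = (LBINT x. (norm (f x))\<^sup>2)"
      if "f \<in> borel_measurable borel" "integrable lborel (\<lambda>x. (norm (f x))\<^sup>2)" for f :: "'a \<Rightarrow> 'a"
      using intr[of "\<lambda>x. (norm (f x))\<^sup>2"] that by auto
    have "integrable lborel (\<lambda>x. gradient \<Phi> x \<bullet> gradient w x)"
      "integrable lborel (\<lambda>x. ?s (gradient \<Phi> (?s x)) \<bullet> gradient w x)"
      using int\<Phi> intw sq(1)[OF _ int\<Phi>(4)] by (auto intro!: square_integrable_inner simp: norm_reflect[OF n])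
    note pi = this
    \<comment> \<open>By symmetry, the pairing of \<open>\<Phi>\<close> with \<open>W\<close> is the pairing of \<open>d\<close> with \<open>w\<close>, which is nonnegative.\<close>
    have "(LBINT x. gradient \<Phi> x \<bullet> ?s (gradient w (?s x))) = (LBINT x. ?s (gradient \<Phi> (?s x)) \<bullet> gradient w x)"
      using intr(1)[of "\<lambda>x. ?s (gradient \<Phi> (?s x)) \<bullet> gradient w x"]
      by (simp add: reflect_reflect[OF n] reflect_inner)
    moreover have "integrable lborel (\<lambda>x. gradient \<Phi> x \<bullet> ?s (gradient w (?s x)))"
      using intr(2)[of "\<lambda>x. ?s (gradient \<Phi> (?s x)) \<bullet> gradient w x"] pi
      by (simp add: reflect_reflect[OF n] reflect_inner)
    ultimately have "(LBINT x. gradient \<Phi> x \<bullet> gradient W x) = (LBINT x. gradient d x \<bullet> gradient w x)"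
      using pi by (simp add: gW gd inner_diff_right inner_diff_left)
    also have "\<dots> \<ge> 0"
      using soft_pos_deriv_bounds(1)[of 1] by (intro integral_nonneg_AE AE_I2) (auto simp: gw)
    finally have pos: "(LBINT x. gradient \<Phi> x \<bullet> gradient W x) \<ge> 0" .
    have "(LBINT x. (norm (gradient W x))\<^sup>2) \<le>
        (LBINT x. 2 * (norm (gradient w x))\<^sup>2 + 2 * (norm (gradient w (?s x)))\<^sup>2)"
      using intw intW sq(1)[OF _ intw(4)] norm_diff_sq_le[of "gradient w _" "?s (gradient w (?s _))" 0]
      by (intro integral_mono) (auto simp: gW norm_reflect[OF n])
    also have "\<dots> = 4 * (LBINT x. (norm (gradient w x))\<^sup>2)"
      using intw sq[OF _ intw(4)] by simp
    also have "(LBINT x. (norm (gradient w x))\<^sup>2) \<le>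
        (LBINT x. 2 * (norm (gradient \<Phi> x))\<^sup>2 + 2 * (norm (gradient \<Phi> (?s x)))\<^sup>2)"
    proof (intro integral_mono)
      fix x
      have "norm (gradient w x) \<le> norm (gradient d x)"
        using soft_pos_deriv_bounds[of 1 "d x"] by (auto simp: gw intro!: mult_left_le_one_le)
      then have "(norm (gradient w x))\<^sup>2 \<le> (norm (gradient d x))\<^sup>2" by (intro power_mono) auto
      also have "\<dots> \<le> 2 * (norm (gradient \<Phi> x))\<^sup>2 + 2 * (norm (gradient \<Phi> (?s x)))\<^sup>2"
        using norm_diff_sq_le[of "gradient \<Phi> x" "?s (gradient \<Phi> (?s x))" 0]
        by (simp add: gd norm_reflect[OF n])
      finally show "(norm (gradient w x))\<^sup>2 \<le> 2 * (norm (gradient \<Phi> x))\<^sup>2 + 2 * (norm (gradient \<Phi> (?s x)))\<^sup>2" .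
    qed (use intw int\<Phi> sq[OF _ int\<Phi>(4)] in auto)
    also have "\<dots> = 4 * (LBINT x. (norm (gradient \<Phi> x))\<^sup>2)"
      using int\<Phi> sq[OF _ int\<Phi>(4)] by simp
    finally have C: "(LBINT x. (norm (gradient W x))\<^sup>2) \<le> 16 * (LBINT x. (norm (gradient \<Phi> x))\<^sup>2)"
      by simp
    have "\<bar>(LBINT x. exp (- U x) * W x) - (LBINT x. gradient \<Phi> x \<bullet> gradient W x)\<bar>
        \<le> (1 + 16 * (energy + 1)) * \<delta>"
      by (rule defect_bound[OF \<Phi> W \<delta> near(2) _ C]) simp
    with pos have low: "- (LBINT x. exp (- U x) * W x) \<le> (1 + 16 * (energy + 1)) * \<delta>" by linarith
    have e1: "integrable lborel (\<lambda>x. exp (- U x) * w x)" "integrable lborel (\<lambda>x. exp (- U x) * w (?s x))"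
      using source_integrable[OF w] source_integrable[OF ws] by auto
    have e2: "integrable lborel (\<lambda>x. exp (- U (?s x)) * w x)"
      using intr(2)[of "\<lambda>x. exp (- U (?s x)) * w x"] e1(2) by (simp add: reflect_reflect[OF n])
    have "(LBINT x. exp (- U x) * w (?s x)) = (LBINT x. exp (- U (?s x)) * w x)"
      using intr(1)[of "\<lambda>x. exp (- U (?s x)) * w x"] by (simp add: reflect_reflect[OF n])
    then have "(LBINT x. exp (- U x) * W x) = (LBINT x. F x * w x)"
      using e1 e2 by (simp add: W_def F_def right_diff_distrib left_diff_distrib)
    with low have low': "(LBINT x. - F x * w x) \<le> (1 + 16 * (energy + 1)) * \<delta>" by simp
    have iFw: "integrable lborel (\<lambda>x. - F x * w x)"
      using e1 e2 by (simp add: F_def left_diff_distrib)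
    note iD = U_minus_test_integrable[OF \<Phi>]
    have iDs: "integrable lborel (\<lambda>x. \<bar>U (?s x) - \<Phi> (?s x)\<bar>)"
      "(LBINT x. \<bar>U (?s x) - \<Phi> (?s x)\<bar>) = (LBINT x. \<bar>U x - \<Phi> x\<bar>)"
      using intr[of "\<lambda>x. \<bar>U x - \<Phi> x\<bar>"] iD by auto
    have "(LBINT x. - F x * wU x) \<le> (LBINT x. - F x * w x + (\<bar>U x - \<Phi> x\<bar> + \<bar>U (?s x) - \<Phi> (?s x)\<bar>))"
    proof (rule integral_mono[OF int])
      show "integrable lborel (\<lambda>x. - F x * w x + (\<bar>U x - \<Phi> x\<bar> + \<bar>U (?s x) - \<Phi> (?s x)\<bar>))"
        using iFw iD iDs(1) by auto
      fix x
      have "\<bar>wU x - w x\<bar> \<le> \<bar>U x - U (?s x) - d x\<bar>"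
        using soft_pos_lipschitz[of 1 "U x - U (?s x)" "d x"] by (auto simp: wU_def w_def)
      then have "\<bar>wU x - w x\<bar> \<le> \<bar>U x - \<Phi> x\<bar> + \<bar>U (?s x) - \<Phi> (?s x)\<bar>" unfolding d_def by linarith
      moreover have "- F x * (wU x - w x) \<le> 1 * \<bar>wU x - w x\<bar>"
      proof -
        have "- F x * (wU x - w x) \<le> \<bar>- F x * (wU x - w x)\<bar>" by (rule abs_ge_self)
        also have "\<dots> = \<bar>F x\<bar> * \<bar>wU x - w x\<bar>" by (simp add: abs_mult)
        also have "\<dots> \<le> 1 * \<bar>wU x - w x\<bar>" using F1 by (intro mult_right_mono) auto
        finally show ?thesis .
      qed
      ultimately show "- F x * wU x \<le> - F x * w x + (\<bar>U x - \<Phi> x\<bar> + \<bar>U (?s x) - \<Phi> (?s x)\<bar>)"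
        by (simp add: right_diff_distrib)
    qed
    also have "\<dots> = (LBINT x. - F x * w x) + 2 * (LBINT x. \<bar>U x - \<Phi> x\<bar>)"
      using iFw iD iDs by simp
    also have "\<dots> \<le> (19 + 16 * energy) * \<delta>"
      using low' near(1) \<delta>2 by (simp add: algebra_simps)
    finally show "(LBINT x. - F x * wU x) \<le> (19 + 16 * energy) * \<delta>" .
  qed
  then show ?thesis
  proof (rule AE_mp, intro AE_I2 impI)
    fix x assume "- F x * wU x = 0" "x \<bullet> n < 0"
    then consider "exp (- U x) = exp (- U (?s x))" | "soft_pos 1 (U x - U (?s x)) = 0"
      by (auto simp: F_def wU_def)
    then show "U x \<le> U (?s x)"
    proof cases
      case 2 then show ?thesis using soft_pos_pos[of 1 "U x - U (?s x)"] by force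
    qed simp
  qed
qed

section \<open>Integrals on products and convolutions\<close>

lemma integrable_product_functions:
  fixes f :: "'a::euclidean_space \<Rightarrow> real" and g :: "'b::euclidean_space \<Rightarrow> real"
  assumes f: "integrable lborel f" and g: "integrable lborel g"
  shows "integrable lborel (\<lambda>z. f (fst z) * g (snd z))"
proof -
  have [measurable]: "f \<in> borel_measurable borel" "g \<in> borel_measurable borel"
    using borel_measurable_integrable[OF f] borel_measurable_integrable[OF g] by auto
  have "integrable (lborel \<Otimes>\<^sub>M lborel) (\<lambda>z. f (fst z) * g (snd z))"
  proof (rule lborel_pair.Fubini_integrable)
    show "integrable lborel (\<lambda>x. LBINT y. norm (f (fst (x, y)) * g (snd (x, y))))"
      using f by (simp add: abs_mult)
    show "AE x in lborel. integrable lborel (\<lambda>y. f (fst (x, y)) * g (snd (x, y)))"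
      using g by simp
  qed measurable
  then show ?thesis by (simp add: lborel_prod)
qed

lemma integral_scale:
  fixes f :: "'a::euclidean_space \<Rightarrow> real"
  assumes c: "c \<noteq> 0" and [measurable]: "f \<in> borel_measurable borel"
  shows "(LBINT x. f x) = \<bar>c\<bar> ^ DIM('a) * (LBINT x. f (c *\<^sub>R x))"
proof -
  have "(LBINT x. f x) = (\<integral>x. f x \<partial>density (distr lborel borel (\<lambda>x::'a. 0 + c *\<^sub>R x)) (\<lambda>_. \<bar>c\<bar> ^ DIM('a)))"
    using lborel_affine[OF c, of "0::'a"] by simp
  also have "\<dots> = (\<integral>x. \<bar>c\<bar> ^ DIM('a) *\<^sub>R f x \<partial>distr lborel borel (\<lambda>x::'a. 0 + c *\<^sub>R x))"
    by (subst integral_density) auto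
  also have "\<dots> = (LBINT x. \<bar>c\<bar> ^ DIM('a) *\<^sub>R f (0 + c *\<^sub>R x))"
    by (subst integral_distr) auto
  finally show ?thesis by simp
qed

lemma integrable_powr_half:
  "integrable lborel (\<lambda>t::real. indicator {-c<..<c} t * \<bar>t\<bar> powr (-1/2))"
proof (cases "c > 0")
  case True
  have "set_integrable lborel (einterval 0 c) (\<lambda>t. t powr (-1/2))"
  proof (rule interval_integral_FTC_nonneg(1))
    show "(0::ereal) < ereal c" using True by simp
    fix t :: real assume "0 < ereal t"
    then have t: "t > 0" by simp
    show "DERIV (\<lambda>t. 2 * sqrt t) t :> t powr (-1/2)"
      using t by (auto intro!: derivative_eq_intros simp: powr_minus powr_half_sqrt field_simps)
    show "isCont (\<lambda>t. t powr (-1/2)) t"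
      using t by (auto intro!: continuous_intros)
  next
    have "((\<lambda>t. 2 * sqrt t) \<longlongrightarrow> 2 * sqrt 0) (at_right 0)" "((\<lambda>t. 2 * sqrt t) \<longlongrightarrow> 2 * sqrt c) (at_left c)"
      by (auto intro!: tendsto_eq_intros)
    then show "(((\<lambda>t. 2 * sqrt t) \<circ> real_of_ereal) \<longlongrightarrow> 2 * sqrt 0) (at_right 0)"
      "(((\<lambda>t. 2 * sqrt t) \<circ> real_of_ereal) \<longlongrightarrow> 2 * sqrt c) (at_left (ereal c))"
      by (simp_all add: zero_ereal_def ereal_tendsto_simps)
  qed auto
  then have p: "integrable lborel (\<lambda>t::real. indicator {0<..<c} t * t powr (-1/2))"
    by (simp add: set_integrable_def zero_ereal_def)
  then have q: "integrable lborel (\<lambda>t::real. indicator {0<..<c} (0 + (-1) * t) * (0 + (-1) * t) powr (-1/2))"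
    by (rule lborel_integrable_real_affine) simp
  have "integrable lborel (\<lambda>t::real. indicator {0<..<c} t * t powr (-1/2) +
      indicator {0<..<c} (0 + (-1) * t) * (0 + (-1) * t) powr (-1/2))"
    using p q by (rule Bochner_Integration.integrable_add)
  moreover have "(\<lambda>t::real. indicator {0<..<c} t * t powr (-1/2) +
      indicator {0<..<c} (0 + (-1) * t) * (0 + (-1) * t) powr (-1/2)) =
      (\<lambda>t. indicator {-c<..<c} t * \<bar>t\<bar> powr (-1/2))"
  proof
    fix t :: real
    show "indicator {0<..<c} t * t powr (-1/2) +
      indicator {0<..<c} (0 + (-1) * t) * (0 + (-1) * t) powr (-1/2) = indicator {-c<..<c} t * \<bar>t\<bar> powr (-1/2)"
      using True by (cases t "0::real" rule: linorder_cases) (auto simp: indicator_def)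
  qed
  ultimately show ?thesis by simp
next
  case False
  then have "{-c<..<c} = {}" by auto
  then show ?thesis by simp
qed

lemma integrable_inverse_one_plus_square: "integrable lborel (\<lambda>t::real. 1 / (1 + t\<^sup>2))"
proof -
  have "set_integrable lborel (einterval (-\<infinity>) \<infinity>) (\<lambda>t. 1 / (1 + t\<^sup>2))"
  proof (rule interval_integral_FTC_nonneg(1))
    fix t :: real
    have nz: "1 + t\<^sup>2 \<noteq> 0" by (metis add_nonneg_eq_0_iff zero_le_one zero_le_power2 zero_neq_one)
    show "DERIV arctan t :> 1 / (1 + t\<^sup>2)"
      by (auto intro!: derivative_eq_intros simp: field_simps)
    show "isCont (\<lambda>t. 1 / (1 + t\<^sup>2)) t" using nz by (auto intro!: continuous_intros)
  next
    show "((arctan \<circ> real_of_ereal) \<longlongrightarrow> - (pi / 2)) (at_right (- \<infinity>))"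
      using tendsto_arctan_at_bot by (simp add: ereal_tendsto_simps)
    show "((arctan \<circ> real_of_ereal) \<longlongrightarrow> pi / 2) (at_left \<infinity>)"
      using tendsto_arctan_at_top by (simp add: ereal_tendsto_simps)
  qed auto
  then show ?thesis by (simp add: set_integrable_def)
qed

lemma norm_sq_add_pos: "\<epsilon> > 0 \<Longrightarrow> (norm v)\<^sup>2 + \<epsilon> > 0"
  by (intro add_nonneg_pos) auto

lemma norm_sq_add_nonzero: "\<epsilon> > 0 \<Longrightarrow> (norm v)\<^sup>2 + \<epsilon> \<noteq> 0"
  using norm_sq_add_pos[of \<epsilon> v] by linarith

text \<open>The Laplacian of \<open>ln (|v|\<^sup>2 + 1)\<close> in the plane. Up to a constant factor, its rescalings form an
  approximate identity; the value of its integral is not needed.\<close>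

definition profile :: "real \<times> real \<Rightarrow> real" where
  "profile v = 4 / ((norm v)\<^sup>2 + 1)\<^sup>2"

lemma profile_pos: "profile v > 0"
  unfolding profile_def by (intro divide_pos_pos zero_less_power norm_sq_add_pos) auto

lemma continuous_profile: "continuous_on S profile"
  unfolding profile_def[abs_def]
  by (intro continuous_intros ballI) (metis norm_sq_add_nonzero zero_less_one power_not_zero)

lemma profile_borel [measurable]: "profile \<in> borel_measurable borel"
  by (rule borel_measurable_continuous_onI[OF continuous_profile])

lemma profile_integrable: "integrable lborel profile"
proof (rule Bochner_Integration.integrable_bound)
  show "integrable lborel (\<lambda>v::real\<times>real. 4 * (1 / (1 + (fst v)\<^sup>2) * (1 / (1 + (snd v)\<^sup>2))))"
    by (intro integrable_mult_right integrable_product_functions integrable_inverse_one_plus_square)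
  show "AE v in lborel. norm (profile v) \<le> norm (4 * (1 / (1 + (fst v)\<^sup>2) * (1 / (1 + (snd v)\<^sup>2))))"
  proof (rule AE_I2)
    fix v :: "real \<times> real"
    have n: "(norm v)\<^sup>2 = (fst v)\<^sup>2 + (snd v)\<^sup>2" by (cases v) (simp add: norm_Pair)
    have "(1 + a) * (1 + b) \<le> (a + b + 1)\<^sup>2" if "a \<ge> 0" "b \<ge> 0" for a b :: real
      using that by (simp add: power2_eq_square algebra_simps)
    from this[of "(fst v)\<^sup>2" "(snd v)\<^sup>2"]
    moreover have "0 < 1 + (fst v)\<^sup>2" "0 < 1 + (snd v)\<^sup>2" by (intro add_pos_nonneg, auto)+
    ultimately have "profile v \<le> 4 / ((1 + (fst v)\<^sup>2) * (1 + (snd v)\<^sup>2))"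
      unfolding profile_def n by (intro frac_le mult_pos_pos) auto
    then show "norm (profile v) \<le> norm (4 * (1 / (1 + (fst v)\<^sup>2) * (1 / (1 + (snd v)\<^sup>2))))"
      using profile_pos[of v] by simp
  qed
qed measurable

lemma integral_profile_pos: "(LBINT v. profile v) > 0"
proof -
  have "(LBINT v. profile v) \<noteq> 0"
  proof
    assume "(LBINT v. profile v) = 0"
    then have "AE v in lborel. profile v = 0"
      using integral_nonneg_eq_0_iff_AE[OF profile_integrable] profile_pos less_imp_le by blast
    then have "AE v in (lborel :: (real \<times> real) measure). False"
      by (rule AE_mp) (use profile_pos less_irrefl in \<open>auto simp: less_imp_neq[THEN not_sym]\<close>)
    then show False by (simp add: eventually_False trivial_limit_def[symmetric] ae_filter_eq_bot_iff)
  qed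
  moreover have "(LBINT v. profile v) \<ge> 0"
    using profile_pos less_imp_le by (intro integral_nonneg_AE AE_I2) blast
  ultimately show ?thesis by simp
qed

lemma continuous_convolution:
  fixes k U :: "'a::euclidean_space \<Rightarrow> real"
  assumes k: "continuous_on UNIV k" "\<And>x. \<bar>k x\<bar> \<le> B" and U: "integrable lborel U"
  shows "continuous_on S (\<lambda>x. LBINT y. k (y - x) * U y)"
proof (rule continuous_on_subset[OF _ subset_UNIV], unfold continuous_on_sequentially, intro allI ballI impI)
  fix X :: "nat \<Rightarrow> 'a" and x assume "(\<forall>n. X n \<in> UNIV) \<and> X \<longlonglongrightarrow> x"
  then have X: "X \<longlonglongrightarrow> x" by simp
  have [measurable]: "k \<in> borel_measurable borel" by (rule borel_measurable_continuous_onI[OF k(1)])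
  have [measurable]: "U \<in> borel_measurable borel" using borel_measurable_integrable[OF U] by simp
  have "(\<lambda>n. LBINT y. k (y - X n) * U y) \<longlonglongrightarrow> (LBINT y. k (y - x) * U y)"
  proof (rule integral_dominated_convergence[where w = "\<lambda>y. B * \<bar>U y\<bar>"])
    show "integrable lborel (\<lambda>y. B * \<bar>U y\<bar>)" using U by simp
    show "AE y in lborel. norm (k (y - X n) * U y) \<le> B * \<bar>U y\<bar>" for n
      using k(2) by (auto simp: abs_mult intro!: mult_right_mono)
    have "(\<lambda>n. k (y - X n)) \<longlonglongrightarrow> k (y - x)" for y
      using k(1) X by (intro isCont_tendsto_compose[of _ k] tendsto_intros) (auto simp: continuous_on_eq_continuous_at)
    then show "AE y in lborel. (\<lambda>n. k (y - X n) * U y) \<longlonglongrightarrow> k (y - x) * U y"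
      by (auto intro!: tendsto_intros)
  qed measurable
  then show "((\<lambda>x. LBINT y. k (y - x) * U y) \<circ> X) \<longlonglongrightarrow> (LBINT y. k (y - x) * U y)"
    by (simp add: o_def)
qed

section \<open>The regularised logarithmic kernel\<close>

text \<open>The sum of the iterated partial derivatives \<open>\<partial>\<^sub>b \<partial>\<^sub>b f\<close>.\<close>

definition laplacian :: "('a::euclidean_space \<Rightarrow> real) \<Rightarrow> 'a \<Rightarrow> real" where
  "laplacian f x = (\<Sum>b\<in>Basis. gradient (\<lambda>y. gradient f y \<bullet> b) x \<bullet> b)"

lemma smooth_gradient_inner: "smooth f \<Longrightarrow> b \<in> Basis \<Longrightarrow> smooth (\<lambda>y. gradient f y \<bullet> b)"
  by (simp add: gradient_inner_Basis smooth_partial)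

lemma continuous_laplacian: "smooth f \<Longrightarrow> continuous_on S (laplacian f)"
  unfolding laplacian_def[abs_def]
  by (intro continuous_intros continuous_gradient smooth_gradient_inner)

lemma laplacian_mult:
  assumes f: "smooth f" and g: "smooth g"
  shows "laplacian (\<lambda>x. f x * g x) x = f x * laplacian g x + 2 * (gradient f x \<bullet> gradient g x) + g x * laplacian f x"
proof -
  have "gradient (\<lambda>y. gradient (\<lambda>x. f x * g x) y \<bullet> b) x \<bullet> b =
      f x * (gradient (\<lambda>y. gradient g y \<bullet> b) x \<bullet> b) + 2 * ((gradient f x \<bullet> b) * (gradient g x \<bullet> b)) +
      g x * (gradient (\<lambda>y. gradient f y \<bullet> b) x \<bullet> b)" if b: "b \<in> Basis" for b
  proof -
    have e: "(\<lambda>y. gradient (\<lambda>x. f x * g x) y \<bullet> b) = (\<lambda>y. f y * (gradient g y \<bullet> b) + g y * (gradient f y \<bullet> b))"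
      by (simp add: gradient_mult[OF f g] inner_add_left)
    note s = smooth_gradient_inner[OF f b] smooth_gradient_inner[OF g b]
    show ?thesis
      unfolding e
      by (simp add: gradient_add[OF smooth_intros(3)[OF f s(2)] smooth_intros(3)[OF g s(1)]]
          gradient_mult[OF f s(2)] gradient_mult[OF g s(1)] inner_add_left)
  qed
  moreover have "gradient f x \<bullet> gradient g x = (\<Sum>b\<in>Basis. (gradient f x \<bullet> b) * (gradient g x \<bullet> b))"
    by (rule euclidean_inner)
  ultimately show ?thesis
    by (simp add: laplacian_def sum.distrib sum_distrib_left)
qed

lemma laplacian_translate:
  assumes f: "smooth f"
  shows "laplacian (\<lambda>y. f (y - x)) y = laplacian f (y - x)"
proof -
  have tr: "gradient (\<lambda>y. h (y - x)) y = gradient h (y - x)" if h: "smooth h" for h :: "'a \<Rightarrow> real" and y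
    by (rule gradient_eqI, rule has_derivative_compose[where f = "\<lambda>y. y - x" and g = h and f' = "\<lambda>v. v"])
       (auto intro!: derivative_eq_intros smooth_has_gradient[OF h])
  show ?thesis
    unfolding laplacian_def by (simp add: tr[OF f] tr[OF smooth_gradient_inner[OF f]])
qed

lemma smooth_translate: "smooth f \<Longrightarrow> smooth (\<lambda>y. f (y - x))"
  using Ck_compose_affine[OF bounded_linear_ident, of _ f "- x"] by (simp add: smooth_def)

lemma smooth_inverse: "smooth f \<Longrightarrow> (\<And>x. f x \<noteq> 0) \<Longrightarrow> smooth (\<lambda>x. inverse (f x))"
  unfolding smooth_def using Ck_inverse by blast

lemma smooth_ln: "smooth f \<Longrightarrow> (\<And>x. f x > 0) \<Longrightarrow> smooth (\<lambda>x. ln (f x))"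
  unfolding smooth_def using Ck_ln by blast

text \<open>For \<open>\<epsilon> > 0\<close> this is a smooth regularisation of a multiple of the fundamental solution of the Laplacian. For
  \<open>\<epsilon> = 0\<close> it is the singular kernel itself, with the irrelevant value \<open>0\<close> at the origin.\<close>

definition log_kernel :: "real \<Rightarrow> real \<times> real \<Rightarrow> real" where
  "log_kernel \<epsilon> z = ln ((norm z)\<^sup>2 + \<epsilon>)"

lemma smooth_log_kernel: "\<epsilon> > 0 \<Longrightarrow> smooth (log_kernel \<epsilon>)"
  unfolding log_kernel_def[abs_def]
  by (intro smooth_ln smooth_intros(2) smooth_norm_sq smooth_intros(1) add_nonneg_pos) auto

lemma gradient_log_kernel:
  assumes "\<epsilon> > 0" shows "gradient (log_kernel \<epsilon>) z = (2 / ((norm z)\<^sup>2 + \<epsilon>)) *\<^sub>R z"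
proof (rule gradient_eqI)
  have p: "(norm z)\<^sup>2 + \<epsilon> > 0" using assms by (intro add_nonneg_pos) auto
  have n: "((\<lambda>z. (norm z)\<^sup>2 + \<epsilon>) has_derivative (\<lambda>v. 2 * (z \<bullet> v))) (at z)"
    unfolding power2_norm_eq_inner by (auto intro!: derivative_eq_intros simp: inner_commute)
  show "(log_kernel \<epsilon> has_derivative (\<lambda>v. (2 / ((norm z)\<^sup>2 + \<epsilon>)) *\<^sub>R z \<bullet> v)) (at z)"
    unfolding log_kernel_def[abs_def]
    by (rule has_derivative_eq_rhs[OF has_derivative_ln[OF p n]]) (auto simp: field_simps)
qed

lemma laplacian_log_kernel:
  assumes e: "\<epsilon> > 0" shows "laplacian (log_kernel \<epsilon>) z = 4 * \<epsilon> / ((norm z)\<^sup>2 + \<epsilon>)\<^sup>2"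
proof -
  define s where "s z = (norm z)\<^sup>2 + \<epsilon>" for z :: "real \<times> real"
  have p: "s z > 0" for z using e by (auto simp: s_def intro!: add_nonneg_pos)
  have sm: "smooth s" unfolding s_def[abs_def] by (intro smooth_intros(1,2) smooth_norm_sq)
  have gs: "gradient s z = 2 *\<^sub>R z" for z
    by (rule gradient_eqI) (unfold s_def[abs_def] power2_norm_eq_inner, auto intro!: derivative_eq_intros simp: inner_commute)
  have gb: "gradient (\<lambda>y. gradient (log_kernel \<epsilon>) y \<bullet> b) z \<bullet> b = 2 / s z - 4 * (z \<bullet> b)\<^sup>2 / (s z)\<^sup>2"
    if b: "b \<in> Basis" for b
  proof -
    have g: "gradient (\<lambda>y. gradient (log_kernel \<epsilon>) y \<bullet> b) z = (2 / s z) *\<^sub>R b - (4 * (z \<bullet> b) / (s z)\<^sup>2) *\<^sub>R z"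
    proof (rule gradient_eqI)
      have sd: "(s has_derivative (\<lambda>v. 2 * (z \<bullet> v))) (at z)"
        using smooth_has_gradient[OF sm, of z] by (simp add: gs)
      have "((\<lambda>y. 2 * (y \<bullet> b) / s y) has_derivative (\<lambda>v. ((2 / s z) *\<^sub>R b - (4 * (z \<bullet> b) / (s z)\<^sup>2) *\<^sub>R z) \<bullet> v)) (at z)"
      proof (rule has_derivative_eq_rhs)
        show "((\<lambda>y. 2 * (y \<bullet> b) / s y) has_derivative
            (\<lambda>h. - (2 * (z \<bullet> b)) * (inverse (s z) * (2 * (z \<bullet> h)) * inverse (s z)) + 2 * (h \<bullet> b) / s z)) (at z)"
          by (rule has_derivative_divide[OF _ sd]) (use p[of z] in \<open>auto intro!: derivative_eq_intros\<close>)
        show "(\<lambda>h. - (2 * (z \<bullet> b)) * (inverse (s z) * (2 * (z \<bullet> h)) * inverse (s z)) + 2 * (h \<bullet> b) / s z) =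
            (\<lambda>v. ((2 / s z) *\<^sub>R b - (4 * (z \<bullet> b) / (s z)\<^sup>2) *\<^sub>R z) \<bullet> v)"
          by (rule ext) (simp add: inner_diff_left inner_commute[of b] power2_eq_square divide_inverse)
      qed
      moreover have "(\<lambda>y. gradient (log_kernel \<epsilon>) y \<bullet> b) = (\<lambda>y. 2 * (y \<bullet> b) / s y)"
        by (simp add: gradient_log_kernel[OF e] s_def)
      ultimately show "((\<lambda>y. gradient (log_kernel \<epsilon>) y \<bullet> b) has_derivative
          (\<lambda>v. ((2 / s z) *\<^sub>R b - (4 * (z \<bullet> b) / (s z)\<^sup>2) *\<^sub>R z) \<bullet> v)) (at z)" by simp
    qed
    show ?thesis unfolding g using b by (simp add: inner_diff_left power2_eq_square)
  qed
  have "laplacian (log_kernel \<epsilon>) z = (\<Sum>b\<in>Basis. 2 / s z - 4 * (z \<bullet> b)\<^sup>2 / (s z)\<^sup>2)"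
    unfolding laplacian_def by (intro sum.cong gb) auto
  also have "\<dots> = 4 / s z - 4 * (norm z)\<^sup>2 / (s z)\<^sup>2"
  proof -
    have "(norm z)\<^sup>2 = (\<Sum>b\<in>Basis. (z \<bullet> b)\<^sup>2)"
      unfolding power2_norm_eq_inner by (subst euclidean_inner) (simp add: power2_eq_square)
    then show ?thesis by (simp add: sum_subtractf sum_divide_distrib sum_distrib_left)
  qed
  also have "\<dots> = 4 * \<epsilon> / (s z)\<^sup>2"
  proof -
    have "4 / s z = 4 * s z / (s z)\<^sup>2" using p[of z] by (simp add: power2_eq_square)
    then show ?thesis by (simp add: diff_divide_distrib[symmetric] s_def)
  qed
  finally show ?thesis by (simp add: s_def)
qed

text \<open>With \<open>S t = E t / (E t + E (1 - t))\<close> and \<open>E = flat 0\<close>, the cutoff function is \<open>S (2 - |z|\<^sup>2 / \<rho>\<^sup>2)\<close>.\<close>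

lemma cutoff_exists:
  fixes \<rho> :: real
  assumes \<rho>: "\<rho> > 0"
  obtains \<eta> :: "'a::euclidean_space \<Rightarrow> real" where "smooth \<eta>" "\<And>z. norm z \<le> \<rho> \<Longrightarrow> \<eta> z = 1"
    "\<And>z. 2 * \<rho> \<le> norm z \<Longrightarrow> \<eta> z = 0" "\<And>z. 0 \<le> \<eta> z" "\<And>z. \<eta> z \<le> 1"
proof -
  define D where "D t = flat 0 t + flat 0 (1 - t)" for t
  define S where "S t = flat 0 t * inverse (D t)" for t
  define \<eta> :: "'a \<Rightarrow> real" where "\<eta> z = S (2 - (norm z)\<^sup>2 * inverse (\<rho>\<^sup>2))" for z
  have D: "D t > 0" for t
    using flat0_nonneg[of t] flat0_nonneg[of "1 - t"] flat0_pos[of t] flat0_pos[of "1 - t"]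
    unfolding D_def by (cases "t > 0") (auto intro: add_pos_nonneg add_nonneg_pos)
  have "smooth D" unfolding D_def[abs_def]
    by (intro smooth_intros(2) smooth_flat smooth_compose[OF smooth_flat] smooth_intros(5)[OF smooth_intros(1) smooth_ident])
  then have S: "smooth S" unfolding S_def[abs_def]
    using D by (intro smooth_intros(3) smooth_flat smooth_inverse) (auto simp: less_imp_neq[THEN not_sym])
  show ?thesis
  proof (rule that[of \<eta>])
    show "smooth \<eta>" unfolding \<eta>_def[abs_def]
      by (intro smooth_compose[OF S] smooth_intros(1,3,5) smooth_norm_sq)
    show "\<eta> z = 1" if "norm z \<le> \<rho>" for z
    proof -
      have "(norm z)\<^sup>2 \<le> \<rho>\<^sup>2" using that by (intro power_mono) auto
      then have "(norm z)\<^sup>2 * inverse (\<rho>\<^sup>2) \<le> 1" using \<rho> by (simp add: field_simps)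
      then have "1 - (2 - (norm z)\<^sup>2 * inverse (\<rho>\<^sup>2)) \<le> 0" by simp
      then show ?thesis
        using D[of "2 - (norm z)\<^sup>2 * inverse (\<rho>\<^sup>2)"]
        unfolding \<eta>_def S_def D_def by (simp add: flat0_nonpos less_imp_neq[THEN not_sym])
    qed
    show "\<eta> z = 0" if "2 * \<rho> \<le> norm z" for z
    proof -
      have "(2 * \<rho>)\<^sup>2 \<le> (norm z)\<^sup>2" using that \<rho> by (intro power_mono) auto
      then have "2 * \<rho>\<^sup>2 \<le> (norm z)\<^sup>2" using zero_le_power2[of \<rho>] unfolding power_mult_distrib power2_eq_square[of 2] by linarith
      then have "2 \<le> (norm z)\<^sup>2 * inverse (\<rho>\<^sup>2)" using \<rho> by (simp add: field_simps)
      then show ?thesis unfolding \<eta>_def S_def by (simp add: flat0_nonpos)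
    qed
    have "0 \<le> S t \<and> S t \<le> 1" for t
      using D[of t] flat0_nonneg[of t] flat0_nonneg[of "1 - t"]
      by (auto simp: S_def field_simps) (auto simp: D_def)
    then show "0 \<le> \<eta> z" "\<eta> z \<le> 1" for z by (auto simp: \<eta>_def)
  qed
qed

lemma ln_one_plus_le:
  assumes x: "x \<ge> (0::real)" shows "ln (1 + x) \<le> 4 * x powr (1/4)"
proof -
  define y where "y = x powr (1/4)"
  have y: "y \<ge> 0" "y ^ 4 = x"
    using x by (auto simp: y_def powr_realpow'[symmetric] powr_powr simp flip: powr_numeral)
  have "1 + y ^ 4 \<le> (1 + y) ^ 4"
    using y(1) by (simp add: power4_eq_xxxx algebra_simps)
  then have "ln (1 + x) \<le> ln ((1 + y) ^ 4)" using y x by (intro ln_mono) auto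
  also have "\<dots> = 4 * ln (1 + y)" using y by (simp add: ln_realpow)
  also have "\<dots> \<le> 4 * y" using ln_add_one_self_le_self[OF y(1)] by simp
  finally show ?thesis by (simp add: y_def)
qed

lemma AE_fst_nonzero: "AE z in (lborel :: (real \<times> real) measure). fst z \<noteq> 0"
proof -
  have "negligible {z :: real \<times> real. z \<bullet> (1, 0) = 0}"
    by (rule negligible_standard_hyperplane) (simp add: Basis_prod_def)
  then have "{z :: real \<times> real. fst z = 0} \<in> null_sets lebesgue"
    unfolding negligible_iff_null_sets inner_prod_def by simp
  moreover have "closed {z :: real \<times> real. fst z = 0}" by (intro closed_Collect_eq continuous_intros)
  then have "{z :: real \<times> real. fst z = 0} \<in> sets lborel" by simp
  ultimately have "{z :: real \<times> real. fst z = 0} \<in> null_sets lborel"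
    by (simp add: null_sets_completion_iff)
  from AE_not_in[OF this] show ?thesis by simp
qed

text \<open>Up to the factor \<open>4 \<epsilon> powr (1/4)\<close>, a bound for the difference between the regularised and the singular kernel
  on the square of side \<open>2 c\<close>. It is a product of functions of one coordinate, and the exponent \<open>- 1 / 2\<close> is
  integrable at \<open>0\<close> on the line.\<close>

definition log_majorant :: "real \<Rightarrow> real \<times> real \<Rightarrow> real" where
  "log_majorant c z = (indicator {-c<..<c} (fst z) * \<bar>fst z\<bar> powr (-1/2)) * indicator {-c<..<c} (snd z)"

lemma log_majorant_integrable: "integrable lborel (log_majorant c)"
  unfolding log_majorant_def[abs_def]
  by (intro integrable_product_functions integrable_powr_half)
     (cases "- c \<le> c", simp_all add: integrable_indicator_iff)

lemma log_majorant_nonneg: "0 \<le> log_majorant c z"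
  by (simp add: log_majorant_def)

lemma log_kernel_diff:
  assumes e: "\<epsilon> > 0" and z: "fst z \<noteq> 0" "norm z < c"
  shows "\<bar>log_kernel \<epsilon> z - log_kernel 0 z\<bar> \<le> 4 * \<epsilon> powr (1/4) * log_majorant c z"
proof -
  have n: "(norm z)\<^sup>2 = (fst z)\<^sup>2 + (snd z)\<^sup>2" by (cases z) (simp add: norm_Pair)
  have z0: "z \<noteq> 0" using z(1) by auto
  have t: "(fst z)\<^sup>2 > 0" using z(1) by simp
  have in1: "\<bar>fst z\<bar> < c" "\<bar>snd z\<bar> < c" using norm_fst_le[of "fst z" "snd z"] norm_snd_le[of "snd z" "fst z"] z(2) by auto
  have "log_kernel \<epsilon> z - log_kernel 0 z = ln (((norm z)\<^sup>2 + \<epsilon>) / (norm z)\<^sup>2)"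
    using z0 e by (simp add: log_kernel_def ln_div norm_sq_add_pos norm_sq_add_nonzero)
  also have "((norm z)\<^sup>2 + \<epsilon>) / (norm z)\<^sup>2 = 1 + \<epsilon> / (norm z)\<^sup>2" using z0 by (simp add: field_simps)
  finally have eq: "log_kernel \<epsilon> z - log_kernel 0 z = ln (1 + \<epsilon> / (norm z)\<^sup>2)" .
  have "\<epsilon> / (norm z)\<^sup>2 \<le> \<epsilon> / (fst z)\<^sup>2" using e t by (intro divide_left_mono) (auto simp: n intro!: mult_pos_pos add_pos_nonneg)
  then have "ln (1 + \<epsilon> / (norm z)\<^sup>2) \<le> ln (1 + \<epsilon> / (fst z)\<^sup>2)"
    using e by (intro ln_mono) (auto intro!: add_pos_nonneg)
  also have "\<dots> \<le> 4 * (\<epsilon> / (fst z)\<^sup>2) powr (1/4)" using e by (intro ln_one_plus_le) auto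
  also have "(\<epsilon> / (fst z)\<^sup>2) powr (1/4) = \<epsilon> powr (1/4) * \<bar>fst z\<bar> powr (-1/2)"
  proof -
    have "(fst z)\<^sup>2 = \<bar>fst z\<bar> powr 2" using z(1) by simp
    then have "((fst z)\<^sup>2) powr (1/4) = \<bar>fst z\<bar> powr (2 * (1/4))" by (simp only: powr_powr)
    moreover have "(\<epsilon> / (fst z)\<^sup>2) powr (1/4) = \<epsilon> powr (1/4) / ((fst z)\<^sup>2) powr (1/4)"
      by (simp only: powr_divide)
    moreover have "\<bar>fst z\<bar> powr (-(2 * (1/4))) = 1 / \<bar>fst z\<bar> powr (2 * (1/4))" by (rule powr_minus_divide)
    moreover have "-(2 * (1/4)) = (-1/2 :: real)" by simp
    ultimately show ?thesis by (metis times_divide_eq_right mult.right_neutral)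
  qed
  finally have "ln (1 + \<epsilon> / (norm z)\<^sup>2) \<le> 4 * \<epsilon> powr (1/4) * \<bar>fst z\<bar> powr (-1/2)" by simp
  moreover have "ln (1 + \<epsilon> / (norm z)\<^sup>2) \<ge> 0" using e by (intro ln_ge_zero) auto
  moreover have "log_majorant c z = \<bar>fst z\<bar> powr (-1/2)" using in1 by (simp add: log_majorant_def abs_less_iff)
  ultimately show ?thesis unfolding eq by simp
qed

section \<open>Localised kernels\<close>

text \<open>A smooth cutoff function \<open>\<eta>\<close> that is \<open>1\<close> on the disc of radius \<open>\<rho>\<close> and \<open>0\<close> outside the disc of
  radius \<open>2 \<rho>\<close>.\<close>

locale cutoff =
  fixes \<rho> :: real and \<eta> :: "real \<times> real \<Rightarrow> real"
  assumes \<rho>: "\<rho> > 0" and \<eta>: "smooth \<eta>" and \<eta>_one: "norm z \<le> \<rho> \<Longrightarrow> \<eta> z = 1"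
    and \<eta>_zero: "2 * \<rho> \<le> norm z \<Longrightarrow> \<eta> z = 0" and \<eta>_nonneg: "0 \<le> \<eta> z" and \<eta>_le_1: "\<eta> z \<le> 1"
begin

text \<open>The localised kernel. By the product rule its Laplacian is \<open>peak \<epsilon> + rest \<epsilon>\<close>: the first part concentrates
  at the origin as \<open>\<epsilon> \<rightarrow> 0\<close>, and the second one, which collects the terms with derivatives of \<open>\<eta>\<close>, lives
  on the annulus where \<open>\<eta>\<close> is not constant and converges uniformly (\<open>rest_diff\<close>).\<close>

definition "kern \<epsilon> z = \<eta> z * log_kernel \<epsilon> z"
definition "rest \<epsilon> z = 2 * (gradient \<eta> z \<bullet> ((2 / ((norm z)\<^sup>2 + \<epsilon>)) *\<^sub>R z)) + log_kernel \<epsilon> z * laplacian \<eta> z"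
definition "peak \<epsilon> z = \<eta> z * (4 * \<epsilon> / ((norm z)\<^sup>2 + \<epsilon>)\<^sup>2)"

lemma smooth_kern: "\<epsilon> > 0 \<Longrightarrow> smooth (kern \<epsilon>)"
  unfolding kern_def[abs_def] by (intro smooth_intros(3) \<eta> smooth_log_kernel)

lemma kern_zero: "z \<notin> cball 0 (2 * \<rho>) \<Longrightarrow> kern \<epsilon> z = 0"
  by (simp add: kern_def \<eta>_zero)

lemma laplacian_kern: "\<epsilon> > 0 \<Longrightarrow> laplacian (kern \<epsilon>) z = peak \<epsilon> z + rest \<epsilon> z"
  unfolding kern_def[abs_def]
  by (simp add: laplacian_mult[OF \<eta> smooth_log_kernel] laplacian_log_kernel gradient_log_kernel peak_def rest_def)

lemma \<eta>_continuous: "continuous_on S \<eta>" using smooth_continuous[OF \<eta>] .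

lemma \<eta>_borel [measurable]: "\<eta> \<in> borel_measurable borel"
  by (rule borel_measurable_continuous_onI[OF \<eta>_continuous])

lemma kern_borel [measurable]: "kern \<epsilon> \<in> borel_measurable borel"
  unfolding kern_def[abs_def] log_kernel_def[abs_def] by measurable

lemma rest_borel [measurable]: "rest \<epsilon> \<in> borel_measurable borel"
proof -
  have [measurable]: "gradient \<eta> \<in> borel_measurable borel" "laplacian \<eta> \<in> borel_measurable borel"
    using continuous_gradient[OF \<eta>] continuous_laplacian[OF \<eta>] by (auto intro: borel_measurable_continuous_onI)
  show ?thesis unfolding rest_def[abs_def] log_kernel_def[abs_def] by measurable
qed

lemma continuous_peak: "\<epsilon> > 0 \<Longrightarrow> continuous_on S (peak \<epsilon>)"
  unfolding peak_def[abs_def]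
  by (intro continuous_intros \<eta>_continuous ballI) (metis norm_sq_add_nonzero power_not_zero)

lemma peak_borel [measurable]: "peak \<epsilon> \<in> borel_measurable borel"
  unfolding peak_def[abs_def] by measurable

lemma peak_bounds:
  assumes "\<epsilon> > 0" shows "0 \<le> peak \<epsilon> z" "peak \<epsilon> z \<le> 4 / \<epsilon>"
proof -
  show "0 \<le> peak \<epsilon> z" using assms \<eta>_nonneg by (simp add: peak_def)
  have "\<epsilon>\<^sup>2 \<le> ((norm z)\<^sup>2 + \<epsilon>)\<^sup>2" using assms by (intro power_mono) auto
  then have "4 * \<epsilon> / ((norm z)\<^sup>2 + \<epsilon>)\<^sup>2 \<le> 4 * \<epsilon> / \<epsilon>\<^sup>2" using assms by (intro divide_left_mono mult_pos_pos zero_less_power norm_sq_add_pos) auto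
  also have "\<dots> = 4 / \<epsilon>" using assms by (simp add: power2_eq_square)
  finally have "\<eta> z * (4 * \<epsilon> / ((norm z)\<^sup>2 + \<epsilon>)\<^sup>2) \<le> 1 * (4 / \<epsilon>)"
    using assms \<eta>_nonneg \<eta>_le_1 by (intro mult_mono) auto
  then show "peak \<epsilon> z \<le> 4 / \<epsilon>" by (simp add: peak_def)
qed

lemma peak_scale:
  assumes c: "c > 0" shows "c\<^sup>2 * peak (c\<^sup>2) (c *\<^sub>R v) = \<eta> (c *\<^sub>R v) * profile v"
proof -
  have "(norm (c *\<^sub>R v))\<^sup>2 + c\<^sup>2 = c\<^sup>2 * ((norm v)\<^sup>2 + 1)" by (simp add: power_mult_distrib algebra_simps)
  then have "peak (c\<^sup>2) (c *\<^sub>R v) = \<eta> (c *\<^sub>R v) * (4 * c\<^sup>2 / (c\<^sup>2 * ((norm v)\<^sup>2 + 1))\<^sup>2)" by (simp only: peak_def)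
  moreover have "c\<^sup>2 * (4 * c\<^sup>2 / (c\<^sup>2 * X)\<^sup>2) = 4 / X\<^sup>2" for X :: real
  proof -
    have "b * (4 * b / (b * X)\<^sup>2) = 4 / X\<^sup>2" if "b > 0" for b :: real
      using that by (simp add: power2_eq_square)
    then show ?thesis using c by simp
  qed
  ultimately show ?thesis by (simp only: profile_def mult.left_commute[of "c\<^sup>2"])
qed

lemma rest_bounded:
  assumes e: "\<epsilon> > 0" obtains B where "\<And>z. \<bar>rest \<epsilon> z\<bar> \<le> B"
proof -
  have gk: "gradient (kern \<epsilon>) y = 0" if "y \<notin> cball 0 (2 * \<rho>)" for y
    by (rule gradient_support[OF compact_cball kern_zero that])
  have "laplacian (kern \<epsilon>) z = 0" if "z \<notin> cball 0 (2 * \<rho>)" for z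
  proof -
    have "gradient (\<lambda>y. gradient (kern \<epsilon>) y \<bullet> b) z = 0" for b
      by (rule gradient_support[OF compact_cball _ that])
         (metis gk inner_zero_left)
    then show ?thesis by (simp add: laplacian_def)
  qed
  then obtain A where A: "\<And>z. norm (laplacian (kern \<epsilon>) z) \<le> A"
    using bounded_compact_support[OF continuous_laplacian[OF smooth_kern[OF e]] compact_cball] by metis
  show ?thesis
  proof
    fix z show "\<bar>rest \<epsilon> z\<bar> \<le> A + 4 / \<epsilon>"
      using A[of z] peak_bounds[OF e, of z] laplacian_kern[OF e, of z] by simp
  qed
qed

lemma kern_diff:
  assumes e: "\<epsilon> > 0" and z: "fst z \<noteq> 0"
  shows "\<bar>kern \<epsilon> z - kern 0 z\<bar> \<le> 4 * \<epsilon> powr (1/4) * log_majorant (2 * \<rho>) z"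
proof (cases "norm z < 2 * \<rho>")
  case True
  have "\<bar>kern \<epsilon> z - kern 0 z\<bar> = \<eta> z * \<bar>log_kernel \<epsilon> z - log_kernel 0 z\<bar>"
    using \<eta>_nonneg[of z] by (simp add: kern_def right_diff_distrib[symmetric] abs_mult)
  also have "\<dots> \<le> 1 * \<bar>log_kernel \<epsilon> z - log_kernel 0 z\<bar>" using \<eta>_le_1 by (intro mult_right_mono) auto
  also have "\<dots> \<le> 4 * \<epsilon> powr (1/4) * log_majorant (2 * \<rho>) z" using log_kernel_diff[OF e z True] by simp
  finally show ?thesis .
next
  case False
  then show ?thesis by (simp add: kern_def \<eta>_zero log_majorant_nonneg)
qed

lemma rest_diff:
  obtains C where "C \<ge> 0" "\<And>\<epsilon> z. \<epsilon> > 0 \<Longrightarrow> \<bar>rest \<epsilon> z - rest 0 z\<bar> \<le> C * \<epsilon>"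
proof -
  have gz: "gradient \<eta> z = 0" if "z \<notin> cball 0 (2 * \<rho>)" for z
    by (rule gradient_support[OF compact_cball _ that]) (simp add: \<eta>_zero)
  have lz: "laplacian \<eta> z = 0" if "z \<notin> cball 0 (2 * \<rho>)" for z
  proof -
    have "gradient (\<lambda>y. gradient \<eta> y \<bullet> b) z = 0" for b
      by (rule gradient_support[OF compact_cball _ that]) (metis gz inner_zero_left)
    then show ?thesis by (simp add: laplacian_def)
  qed
  obtain M where M: "M > 0" "\<And>z. norm (gradient \<eta> z) \<le> M"
    using bounded_compact_support[OF continuous_gradient[OF \<eta>] compact_cball gz] by metis
  obtain M' where M': "M' > 0" "\<And>z. norm (laplacian \<eta> z) \<le> M'"
    using bounded_compact_support[OF continuous_laplacian[OF \<eta>] compact_cball lz] by metis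
  have g1: "gradient \<eta> z = 0" if "z \<in> ball 0 \<rho>" for z
  proof -
    have "(\<eta> has_derivative (\<lambda>_. 0)) (at z)"
      by (rule has_derivative_transform_within_open[OF has_derivative_const[of 1] open_ball that])
         (simp add: \<eta>_one)
    then show ?thesis by (intro gradient_eqI) simp
  qed
  have l1: "laplacian \<eta> z = 0" if "z \<in> ball 0 \<rho>" for z
  proof -
    have "gradient (\<lambda>y. gradient \<eta> y \<bullet> b) z = 0" for b
      by (rule gradient_locally_zero[OF open_ball that]) (simp add: g1)
    then show ?thesis by (simp add: laplacian_def)
  qed
  show ?thesis
  proof (rule that)
    show "4 * M / \<rho> ^ 3 + M' / \<rho>\<^sup>2 \<ge> 0" using M M' \<rho> by simp
    fix \<epsilon> :: real and z :: "real \<times> real" assume e: "\<epsilon> > 0"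
    show "\<bar>rest \<epsilon> z - rest 0 z\<bar> \<le> (4 * M / \<rho> ^ 3 + M' / \<rho>\<^sup>2) * \<epsilon>"
    proof (cases "norm z < \<rho>")
      case True
      then show ?thesis using M M' \<rho> e by (simp add: rest_def g1 l1)
    next
      case False
      define r where "r = norm z"
      have r: "r \<ge> \<rho>" "r > 0" using False \<rho> by (auto simp: r_def)
      have "rest \<epsilon> z - rest 0 z = (4 / (r\<^sup>2 + \<epsilon>) - 4 / r\<^sup>2) * (gradient \<eta> z \<bullet> z) +
          (ln (r\<^sup>2 + \<epsilon>) - ln (r\<^sup>2)) * laplacian \<eta> z"
        by (simp add: rest_def log_kernel_def r_def algebra_simps)
      also have "\<bar>\<dots>\<bar> \<le> \<bar>4 / (r\<^sup>2 + \<epsilon>) - 4 / r\<^sup>2\<bar> * \<bar>gradient \<eta> z \<bullet> z\<bar> + \<bar>ln (r\<^sup>2 + \<epsilon>) - ln (r\<^sup>2)\<bar> * \<bar>laplacian \<eta> z\<bar>"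
        by (rule order_trans[OF abs_triangle_ineq]) (simp add: abs_mult)
      also have "\<dots> \<le> (4 * \<epsilon> / r ^ 4) * (M * r) + (\<epsilon> / r\<^sup>2) * M'"
      proof (intro add_mono mult_mono)
        have "4 / (r\<^sup>2 + \<epsilon>) - 4 / r\<^sup>2 = - (4 * \<epsilon> / ((r\<^sup>2 + \<epsilon>) * r\<^sup>2))"
          using r e by (simp add: field_simps add_pos_pos less_imp_neq[THEN not_sym])
        then have "\<bar>4 / (r\<^sup>2 + \<epsilon>) - 4 / r\<^sup>2\<bar> = 4 * \<epsilon> / ((r\<^sup>2 + \<epsilon>) * r\<^sup>2)" using r e by simp
        also have "\<dots> \<le> 4 * \<epsilon> / (r\<^sup>2 * r\<^sup>2)"
          using r e by (intro divide_left_mono mult_right_mono mult_pos_pos add_pos_pos) auto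
        also have "r\<^sup>2 * r\<^sup>2 = r ^ 4" by (simp flip: power_add)
        finally show "\<bar>4 / (r\<^sup>2 + \<epsilon>) - 4 / r\<^sup>2\<bar> \<le> 4 * \<epsilon> / r ^ 4" .
        show "\<bar>gradient \<eta> z \<bullet> z\<bar> \<le> M * r"
          using Cauchy_Schwarz_ineq2[of "gradient \<eta> z" z] mult_right_mono[OF M(2)[of z] norm_ge_zero[of z]]
          by (simp add: r_def)
        have "ln (r\<^sup>2 + \<epsilon>) - ln (r\<^sup>2) = ln (1 + \<epsilon> / r\<^sup>2)"
        proof -
          have "(r\<^sup>2 + \<epsilon>) / r\<^sup>2 = 1 + \<epsilon> / r\<^sup>2" using r by (simp add: add_divide_distrib)
          moreover have "ln ((r\<^sup>2 + \<epsilon>) / r\<^sup>2) = ln (r\<^sup>2 + \<epsilon>) - ln (r\<^sup>2)"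
            using r e add_pos_pos[of "r\<^sup>2" \<epsilon>] by (intro ln_divide_pos) auto
          ultimately show ?thesis by simp
        qed
        moreover have "0 \<le> ln (1 + \<epsilon> / r\<^sup>2)" "ln (1 + \<epsilon> / r\<^sup>2) \<le> \<epsilon> / r\<^sup>2"
          using r e by (auto intro!: ln_ge_zero ln_add_one_self_le_self)
        ultimately show "\<bar>ln (r\<^sup>2 + \<epsilon>) - ln (r\<^sup>2)\<bar> \<le> \<epsilon> / r\<^sup>2" by simp
      qed (use M' e r in auto)
      also have "\<dots> = 4 * M * \<epsilon> / r ^ 3 + M' * \<epsilon> / r\<^sup>2"
        using r by (simp add: power3_eq_cube power4_eq_xxxx field_simps)
      also have "\<dots> \<le> 4 * M * \<epsilon> / \<rho> ^ 3 + M' * \<epsilon> / \<rho>\<^sup>2"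
        using r M M' \<rho> e by (intro add_mono divide_left_mono power_mono) auto
      also have "\<dots> = (4 * M / \<rho> ^ 3 + M' / \<rho>\<^sup>2) * \<epsilon>" by (simp add: field_simps)
      finally show ?thesis .
    qed
  qed
qed

lemma kern_0_integrable: "integrable lborel (kern 0)"
proof -
  have k1: "integrable lborel (kern 1)"
    by (rule integrable_compact_support[OF smooth_continuous[OF smooth_kern] compact_cball[of 0 "2 * \<rho>"]])
       (simp, metis kern_zero)
  have "integrable lborel (\<lambda>z. kern 1 z - kern 0 z)"
  proof (rule Bochner_Integration.integrable_bound)
    show "integrable lborel (\<lambda>z. 4 * log_majorant (2 * \<rho>) z)" using log_majorant_integrable by simp
    show "AE z in lborel. norm (kern 1 z - kern 0 z) \<le> norm (4 * log_majorant (2 * \<rho>) z)"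
      by (rule AE_mp[OF AE_fst_nonzero AE_I2])
         (use kern_diff[of 1] log_majorant_nonneg[of "2 * \<rho>"] in \<open>auto simp: abs_mult\<close>)
  qed measurable
  from Bochner_Integration.integrable_diff[OF k1 this] show ?thesis by simp
qed

end

section \<open>Interior continuity\<close>

locale planar = nonneg_weak_solution \<Omega> U G for \<Omega> :: "(real \<times> real) set" and U G
begin

lemma weak_laplacian:
  assumes \<phi>: "\<phi> \<in> test_functions \<Omega>"
  shows "(LBINT x. U x * laplacian \<phi> x) = - (LBINT x. exp (- U x) * \<phi> x)"
proof -
  let ?\<psi> = "\<lambda>b x. gradient \<phi> x \<bullet> b"
  note [measurable] = test_measurable[OF \<phi>]
  have \<psi>: "?\<psi> b \<in> test_functions \<Omega>" if "b \<in> Basis" for b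
    using test_partial[OF \<phi> that] by (simp add: gradient_inner_Basis[OF that])
  have sqU: "integrable lborel (\<lambda>x. U x *\<^sub>R gradient (?\<psi> b) x)" if "b \<in> Basis" for b
    using test_measurable[OF \<psi>[OF that]] test_integrable[OF \<psi>[OF that]] U_sq
    by (intro square_integrable_scaleR) auto
  have sqG: "integrable lborel (\<lambda>x. ?\<psi> b x *\<^sub>R G x)" if "b \<in> Basis" for b
    using test_measurable[OF \<psi>[OF that]] test_integrable[OF \<psi>[OF that]] G_sq
    by (intro square_integrable_scaleR) auto
  have "(LBINT x. U x * laplacian \<phi> x) = (LBINT x. (\<Sum>b\<in>Basis. (U x *\<^sub>R gradient (?\<psi> b) x) \<bullet> b))"
    by (simp add: laplacian_def sum_distrib_left)
  also have "\<dots> = (\<Sum>b\<in>Basis. LBINT x. (U x *\<^sub>R gradient (?\<psi> b) x) \<bullet> b)"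
    by (rule Bochner_Integration.integral_sum) (intro integrable_inner_left sqU)
  also have "\<dots> = (\<Sum>b\<in>Basis. (LBINT x. U x *\<^sub>R gradient (?\<psi> b) x) \<bullet> b)"
    by (intro sum.cong refl integral_inner_left sqU)
  also have "\<dots> = (\<Sum>b\<in>Basis. - ((LBINT x. ?\<psi> b x *\<^sub>R G x) \<bullet> b))"
    by (intro sum.cong refl) (simp add: weak[OF \<psi>])
  also have "\<dots> = (\<Sum>b\<in>Basis. - (LBINT x. (?\<psi> b x *\<^sub>R G x) \<bullet> b))"
    by (intro sum.cong refl arg_cong[where f = uminus] integral_inner_left[symmetric] sqG)
  also have "\<dots> = - (LBINT x. (\<Sum>b\<in>Basis. (?\<psi> b x *\<^sub>R G x) \<bullet> b))"
    by (subst Bochner_Integration.integral_sum) (auto simp: sum_negf intro!: integrable_inner_left sqG simp del: inner_scaleR_left)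
  also have "(\<lambda>x. \<Sum>b\<in>Basis. (?\<psi> b x *\<^sub>R G x) \<bullet> b) = (\<lambda>x. G x \<bullet> gradient \<phi> x)"
  proof
    fix x
    have "G x \<bullet> gradient \<phi> x = (\<Sum>b\<in>Basis. (G x \<bullet> b) * (gradient \<phi> x \<bullet> b))" by (rule euclidean_inner)
    then show "(\<Sum>b\<in>Basis. (?\<psi> b x *\<^sub>R G x) \<bullet> b) = G x \<bullet> gradient \<phi> x" by (simp add: mult.commute)
  qed
  finally show ?thesis using equation[OF \<phi>] by simp
qed

text \<open>Inserting \<open>kern \<epsilon> (\<cdot> - x)\<close> into \<open>weak_laplacian\<close> gives
  \<open>\<integral> peak \<epsilon> (y - x) U y = - \<integral> kern \<epsilon> (y - x) exp (- U y) - \<integral> rest \<epsilon> (y - x) U y\<close>. The left-hand side is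
  continuous in \<open>x\<close>. The right-hand side converges uniformly as \<open>\<epsilon> \<rightarrow> 0\<close>, because \<open>exp (- U) \<le> 1\<close> and
  \<open>kern \<epsilon> \<rightarrow> kern 0\<close> in the mean. In the sense of distributions the left-hand side converges to a
  positive multiple of \<open>U\<close>.\<close>

lemma local_continuity:
  assumes \<rho>0: "\<rho> > 0" and sub: "cball x0 (3 * \<rho>) \<subseteq> \<Omega>"
  shows "\<exists>w. continuous_on (ball x0 \<rho>) w \<and> (AE x in lborel. x \<in> ball x0 \<rho> \<longrightarrow> w x = U x)"
proof -
  obtain \<eta> :: "real \<times> real \<Rightarrow> real" where "cutoff \<rho> \<eta>"
    using cutoff_exists[OF \<rho>0] \<rho>0 unfolding cutoff_def by metis
  then interpret cutoff \<rho> \<eta> .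
  let ?V = "ball x0 \<rho>"
  \<comment> \<open>The regularisation parameter is \<open>\<epsilon> = (c n)\<^sup>2\<close>, so that \<open>c n\<close> is the length scale of the peak.\<close>
  define c where "c n = 1 / real (Suc n)" for n
  have c: "c n > 0" "c n \<le> 1" for n by (auto simp: c_def)
  have c0: "c \<longlonglongrightarrow> 0" unfolding c_def using LIMSEQ_inverse_real_of_nat by (simp add: inverse_eq_divide)
  define A where "A n x = (LBINT y. peak ((c n)\<^sup>2) (y - x) * U y)" for n x
  define W where "W x = - (LBINT y. kern 0 (y - x) * exp (- U y)) - (LBINT y. rest 0 (y - x) * U y)" for x
  define m where "m = (LBINT v. profile v)"
  have m: "m > 0" unfolding m_def by (rule integral_profile_pos)
  obtain C where C: "C \<ge> 0" "\<And>\<epsilon> z. \<epsilon> > 0 \<Longrightarrow> \<bar>rest \<epsilon> z - rest 0 z\<bar> \<le> C * \<epsilon>" using rest_diff by blast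
  define J where "J = (LBINT z. log_majorant (2 * \<rho>) z)"
  define I where "I = (LBINT y. \<bar>U y\<bar>)"
  define err where "err n = 4 * ((c n)\<^sup>2) powr (1/4) * J + C * (c n)\<^sup>2 * I" for n
  have tr: "(LBINT y. f (y - x)) = (LBINT y. f y)" "integrable lborel (\<lambda>y. f (y - x)) \<longleftrightarrow> integrable lborel f"
    if "f \<in> borel_measurable borel" for f :: "real \<times> real \<Rightarrow> real" and x
    using integral_translate[OF that, of "- x"] by auto
  have exp1: "0 < exp (- U y)" "exp (- U y) \<le> 1" for y using U_nonneg[of y] by auto
  have bdU: "integrable lborel (\<lambda>y. k (y - x) * U y)"
    if "k \<in> borel_measurable borel" "\<And>z. \<bar>k z\<bar> \<le> B" for k :: "real \<times> real \<Rightarrow> real" and x B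
  proof (rule Bochner_Integration.integrable_bound)
    show "integrable lborel (\<lambda>y. B * U y)" using U_integrable by simp
    show "AE y in lborel. norm (k (y - x) * U y) \<le> norm (B * U y)"
    proof (rule AE_I2)
      fix y
      have "\<bar>k (y - x)\<bar> \<le> \<bar>B\<bar>" using that(2)[of "y - x"] by linarith
      then show "norm (k (y - x) * U y) \<le> norm (B * U y)" by (simp add: abs_mult mult_right_mono)
    qed
  qed (use that(1) in measurable)
  have bdk: "integrable lborel (\<lambda>y. k (y - x) * exp (- U y))" if k: "integrable lborel k" for k :: "real \<times> real \<Rightarrow> real" and x
  proof -
    have [measurable]: "k \<in> borel_measurable borel" using borel_measurable_integrable[OF k] by simp
    show ?thesis
    proof (rule Bochner_Integration.integrable_bound)
      show "integrable lborel (\<lambda>y. k (y - x))" using tr(2)[of k x] k by simp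
      show "AE y in lborel. norm (k (y - x) * exp (- U y)) \<le> norm (k (y - x))"
        using exp1 by (auto simp: abs_mult intro!: mult_left_le)
    qed measurable
  qed
  have kint: "integrable lborel (kern \<epsilon>)" if "\<epsilon> > 0" for \<epsilon>
    using that by (intro integrable_compact_support[OF smooth_continuous[OF smooth_kern] compact_cball[of 0 "2 * \<rho>"]])
      (simp, metis kern_zero)
  have close: "\<bar>A n x - W x\<bar> \<le> err n" if x: "x \<in> ?V" for n x
  proof -
    let ?e = "(c n)\<^sup>2"
    have e: "?e > 0" using c[of n] by simp
    have \<phi>: "(\<lambda>y. kern ?e (y - x)) \<in> test_functions \<Omega>"
    proof (rule test_functionI[OF smooth_translate[OF smooth_kern[OF e]] compact_cball[of x "2 * \<rho>"]])
      show "cball x (2 * \<rho>) \<subseteq> \<Omega>"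
      proof
        fix y assume "y \<in> cball x (2 * \<rho>)"
        then have "dist x0 y \<le> 3 * \<rho>" using x dist_triangle[of x0 y x] by (auto simp: dist_commute)
        then show "y \<in> \<Omega>" using sub by auto
      qed
      show "kern ?e (y - x) = 0" if "y \<notin> cball x (2 * \<rho>)" for y
        by (rule kern_zero) (use that in \<open>auto simp: dist_norm norm_minus_commute\<close>)
    qed
    have lap: "laplacian (\<lambda>y. kern ?e (y - x)) y = peak ?e (y - x) + rest ?e (y - x)" for y
      using laplacian_translate[OF smooth_kern[OF e]] laplacian_kern[OF e] by simp
    obtain B where B: "\<And>z. \<bar>rest ?e z\<bar> \<le> B" using rest_bounded[OF e] by blast
    have ip: "integrable lborel (\<lambda>y. peak ?e (y - x) * U y)"
      using peak_bounds[OF e] by (intro bdU[of _ "4 / ?e"]) auto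
    have ir: "integrable lborel (\<lambda>y. rest ?e (y - x) * U y)" using B by (intro bdU) auto
    have "\<bar>rest 0 z\<bar> \<le> B + C * ?e" for z using B[of z] C(2)[OF e, of z] by linarith
    then have i0: "integrable lborel (\<lambda>y. rest 0 (y - x) * U y)" by (intro bdU) auto
    have "(LBINT y. U y * laplacian (\<lambda>y. kern ?e (y - x)) y) = A n x + (LBINT y. rest ?e (y - x) * U y)"
      unfolding A_def lap using ip ir by (subst Bochner_Integration.integral_add[symmetric]) (auto simp: algebra_simps)
    with weak_laplacian[OF \<phi>]
    have "A n x = - (LBINT y. kern ?e (y - x) * exp (- U y)) - (LBINT y. rest ?e (y - x) * U y)"
      by (simp add: mult.commute)
    then have eq1: "A n x - W x = - ((LBINT y. kern ?e (y - x) * exp (- U y)) - (LBINT y. kern 0 (y - x) * exp (- U y)))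
        - ((LBINT y. rest ?e (y - x) * U y) - (LBINT y. rest 0 (y - x) * U y))"
      by (simp add: W_def)
    have eq2: "A n x - W x = - (LBINT y. (kern ?e (y - x) - kern 0 (y - x)) * exp (- U y))
        - (LBINT y. (rest ?e (y - x) - rest 0 (y - x)) * U y)"
      unfolding eq1 using bdk[OF kint[OF e]] bdk[OF kern_0_integrable] ir i0 by (simp add: left_diff_distrib)
    have b1: "\<bar>LBINT y. (kern ?e (y - x) - kern 0 (y - x)) * exp (- U y)\<bar> \<le> 4 * ?e powr (1/4) * J"
    proof -
      have d: "integrable lborel (\<lambda>z. kern ?e z - kern 0 z)" using kint[OF e] kern_0_integrable by simp
      have d': "integrable lborel (\<lambda>y. kern ?e (y - x) - kern 0 (y - x))"
        using tr(2)[of "\<lambda>z. kern ?e z - kern 0 z" x] d by simp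
      have "\<bar>LBINT y. (kern ?e (y - x) - kern 0 (y - x)) * exp (- U y)\<bar>
          \<le> (LBINT y. \<bar>(kern ?e (y - x) - kern 0 (y - x)) * exp (- U y)\<bar>)" by (rule integral_abs_bound)
      also have "\<dots> \<le> (LBINT y. \<bar>kern ?e (y - x) - kern 0 (y - x)\<bar>)"
      proof (rule integral_mono[OF integrable_abs[OF bdk[OF d]] integrable_abs[OF d']])
        show "\<bar>(kern ?e (y - x) - kern 0 (y - x)) * exp (- U y)\<bar> \<le> \<bar>kern ?e (y - x) - kern 0 (y - x)\<bar>" for y
          using exp1[of y] by (auto simp: abs_mult intro!: mult_left_le)
      qed
      also have "\<dots> = (LBINT z. \<bar>kern ?e z - kern 0 z\<bar>)"
        by (rule tr(1)) measurable
      also have "\<dots> \<le> (LBINT z. 4 * ?e powr (1/4) * log_majorant (2 * \<rho>) z)"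
        using d log_majorant_integrable
        by (intro integral_mono_AE AE_mp[OF AE_fst_nonzero AE_I2]) (auto intro: kern_diff[OF e])
      also have "\<dots> = 4 * ?e powr (1/4) * J" by (simp add: J_def)
      finally show ?thesis .
    qed
    have b2: "\<bar>LBINT y. (rest ?e (y - x) - rest 0 (y - x)) * U y\<bar> \<le> C * ?e * I"
    proof -
      have "\<bar>LBINT y. (rest ?e (y - x) - rest 0 (y - x)) * U y\<bar>
          \<le> (LBINT y. \<bar>(rest ?e (y - x) - rest 0 (y - x)) * U y\<bar>)" by (rule integral_abs_bound)
      also have "\<dots> \<le> (LBINT y. C * ?e * \<bar>U y\<bar>)"
      proof (rule integral_mono)
        show "integrable lborel (\<lambda>y. \<bar>(rest ?e (y - x) - rest 0 (y - x)) * U y\<bar>)"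
          using ir i0 by (simp add: left_diff_distrib)
        show "\<bar>(rest ?e (y - x) - rest 0 (y - x)) * U y\<bar> \<le> C * ?e * \<bar>U y\<bar>" for y
          unfolding abs_mult by (intro mult_right_mono C(2)[OF e]) auto
      qed (use U_integrable in auto)
      finally show ?thesis by (simp add: I_def)
    qed
    have tri: "\<bar>- a - b\<bar> \<le> \<bar>a\<bar> + \<bar>b\<bar>" for a b :: real by linarith
    show ?thesis unfolding eq2 err_def by (rule order_trans[OF tri add_mono[OF b1 b2]])
  qed
  have err0: "err \<longlonglongrightarrow> 0"
  proof -
    have e: "((c n)\<^sup>2) powr (1/4) = c n powr (1/2)" for n
      using c(1)[of n] by (simp add: powr_powr flip: powr_numeral)
    have "(\<lambda>n. c n powr (1/2)) \<longlonglongrightarrow> 0 powr (1/2)"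
      using c0 c less_imp_le by (intro tendsto_powr2) (auto intro!: always_eventually)
    then have "(\<lambda>n. 4 * c n powr (1/2) * J + C * (c n)\<^sup>2 * I) \<longlonglongrightarrow> 4 * 0 * J + C * 0\<^sup>2 * I"
      using c0 by (intro tendsto_intros) auto
    then show ?thesis by (simp add: err_def[abs_def] e)
  qed
  have contA: "continuous_on S (A n)" for S n
    unfolding A_def[abs_def] using c[of n] peak_bounds
    by (intro continuous_convolution[of _ "4 / (c n)\<^sup>2"] continuous_peak U_integrable) auto
  have unif: "uniform_limit ?V A W sequentially"
  proof (rule uniform_limitI)
    fix e :: real assume "e > 0"
    with err0 have "\<forall>\<^sub>F n in sequentially. err n < e" by (auto dest: order_tendstoD(2))
    then show "\<forall>\<^sub>F n in sequentially. \<forall>x\<in>?V. dist (A n x) (W x) < e"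
    proof eventually_elim
      case (elim n)
      show ?case using le_less_trans[OF close elim] by (simp only: dist_real_def) blast
    qed
  qed
  have contW: "continuous_on ?V W"
    by (rule uniform_limit_theorem[OF _ unif]) (auto intro: contA always_eventually)
  have mW: "(\<lambda>x. indicator ?V x *\<^sub>R W x) \<in> borel_measurable borel"
    by (rule borel_measurable_continuous_on_indicator[OF _ contW]) simp
  have key: "(LBINT x. \<xi> x * (indicator ?V x *\<^sub>R W x - m * (indicator ?V x * U x))) = 0"
    if \<xi>: "\<xi> \<in> test_functions ?V" for \<xi>
  proof -
    note [measurable] = test_measurable[OF \<xi>]
    obtain K where K: "smooth \<xi>" "compact K" "K \<subseteq> ?V" "\<And>x. x \<notin> K \<Longrightarrow> \<xi> x = 0"
      using \<xi> by (rule test_functionE) auto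
    obtain B where B: "B > 0" "\<And>x. \<bar>\<xi> x\<bar> \<le> B" using test_bounded[OF \<xi>] by metis
    have chi_int: "integrable lborel \<xi>" using test_integrable[OF \<xi>] by blast
    have contx: "continuous_on S \<xi>" for S using smooth_continuous[OF K(1)] .
    have VW: "\<xi> x * (indicator ?V x *\<^sub>R W x) = \<xi> x * W x" for x
      using K(3) K(4)[of x] by (cases "x \<in> K") (auto simp: indicator_def)
    have iW: "integrable lborel (\<lambda>x. \<xi> x * W x)"
    proof -
      have "integrable lborel (\<lambda>x. indicator K x *\<^sub>R (\<xi> x * W x))"
        by (intro borel_integrable_compact K(2) continuous_intros contx continuous_on_subset[OF contW K(3)])
      moreover have "(\<lambda>x. indicator K x *\<^sub>R (\<xi> x * W x)) = (\<lambda>x. \<xi> x * W x)"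
      proof
        fix x show "indicator K x *\<^sub>R (\<xi> x * W x) = \<xi> x * W x"
          using K(4)[of x] by (cases "x \<in> K") auto
      qed
      ultimately show ?thesis by simp
    qed
    have [measurable]: "A n \<in> borel_measurable borel" for n by (rule borel_measurable_continuous_onI[OF contA])
    obtain E where E: "\<And>n. \<bar>err n\<bar> \<le> E"
      using convergent_imp_bounded[OF err0] by (auto simp: bounded_iff)
    have lim1: "(\<lambda>n. LBINT x. \<xi> x * A n x) \<longlonglongrightarrow> (LBINT x. \<xi> x * W x)"
    proof (rule integral_dominated_convergence[where w = "\<lambda>x. \<bar>\<xi> x * W x\<bar> + E * \<bar>\<xi> x\<bar>"])
      show "integrable lborel (\<lambda>x. \<bar>\<xi> x * W x\<bar> + E * \<bar>\<xi> x\<bar>)" using iW chi_int by auto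
      show "(\<lambda>x. \<xi> x * W x) \<in> borel_measurable lborel" using borel_measurable_integrable[OF iW] .
      show "AE x in lborel. (\<lambda>n. \<xi> x * A n x) \<longlonglongrightarrow> \<xi> x * W x"
      proof (rule AE_I2)
        fix x show "(\<lambda>n. \<xi> x * A n x) \<longlonglongrightarrow> \<xi> x * W x"
        proof (cases "x \<in> K")
          case True
          then have "(\<lambda>n. A n x) \<longlonglongrightarrow> W x" using tendsto_uniform_limitI[OF unif] K(3) by blast
          then show ?thesis by (rule tendsto_mult_left)
        qed (simp add: K(4))
      qed
      show "AE x in lborel. norm (\<xi> x * A n x) \<le> \<bar>\<xi> x * W x\<bar> + E * \<bar>\<xi> x\<bar>" for n
      proof (rule AE_I2)
        fix x show "norm (\<xi> x * A n x) \<le> \<bar>\<xi> x * W x\<bar> + E * \<bar>\<xi> x\<bar>"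
        proof (cases "x \<in> K")
          case True
          then have "\<bar>A n x - W x\<bar> \<le> E" using close[of x n] K(3) E[of n] by fastforce
          then have "\<bar>A n x\<bar> \<le> \<bar>W x\<bar> + E" by linarith
          then have "\<bar>\<xi> x\<bar> * \<bar>A n x\<bar> \<le> \<bar>\<xi> x\<bar> * (\<bar>W x\<bar> + E)" by (intro mult_left_mono) auto
          then show ?thesis by (simp add: abs_mult algebra_simps)
        qed (simp add: K(4))
      qed
    qed measurable
    \<comment> \<open>By Fubini's theorem the mollifying kernel may act on the test function instead of on \<open>U\<close>.\<close>
    define inner where "inner n y = (LBINT x. \<xi> x * peak ((c n)\<^sup>2) (y - x))" for n y
    have swap: "(LBINT x. \<xi> x * A n x) = (LBINT y. U y * inner n y)" for n
    proof -
      let ?e = "(c n)\<^sup>2"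
      have e: "?e > 0" using c[of n] by simp
      let ?f = "\<lambda>x y. \<xi> x * peak ?e (y - x) * U y"
      have "integrable (lborel \<Otimes>\<^sub>M lborel) (case_prod ?f)"
      proof (rule Bochner_Integration.integrable_bound)
        show "integrable (lborel \<Otimes>\<^sub>M lborel) (\<lambda>z :: (real\<times>real)\<times>(real\<times>real). (4 / ?e) * (\<xi> (fst z) * U (snd z)))"
          using integrable_product_functions[OF chi_int U_integrable] by (simp add: lborel_prod)
        show "AE z in lborel \<Otimes>\<^sub>M lborel. norm (case_prod ?f z) \<le> norm ((4 / ?e) * (\<xi> (fst z) * U (snd z)))"
        proof (rule AE_I2)
          fix z
          have "\<bar>peak ?e (snd z - fst z)\<bar> * \<bar>\<xi> (fst z) * U (snd z)\<bar> \<le> (4 / ?e) * \<bar>\<xi> (fst z) * U (snd z)\<bar>"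
            using peak_bounds[OF e, of "snd z - fst z"] by (intro mult_right_mono) auto
          then show "norm (case_prod ?f z) \<le> norm ((4 / ?e) * (\<xi> (fst z) * U (snd z)))"
            by (simp add: case_prod_beta abs_mult mult_ac)
        qed
      qed measurable
      from lborel_pair.Fubini_integral[OF this]
      have "(LBINT y. (LBINT x. ?f x y)) = (LBINT x. (LBINT y. ?f x y))" .
      moreover have "(LBINT x. ?f x y) = U y * inner n y" for y
        by (simp add: inner_def)
      moreover have "(LBINT y. ?f x y) = \<xi> x * A n x" for x
        by (simp add: A_def mult.assoc)
      ultimately show ?thesis by (simp only:)
    qed
    have inner_eq: "inner n y = (LBINT v. \<xi> (y + c n *\<^sub>R v) * \<eta> (- (c n *\<^sub>R v)) * profile v)" for n y
    proof -
      let ?e = "(c n)\<^sup>2"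
      have "inner n y = (LBINT x. \<xi> (y + x) * peak ?e (y - (y + x)))"
        unfolding inner_def by (rule integral_translate(1)[symmetric]) measurable
      also have "\<dots> = \<bar>c n\<bar> ^ DIM(real \<times> real) * (LBINT v. \<xi> (y + c n *\<^sub>R v) * peak ?e (y - (y + c n *\<^sub>R v)))"
        by (rule integral_scale) (use c[of n] in auto)
      also have "\<dots> = (LBINT v. (c n)\<^sup>2 * (\<xi> (y + c n *\<^sub>R v) * peak ?e (c n *\<^sub>R (- v))))"
        by (simp add: power2_eq_square)
      also have "\<dots> = (LBINT v. \<xi> (y + c n *\<^sub>R v) * \<eta> (- (c n *\<^sub>R v)) * profile v)"
      proof (rule Bochner_Integration.integral_cong[OF refl])
        fix v
        have "?e * (\<xi> (y + c n *\<^sub>R v) * peak ?e (c n *\<^sub>R (- v))) = \<xi> (y + c n *\<^sub>R v) * (?e * peak ?e (c n *\<^sub>R (- v)))"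
          by simp
        also have "\<dots> = \<xi> (y + c n *\<^sub>R v) * (\<eta> (c n *\<^sub>R (- v)) * profile (- v))"
          unfolding peak_scale[OF c(1)] ..
        finally show "?e * (\<xi> (y + c n *\<^sub>R v) * peak ?e (c n *\<^sub>R (- v))) = \<xi> (y + c n *\<^sub>R v) * \<eta> (- (c n *\<^sub>R v)) * profile v"
          by (simp add: profile_def)
      qed
      finally show ?thesis .
    qed
    have le: "norm (\<xi> (y + c n *\<^sub>R v) * \<eta> (- (c n *\<^sub>R v)) * profile v) \<le> B * profile v" for n y v
    proof -
      have "\<bar>\<xi> (y + c n *\<^sub>R v)\<bar> * \<bar>\<eta> (- (c n *\<^sub>R v))\<bar> \<le> B * 1"
        using B \<eta>_nonneg \<eta>_le_1 by (intro mult_mono) auto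
      then show ?thesis using profile_pos[of v] by (simp add: abs_mult)
    qed
    have Bp: "integrable lborel (\<lambda>v. B * profile v)" using profile_integrable by simp
    have inner_lim: "(\<lambda>n. inner n y) \<longlonglongrightarrow> \<xi> y * m" for y
    proof -
      have "(\<lambda>n. inner n y) \<longlonglongrightarrow> (LBINT v. \<xi> y * 1 * profile v)"
        unfolding inner_eq
      proof (rule integral_dominated_convergence[OF _ _ Bp])
        show "AE v in lborel. (\<lambda>n. \<xi> (y + c n *\<^sub>R v) * \<eta> (- (c n *\<^sub>R v)) * profile v) \<longlonglongrightarrow> \<xi> y * 1 * profile v"
        proof (rule AE_I2)
          fix v
          have t: "(\<lambda>n. y + c n *\<^sub>R v) \<longlonglongrightarrow> y + 0 *\<^sub>R v" "(\<lambda>n. - (c n *\<^sub>R v)) \<longlonglongrightarrow> - (0 *\<^sub>R v)"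
            by (rule tendsto_add tendsto_const tendsto_scaleR tendsto_minus c0)+
          have "(\<lambda>n. \<xi> (y + c n *\<^sub>R v)) \<longlonglongrightarrow> \<xi> (y + 0 *\<^sub>R v)" "(\<lambda>n. \<eta> (- (c n *\<^sub>R v))) \<longlonglongrightarrow> \<eta> (- (0 *\<^sub>R v))"
          proof -
            have ic: "isCont \<xi> z" "isCont \<eta> z" for z
              using contx[of UNIV] \<eta>_continuous[of UNIV] by (metis UNIV_I continuous_on_eq_continuous_at open_UNIV)+
            show "(\<lambda>n. \<xi> (y + c n *\<^sub>R v)) \<longlonglongrightarrow> \<xi> (y + 0 *\<^sub>R v)" "(\<lambda>n. \<eta> (- (c n *\<^sub>R v))) \<longlonglongrightarrow> \<eta> (- (0 *\<^sub>R v))"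
              by (rule isCont_tendsto_compose[OF ic(1) t(1)], rule isCont_tendsto_compose[OF ic(2) t(2)])
          qed
          moreover have "\<eta> 0 = 1" using \<eta>_one[of 0] \<rho>0 by simp
          ultimately show "(\<lambda>n. \<xi> (y + c n *\<^sub>R v) * \<eta> (- (c n *\<^sub>R v)) * profile v) \<longlonglongrightarrow> \<xi> y * 1 * profile v"
            by (intro tendsto_intros) auto
        qed
        show "AE v in lborel. norm (\<xi> (y + c n *\<^sub>R v) * \<eta> (- (c n *\<^sub>R v)) * profile v) \<le> B * profile v" for n
          by (intro AE_I2 le)
      qed measurable
      then show ?thesis by (simp add: m_def)
    qed
    have inner_bd: "\<bar>inner n y\<bar> \<le> B * m" for n y
    proof -
      have i: "integrable lborel (\<lambda>v. \<xi> (y + c n *\<^sub>R v) * \<eta> (- (c n *\<^sub>R v)) * profile v)"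
      proof (rule Bochner_Integration.integrable_bound[OF Bp])
        show "AE v in lborel. norm (\<xi> (y + c n *\<^sub>R v) * \<eta> (- (c n *\<^sub>R v)) * profile v) \<le> norm (B * profile v)"
          by (intro AE_I2 order_trans[OF le]) simp
      qed measurable
      have "\<bar>inner n y\<bar> \<le> (LBINT v. \<bar>\<xi> (y + c n *\<^sub>R v) * \<eta> (- (c n *\<^sub>R v)) * profile v\<bar>)"
        unfolding inner_eq by (rule integral_abs_bound)
      also have "\<dots> \<le> (LBINT v. B * profile v)"
        using le[of y n] by (intro integral_mono integrable_abs[OF i] Bp) (simp only: real_norm_def)
      finally show ?thesis by (simp add: m_def)
    qed
    have [measurable]: "inner n \<in> borel_measurable borel" for n
      unfolding inner_def[abs_def] by measurable
    have lim2: "(\<lambda>n. LBINT y. U y * inner n y) \<longlonglongrightarrow> (LBINT y. U y * (\<xi> y * m))"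
    proof (rule integral_dominated_convergence[where w = "\<lambda>y. B * m * U y"])
      show "integrable lborel (\<lambda>y. B * m * U y)" using U_integrable by simp
      show "AE y in lborel. (\<lambda>n. U y * inner n y) \<longlonglongrightarrow> U y * (\<xi> y * m)"
        using inner_lim by (auto intro!: tendsto_mult_left)
      show "AE y in lborel. norm (U y * inner n y) \<le> B * m * U y" for n
        using mult_right_mono[OF inner_bd U_nonneg] U_nonneg by (auto simp: abs_mult mult.commute[of "U _"])
    qed measurable
    have eq: "(LBINT x. \<xi> x * W x) = (LBINT y. U y * (\<xi> y * m))"
      using LIMSEQ_unique[OF lim1[unfolded swap] lim2] .
    have iU: "integrable lborel (\<lambda>y. U y * (\<xi> y * m))"
    proof (rule Bochner_Integration.integrable_bound)
      show "integrable lborel (\<lambda>y. B * m * U y)" using U_integrable by simp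
      show "AE y in lborel. norm (U y * (\<xi> y * m)) \<le> norm (B * m * U y)"
      proof (rule AE_I2)
        fix y
        have "\<bar>\<xi> y\<bar> * (\<bar>m\<bar> * \<bar>U y\<bar>) \<le> B * (\<bar>m\<bar> * \<bar>U y\<bar>)" by (intro mult_right_mono B) simp
        then show "norm (U y * (\<xi> y * m)) \<le> norm (B * m * U y)" using B(1) by (simp add: abs_mult mult_ac)
      qed
    qed measurable
    have "(\<lambda>x. \<xi> x * (indicator ?V x *\<^sub>R W x - m * (indicator ?V x * U x))) = (\<lambda>x. \<xi> x * W x - U x * (\<xi> x * m))"
    proof
      fix x
      show "\<xi> x * (indicator ?V x *\<^sub>R W x - m * (indicator ?V x * U x)) = \<xi> x * W x - U x * (\<xi> x * m)"
        using K(3) K(4)[of x] by (cases "x \<in> K") (auto simp: indicator_def algebra_simps)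
    qed
    then show ?thesis using eq iW iU by simp
  qed
  have "AE x in lborel. x \<in> ?V \<longrightarrow> indicator ?V x *\<^sub>R W x - m * (indicator ?V x * U x) = 0"
  proof (rule fundamental_lemma_real[OF open_ball])
    show "(\<lambda>x. indicator ?V x *\<^sub>R W x - m * (indicator ?V x * U x)) \<in> borel_measurable borel"
      by (intro borel_measurable_diff[OF mW] borel_measurable_times borel_measurable_const
          borel_measurable_indicator U_borel) simp
    fix a b assume ab: "cbox a b \<subseteq> ?V"
    have "integrable lborel (\<lambda>x. indicator (cbox a b) x *\<^sub>R W x)"
      by (intro borel_integrable_compact compact_cbox continuous_on_subset[OF contW ab])
    moreover have "integrable lborel (\<lambda>x. indicator (cbox a b) x *\<^sub>R U x)"
      using U_integrable by (intro integrable_mult_indicator) auto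
    ultimately have "integrable lborel (\<lambda>x. indicator (cbox a b) x *\<^sub>R W x - m * (indicator (cbox a b) x *\<^sub>R U x))"
      by (intro Bochner_Integration.integrable_diff integrable_mult_right)
    moreover have "(\<lambda>x. indicator (cbox a b) x *\<^sub>R W x - m * (indicator (cbox a b) x *\<^sub>R U x)) =
        (\<lambda>x. indicator (cbox a b) x *\<^sub>R (indicator ?V x *\<^sub>R W x - m * (indicator ?V x * U x)))"
    proof
      fix x
      show "indicator (cbox a b) x *\<^sub>R W x - m * (indicator (cbox a b) x *\<^sub>R U x) =
        indicator (cbox a b) x *\<^sub>R (indicator ?V x *\<^sub>R W x - m * (indicator ?V x * U x))"
        using ab by (cases "x \<in> cbox a b") auto
    qed
    ultimately show "integrable lborel (\<lambda>x. indicator (cbox a b) x *\<^sub>R (indicator ?V x *\<^sub>R W x - m * (indicator ?V x * U x)))"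
      by simp
  qed (rule key)
  then have "AE x in lborel. x \<in> ?V \<longrightarrow> W x / m = U x"
    by (rule AE_mp) (use m in \<open>auto simp: field_simps\<close>)
  moreover have "continuous_on ?V (\<lambda>x. W x / m)"
    using m by (intro continuous_intros contW) auto
  ultimately show ?thesis by blast
qed

end

section \<open>Reflections preserve planar measure\<close>

text \<open>The two coordinates are substituted one after the other. If \<open>a = 0\<close> the map exchanges the axes, up to
  a shear and scaling, and is treated separately.\<close>

lemma nn_integral_linear_plane:
  fixes f :: "real \<times> real \<Rightarrow> ennreal"
  assumes det: "\<bar>a * d - b * c\<bar> = 1" and [measurable]: "f \<in> borel_measurable borel"
  shows "(\<integral>\<^sup>+z. f (a * fst z + b * snd z, c * fst z + d * snd z) \<partial>lborel) = (\<integral>\<^sup>+z. f z \<partial>lborel)"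
proof -
  have fst': "(\<integral>\<^sup>+z. g z \<partial>lborel) = (\<integral>\<^sup>+x. \<integral>\<^sup>+y. g (x, y) \<partial>lborel \<partial>lborel)"
    and snd': "(\<integral>\<^sup>+z. g z \<partial>lborel) = (\<integral>\<^sup>+y. \<integral>\<^sup>+x. g (x, y) \<partial>lborel \<partial>lborel)"
    if [measurable]: "g \<in> borel_measurable borel" for g :: "real \<times> real \<Rightarrow> ennreal"
  proof -
    have m: "g \<in> borel_measurable (lborel \<Otimes>\<^sub>M lborel)" by (simp add: lborel_prod)
    show "(\<integral>\<^sup>+z. g z \<partial>lborel) = (\<integral>\<^sup>+x. \<integral>\<^sup>+y. g (x, y) \<partial>lborel \<partial>lborel)"
      using lborel.nn_integral_fst[OF m] by (simp add: lborel_prod)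
    show "(\<integral>\<^sup>+z. g z \<partial>lborel) = (\<integral>\<^sup>+y. \<integral>\<^sup>+x. g (x, y) \<partial>lborel \<partial>lborel)"
      using lborel_pair.nn_integral_snd[of "\<lambda>(x, y). g (x, y)"] m by (simp add: lborel_prod case_prod_beta')
  qed
  have sub: "(\<integral>\<^sup>+x. h (t + k * x) \<partial>lborel) = ennreal (1 / \<bar>k\<bar>) * (\<integral>\<^sup>+x. h x \<partial>lborel)"
    if k: "k \<noteq> 0" and [measurable]: "h \<in> borel_measurable borel" for h :: "real \<Rightarrow> ennreal" and t k
  proof -
    have "(\<integral>\<^sup>+x. h x \<partial>lborel) = ennreal \<bar>k\<bar> * (\<integral>\<^sup>+x. h (t + k * x) \<partial>lborel)"
      by (rule nn_integral_real_affine[OF _ k]) measurable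
    then have "ennreal (1 / \<bar>k\<bar>) * (\<integral>\<^sup>+x. h x \<partial>lborel) = (ennreal (1 / \<bar>k\<bar>) * ennreal \<bar>k\<bar>) * (\<integral>\<^sup>+x. h (t + k * x) \<partial>lborel)"
      by (simp add: mult.assoc)
    also have "ennreal (1 / \<bar>k\<bar>) * ennreal \<bar>k\<bar> = 1" using k by (simp add: ennreal_mult[symmetric])
    finally show ?thesis by simp
  qed
  have [measurable]: "f \<in> borel_measurable (borel \<Otimes>\<^sub>M borel)" using assms(2) by (simp add: borel_prod)
  let ?I = "\<integral>\<^sup>+z. f z \<partial>lborel"
  have cancel: "ennreal p * (ennreal q * X) = X" if "p * q = 1" "p \<ge> 0" "q \<ge> 0" for p q X
    using that by (simp add: mult.assoc[symmetric] ennreal_mult[symmetric])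
  have "(\<integral>\<^sup>+z. f (a * fst z + b * snd z, c * fst z + d * snd z) \<partial>lborel) =
      (\<integral>\<^sup>+y. \<integral>\<^sup>+x. f (a * x + b * y, c * x + d * y) \<partial>lborel \<partial>lborel)"
  proof -
    have m: "(\<lambda>z. f (a * fst z + b * snd z, c * fst z + d * snd z)) \<in> borel_measurable borel"
      by (rule measurable_compose[OF borel_measurable_continuous_onI assms(2)]) (intro continuous_intros)
    show ?thesis using snd'[OF m] by simp
  qed
  also have "\<dots> = ?I"
  proof (cases "a = 0")
    case False
    define e where "e = d - b * c / a"
    have ae: "a * e = a * d - b * c" using False by (simp add: e_def field_simps)
    then have e: "e \<noteq> 0" "\<bar>a\<bar> * \<bar>e\<bar> = 1" using det by (auto simp: abs_mult[symmetric])
    have "(\<integral>\<^sup>+x. f (a * x + b * y, c * x + d * y) \<partial>lborel) = ennreal (1 / \<bar>a\<bar>) * (\<integral>\<^sup>+u. f (u, c / a * u + e * y) \<partial>lborel)" for y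
    proof -
      have "(\<integral>\<^sup>+x. f (a * x + b * y, c * x + d * y) \<partial>lborel) =
          (\<integral>\<^sup>+x. f (b * y + a * x, c / a * (b * y + a * x) + e * y) \<partial>lborel)"
        by (intro nn_integral_cong arg_cong[where f = f]) (use False in \<open>simp add: e_def field_simps\<close>)
      then show ?thesis using sub[OF False, of "\<lambda>u. f (u, c / a * u + e * y)" "b * y"] by simp
    qed
    then have "(\<integral>\<^sup>+y. \<integral>\<^sup>+x. f (a * x + b * y, c * x + d * y) \<partial>lborel \<partial>lborel) =
        (\<integral>\<^sup>+y. ennreal (1 / \<bar>a\<bar>) * (\<integral>\<^sup>+u. f (u, c / a * u + e * y) \<partial>lborel) \<partial>lborel)" by simp
    also have "\<dots> = ennreal (1 / \<bar>a\<bar>) * (\<integral>\<^sup>+y. \<integral>\<^sup>+u. f (u, c / a * u + e * y) \<partial>lborel \<partial>lborel)"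
      by (rule nn_integral_cmult) measurable
    also have "(\<integral>\<^sup>+y. \<integral>\<^sup>+u. f (u, c / a * u + e * y) \<partial>lborel \<partial>lborel) = (\<integral>\<^sup>+u. \<integral>\<^sup>+y. f (u, c / a * u + e * y) \<partial>lborel \<partial>lborel)"
    proof -
      have m: "(\<lambda>z. f (fst z, c / a * fst z + e * snd z)) \<in> borel_measurable borel"
        by (rule measurable_compose[OF borel_measurable_continuous_onI assms(2)]) (intro continuous_intros)
      show ?thesis using fst'[OF m] snd'[OF m] by simp
    qed
    also have "\<dots> = (\<integral>\<^sup>+u. ennreal (1 / \<bar>e\<bar>) * (\<integral>\<^sup>+y. f (u, y) \<partial>lborel) \<partial>lborel)"
      using sub[OF e(1), of "\<lambda>y. f (_, y)"] by simp
    also have "\<dots> = ennreal (1 / \<bar>e\<bar>) * (\<integral>\<^sup>+u. \<integral>\<^sup>+y. f (u, y) \<partial>lborel \<partial>lborel)"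
      by (rule nn_integral_cmult) measurable
    also have "(\<integral>\<^sup>+u. \<integral>\<^sup>+y. f (u, y) \<partial>lborel \<partial>lborel) = ?I" using fst'[OF assms(2)] by simp
    also have "ennreal (1 / \<bar>a\<bar>) * (ennreal (1 / \<bar>e\<bar>) * ?I) = ?I"
      by (rule cancel) (use e False in \<open>auto simp: field_simps\<close>)
    finally show ?thesis .
  next
    case True
    then have bc: "\<bar>b\<bar> * \<bar>c\<bar> = 1" "b \<noteq> 0" "c \<noteq> 0" using det by (auto simp: abs_mult)
    have "(\<integral>\<^sup>+x. f (a * x + b * y, c * x + d * y) \<partial>lborel) = ennreal (1 / \<bar>c\<bar>) * (\<integral>\<^sup>+u. f (b * y, u) \<partial>lborel)" for y
      using sub[OF bc(3), of "\<lambda>u. f (b * y, u)" "d * y"] True by (simp add: add.commute)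
    then have "(\<integral>\<^sup>+y. \<integral>\<^sup>+x. f (a * x + b * y, c * x + d * y) \<partial>lborel \<partial>lborel) =
        (\<integral>\<^sup>+y. ennreal (1 / \<bar>c\<bar>) * (\<integral>\<^sup>+u. f (0 + b * y, u) \<partial>lborel) \<partial>lborel)" by simp
    also have "\<dots> = ennreal (1 / \<bar>c\<bar>) * (\<integral>\<^sup>+y. \<integral>\<^sup>+u. f (0 + b * y, u) \<partial>lborel \<partial>lborel)"
      by (rule nn_integral_cmult) measurable
    also have "(\<integral>\<^sup>+y. \<integral>\<^sup>+u. f (0 + b * y, u) \<partial>lborel \<partial>lborel) = ennreal (1 / \<bar>b\<bar>) * (\<integral>\<^sup>+y. \<integral>\<^sup>+u. f (y, u) \<partial>lborel \<partial>lborel)"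
      by (rule sub[OF bc(2)]) measurable
    also have "(\<integral>\<^sup>+u. \<integral>\<^sup>+y. f (u, y) \<partial>lborel \<partial>lborel) = ?I" using fst'[OF assms(2)] by simp
    also have "ennreal (1 / \<bar>c\<bar>) * (ennreal (1 / \<bar>b\<bar>) * ?I) = ?I"
      by (rule cancel) (use bc in \<open>auto simp: field_simps\<close>)
    finally show ?thesis .
  qed
  finally show ?thesis .
qed

lemma distr_reflect_plane:
  fixes n :: "real \<times> real"
  assumes n: "norm n = 1" shows "distr lborel borel (reflect n) = lborel"
proof (rule measure_eqI)
  fix A assume "A \<in> sets (distr lborel borel (reflect n))"
  then have [measurable]: "A \<in> sets borel" by simp
  obtain p q where pq: "n = (p, q)" by (cases n)
  have u: "p\<^sup>2 + q\<^sup>2 = 1" using n by (simp add: pq norm_Pair real_sqrt_eq_1_iff)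
  have "(1 - 2 * p\<^sup>2) * (1 - 2 * q\<^sup>2) - (- 2 * p * q) * (- 2 * p * q) = 1 - 2 * (p\<^sup>2 + q\<^sup>2)"
    by (simp add: power2_eq_square algebra_simps)
  then have det: "\<bar>(1 - 2 * p\<^sup>2) * (1 - 2 * q\<^sup>2) - (- 2 * p * q) * (- 2 * p * q)\<bar> = 1" using u by simp
  have r: "reflect n z = ((1 - 2 * p\<^sup>2) * fst z + (- 2 * p * q) * snd z, (- 2 * p * q) * fst z + (1 - 2 * q\<^sup>2) * snd z)" for z
    by (cases z) (simp add: reflect_def pq power2_eq_square algebra_simps)
  have "emeasure (distr lborel borel (reflect n)) A = (\<integral>\<^sup>+z. indicator A z \<partial>distr lborel borel (reflect n))"
    by (simp add: nn_integral_indicator)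
  also have "\<dots> = (\<integral>\<^sup>+z. indicator A (reflect n z) \<partial>lborel)" by (rule nn_integral_distr) auto
  also have "\<dots> = (\<integral>\<^sup>+z. indicator A z \<partial>lborel)"
    unfolding r by (rule nn_integral_linear_plane[OF det]) measurable
  finally show "emeasure (distr lborel borel (reflect n)) A = emeasure lborel A" by simp
qed simp

section \<open>From almost everywhere to everywhere\<close>

lemma AE_continuous_le:
  fixes f g :: "'a::euclidean_space \<Rightarrow> real"
  assumes S: "open S" and f: "continuous_on S f" and g: "continuous_on S g"
    and ae: "AE y in lborel. y \<in> S \<longrightarrow> f y \<le> g y" and x: "x \<in> S"
  shows "f x \<le> g x"
proof (rule ccontr)
  let ?N = "S \<inter> (\<lambda>y. f y - g y) -` {0<..}"
  assume "\<not> f x \<le> g x"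
  then have ne: "?N \<noteq> {}" using x by auto
  have o: "open ?N" by (intro continuous_open_preimage continuous_on_diff f g S) simp
  have "AE y in lborel. y \<notin> ?N" by (rule AE_mp[OF ae]) auto
  then have "?N \<in> null_sets lborel" using o by (subst AE_iff_null_sets) auto
  then have "?N \<in> null_sets lebesgue" by (rule null_sets_completionI)
  then have "negligible ?N" by (simp only: negligible_iff_null_sets)
  then show False using open_not_negligible[OF o ne] by blast
qed

lemma glue_continuous:
  fixes U :: "'a::euclidean_space \<Rightarrow> real"
  assumes loc: "\<And>x. x \<in> \<Omega> \<Longrightarrow> \<exists>r w. r > 0 \<and> continuous_on (ball x r) w \<and> (AE y in lborel. y \<in> ball x r \<longrightarrow> w y = U y)"
  shows "\<exists>w. continuous_on \<Omega> w \<and> (AE y in lborel. y \<in> \<Omega> \<longrightarrow> w y = U y)"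
proof -
  obtain r w where r: "\<And>x. x \<in> \<Omega> \<Longrightarrow> r x > (0::real)"
    and w: "\<And>x. x \<in> \<Omega> \<Longrightarrow> continuous_on (ball x (r x)) (w x)"
    and ae: "\<And>x. x \<in> \<Omega> \<Longrightarrow> AE y in lborel. y \<in> ball x (r x) \<longrightarrow> w x y = U y"
    using loc by metis
  define W where "W x = w x x" for x
  have eq: "W y = w x y" if x: "x \<in> \<Omega>" and y: "y \<in> \<Omega>" "y \<in> ball x (r x)" for x y
  proof -
    let ?S = "ball x (r x) \<inter> ball y (r y)"
    have S: "open ?S" "y \<in> ?S" using y r[OF y(1)] by auto
    have c: "continuous_on ?S (w x)" "continuous_on ?S (w y)"
      using w[OF x] w[OF y(1)] continuous_on_subset by blast+
    have a: "AE z in lborel. z \<in> ?S \<longrightarrow> w x z = w y z"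
      using ae[OF x] ae[OF y(1)] by eventually_elim auto
    have "w x y \<le> w y y" by (rule AE_continuous_le[OF S(1) c _ S(2)]) (use a in \<open>auto elim: AE_mp\<close>)
    moreover have "w y y \<le> w x y" by (rule AE_continuous_le[OF S(1) c(2,1) _ S(2)]) (use a in \<open>auto elim: AE_mp\<close>)
    ultimately show ?thesis by (simp add: W_def)
  qed
  have "continuous_on \<Omega> W"
    unfolding continuous_on_eq_continuous_within
  proof
    fix x assume x: "x \<in> \<Omega>"
    have "continuous (at x within \<Omega>) (w x)"
      using w[OF x] r[OF x] by (auto simp: continuous_on_eq_continuous_at intro: continuous_at_imp_continuous_at_within)
    then show "continuous (at x within \<Omega>) W"
    proof (rule continuous_transform_within[OF _ r[OF x] x])
      fix y assume "y \<in> \<Omega>" "dist y x < r x"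
      then show "w x y = W y" using eq[OF x] by (simp add: dist_commute)
    qed
  qed
  moreover have "AE y in lborel. y \<in> \<Omega> \<longrightarrow> W y = U y"
  proof -
    obtain F where F: "F \<subseteq> (\<lambda>x. ball x (r x)) ` \<Omega>" "countable F" "\<Union>F = \<Union>((\<lambda>x. ball x (r x)) ` \<Omega>)"
      using Lindelof[of "(\<lambda>x. ball x (r x)) ` \<Omega>"] by auto
    have "AE y in lborel. \<forall>B\<in>F. y \<in> B \<longrightarrow> y \<in> \<Omega> \<longrightarrow> W y = U y"
    proof (subst AE_ball_countable[OF F(2)], rule ballI)
      fix B assume "B \<in> F"
      then obtain x where x: "x \<in> \<Omega>" "B = ball x (r x)" using F(1) by auto
      show "AE y in lborel. y \<in> B \<longrightarrow> y \<in> \<Omega> \<longrightarrow> W y = U y"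
        using ae[OF x(1)] by eventually_elim (use eq[OF x(1)] x(2) in auto)
    qed
    then show ?thesis
    proof (rule AE_mp, intro AE_I2 impI)
      fix y assume *: "\<forall>B\<in>F. y \<in> B \<longrightarrow> y \<in> \<Omega> \<longrightarrow> W y = U y" "y \<in> \<Omega>"
      then have "y \<in> \<Union>F" unfolding F(3) by (intro UN_I[of y]) (auto simp: r)
      then show "W y = U y" using * by auto
    qed
  qed
  ultimately show ?thesis by blast
qed

lemma (in planar) continuous_version: "\<exists>w. continuous_on \<Omega> w \<and> (AE y in lborel. y \<in> \<Omega> \<longrightarrow> w y = U y)"
proof (rule glue_continuous)
  fix x assume "x \<in> \<Omega>"
  then obtain e where e: "e > 0" "cball x e \<subseteq> \<Omega>" using open_domain open_contains_cball by blast
  from local_continuity[of "e / 3" x] e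
  obtain w where "continuous_on (ball x (e / 3)) w" "AE y in lborel. y \<in> ball x (e / 3) \<longrightarrow> w y = U y" by auto
  then show "\<exists>r w. r > 0 \<and> continuous_on (ball x r) w \<and> (AE y in lborel. y \<in> ball x r \<longrightarrow> w y = U y)"
    using e(1) by (intro exI[of _ "e / 3"] exI[of _ w]) auto
qed

text \<open>Two points \<open>p\<close> and \<open>q\<close> of equal norm are exchanged by the reflection with normal \<open>q - p\<close>.\<close>

lemma (in planar) continuous_reflection_le:
  assumes w: "continuous_on \<Omega> w" "AE y in lborel. y \<in> \<Omega> \<longrightarrow> w y = U y"
    and dom: "\<And>n x. norm n = 1 \<Longrightarrow> fst n \<ge> 0 \<Longrightarrow> x \<bullet> n \<ge> 0 \<Longrightarrow> reflect n x \<in> \<Omega> \<Longrightarrow> x \<in> \<Omega>"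
    and p: "p \<in> \<Omega>" and q: "q \<in> \<Omega>" and pq: "norm p = norm q" "fst p \<le> fst q"
  shows "w p \<le> w q"
proof (cases "p = q")
  case False
  define n where "n = (1 / norm (q - p)) *\<^sub>R (q - p)"
  have n: "norm n = 1" "fst n \<ge> 0" using False pq(2) by (auto simp: n_def)
  have pp: "p \<bullet> p = q \<bullet> q" using pq(1) by (simp add: power2_norm_eq_inner[symmetric])
  have nn: "(norm (q - p))\<^sup>2 = - 2 * (p \<bullet> (q - p))"
    using pp by (simp add: power2_norm_eq_inner inner_diff inner_commute)
  have N: "norm (q - p) > 0" using False by simp
  have pn: "p \<bullet> n = - norm (q - p) / 2"
  proof -
    have "p \<bullet> n = (p \<bullet> (q - p)) / norm (q - p)" by (simp add: n_def)
    also have "p \<bullet> (q - p) = - (norm (q - p))\<^sup>2 / 2" using nn by simp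
    finally show ?thesis using N by (simp add: power2_eq_square)
  qed
  have rp: "reflect n p = q"
  proof -
    have "reflect n p = p + norm (q - p) *\<^sub>R n" by (simp add: reflect_def pn)
    also have "\<dots> = q" using N by (simp add: n_def)
    finally show ?thesis .
  qed
  let ?S = "\<Omega> \<inter> reflect n -` \<Omega> \<inter> {x. x \<bullet> n < 0}"
  have S: "open ?S"
    by (intro open_Int open_domain open_vimage open_Collect_less continuous_intros continuous_reflect)
  have pS: "p \<in> ?S" using p q rp pn N by simp
  have cw: "continuous_on ?S (\<lambda>x. w (reflect n x))"
    by (rule continuous_on_compose2[OF w(1) continuous_reflect]) auto
  note inv = distr_reflect_plane[OF n(1)]
  have wr: "AE y in lborel. reflect n y \<in> \<Omega> \<longrightarrow> w (reflect n y) = U (reflect n y)"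
  proof -
    have "AE y in distr lborel borel (reflect n). y \<in> \<Omega> \<longrightarrow> w y = U y" unfolding inv by (rule w(2))
    from AE_distrD[OF _ this] show ?thesis by simp
  qed
  have le: "AE x in lborel. x \<bullet> n < 0 \<longrightarrow> U x \<le> U (reflect n x)"
    by (rule reflection_comparison[OF n(1) inv dom[OF n]])
  have "w p \<le> w (reflect n p)"
  proof (rule AE_continuous_le[OF S continuous_on_subset[OF w(1)] cw _ pS])
    show "AE y in lborel. y \<in> ?S \<longrightarrow> w y \<le> w (reflect n y)"
      using w(2) wr le by eventually_elim auto
  qed auto
  then show ?thesis by (simp add: rp)
qed simp

section \<open>The sector\<close>

text \<open>The condition \<open>|\<theta>| < \<theta>\<^sub>0\<close> is equivalent to \<open>cos \<theta> > cos \<theta>\<^sub>0\<close> for angles in \<open>(- \<pi>, \<pi>]\<close>. The right-hand side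
  excludes the origin by itself, and also the slit if \<open>\<theta>\<^sub>0 = \<pi>\<close>.\<close>

lemma sector_eq:
  assumes "0 < \<theta>\<^sub>0" "\<theta>\<^sub>0 \<le> pi"
  shows "sector \<theta>\<^sub>0 R = {x. norm x < R \<and> norm x * cos \<theta>\<^sub>0 < fst x}"
proof (intro set_eqI iffI)
  fix x :: "real \<times> real" assume "x \<in> sector \<theta>\<^sub>0 R"
  then obtain r \<theta> where x: "x = polar r \<theta>" "0 < r" "r < R" "\<bar>\<theta>\<bar> < \<theta>\<^sub>0" by (auto simp: sector_def)
  have "norm x = r" using x(2) by (simp add: x(1) polar_def norm_Pair power_mult_distrib distrib_left[symmetric])
  moreover have "cos \<theta>\<^sub>0 < cos \<bar>\<theta>\<bar>" using x(4) assms by (intro cos_monotone_0_pi) auto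
  ultimately show "x \<in> {x. norm x < R \<and> norm x * cos \<theta>\<^sub>0 < fst x}"
    using x(2,3) by (simp add: x(1) polar_def)
next
  fix x :: "real \<times> real" assume "x \<in> {x. norm x < R \<and> norm x * cos \<theta>\<^sub>0 < fst x}"
  then have x: "norm x < R" "norm x * cos \<theta>\<^sub>0 < fst x" by auto
  define r where "r = norm x"
  have r: "r > 0" using x(2) by (auto simp: r_def)
  have n: "r\<^sup>2 = (fst x)\<^sup>2 + (snd x)\<^sup>2" unfolding r_def by (cases x) (simp add: norm_Pair)
  have "(fst x / r)\<^sup>2 + (snd x / r)\<^sup>2 = 1" 
    unfolding power_divide add_divide_distrib[symmetric] n[symmetric] using r by simp
  then obtain t where t: "- pi < t" "t \<le> pi" "fst x / r = cos t" "snd x / r = sin t"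
    using sincos_principal_value sincos_total_2pi by (metis)
  have xp: "x = polar r t" using t(3,4) r by (cases x) (auto simp: polar_def field_simps)
  have "cos \<theta>\<^sub>0 < cos \<bar>t\<bar>" using x(2) r t(3) by (simp add: r_def[symmetric] field_simps)
  then have "\<bar>t\<bar> < \<theta>\<^sub>0"
    using cos_monotone_0_pi_le[of "\<theta>\<^sub>0" "\<bar>t\<bar>"] assms t by force
  then show "x \<in> sector \<theta>\<^sub>0 R" using xp r x(1) unfolding sector_def r_def by blast
qed

theorem proposition3p11:
  fixes \<theta>\<^sub>0 R :: real and u :: "real \<times> real \<Rightarrow> real"
  assumes "0 < \<theta>\<^sub>0" and "\<theta>\<^sub>0 \<le> pi" and "0 < R"
    and "variational_solution (sector \<theta>\<^sub>0 R) u"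
  shows "\<exists>w. continuous_representative (sector \<theta>\<^sub>0 R) u w \<and>
    (\<forall>r. 0 < r \<and> r < R \<longrightarrow>
      (\<forall>\<theta>. \<bar>\<theta>\<bar> < \<theta>\<^sub>0 \<longrightarrow> w (polar r \<theta>) \<le> w (polar r 0)))"
proof -
  let ?\<Omega> = "sector \<theta>\<^sub>0 R"
  note eq = sector_eq[OF assms(1,2), of R]
  have op: "open ?\<Omega>" unfolding eq
    by (intro open_Collect_conj open_Collect_less continuous_intros)
  have "?\<Omega> \<subseteq> ball 0 R" by (auto simp: eq)
  then have "bounded ?\<Omega>" using bounded_ball bounded_subset by blast
  then have fin: "emeasure lborel ?\<Omega> < \<infinity>" by (rule emeasure_bounded_finite)
  obtain U0 G where ws: "weak_solution ?\<Omega> U0 G" and u0: "AE x in lborel. x \<in> ?\<Omega> \<longrightarrow> u x = U0 x"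
    using variational_solution_weak_solution[OF op fin assms(4)] .
  obtain U where U: "nonneg_weak_solution ?\<Omega> U G" and u1: "AE x in lborel. U0 x = U x"
    using weak_solution.nonneg_version[OF ws] .
  interpret planar ?\<Omega> U G using U by (simp add: planar_def)
  obtain w where w: "continuous_on ?\<Omega> w" "AE y in lborel. y \<in> ?\<Omega> \<longrightarrow> w y = U y"
    using continuous_version by blast
  have dom: "x \<in> ?\<Omega>" if n: "norm n = 1" "fst n \<ge> 0" and x: "x \<bullet> n \<ge> 0" "reflect n x \<in> ?\<Omega>" for n x
  proof -
    have "0 \<le> (x \<bullet> n) * fst n" using n x by simp
    then have "fst (reflect n x) \<le> fst x" by (simp add: reflect_def mult.commute)
    then show ?thesis using x(2) by (simp add: eq norm_reflect[OF n(1)])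
  qed
  have "AE x in lborel. x \<in> ?\<Omega> \<longrightarrow> w x = u x" using w(2) u0 u1 by eventually_elim auto
  then have "AE x in lebesgue_on ?\<Omega>. w x = u x"
    using op by (subst AE_restrict_space_iff) (auto intro: AE_completion)
  with w(1) have "continuous_representative ?\<Omega> u w" by (simp add: continuous_representative_def)
  moreover have "w (polar r \<theta>) \<le> w (polar r 0)" if r: "0 < r" "r < R" and \<theta>: "\<bar>\<theta>\<bar> < \<theta>\<^sub>0" for r \<theta>
  proof (rule continuous_reflection_le[OF w dom])
    show "polar r \<theta> \<in> ?\<Omega>" "polar r 0 \<in> ?\<Omega>" using r \<theta> assms(1) unfolding sector_def by fastforce+
    show "norm (polar r \<theta>) = norm (polar r 0)"
      using r(1) by (simp add: polar_def norm_Pair power_mult_distrib distrib_left[symmetric])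
    show "fst (polar r \<theta>) \<le> fst (polar r 0)" using r(1) by (simp add: polar_def)
  qed
  ultimately show ?thesis by blast
qed

end
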